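(* Let $\Phi=(\Phi_i)_{i\in V}$ be positive reals, $x_0\in V$ and $t\ge0$. The law $\mathbb{P}^{\tilde Z}_{\Phi,x_0,t}$ of the time-changed reversed vertex-reinforced jump process $\tilde Z$ on the time interval $[0,t\wedge\tilde T]$, started at $x_0$ with initial condition $\Phi$, is absolutely continuous with respect to the law $\mathbb{P}_{x_0,t}$ of the Markov jump process $X$ with rates $W_{i,j}$ started at $x_0$ (observed on $[0,t\wedge T]$), with Radon–Nikodym derivative $$\frac{d\mathbb{P}^{\tilde Z}_{\Phi,x_0,t}}{d\mathbb{P}_{x_0,t}}=e^{-\frac12\left(\mathcal{E}\left(\sqrt{\Phi^2-2\ell(t\wedge T)},\sqrt{\Phi^2-2\ell(t\wedge T)}\right)-\mathcal{E}(\Phi,\Phi)\right)}\ \frac{\prod_{j\ne x_0}\Phi_j}{\prod_{j\ne X_{t\wedge T}}\sqrt{\Phi_j^2-2\ell_j(t\wedge T)}},$$ where $\ell_j(t)=\int_0^t1_{\{X_r=j\}}\,dr$ is the local time of $X$ and $T=\inf\{t\ge0:\ell_i(t)=\frac12\Phi_i^2\text{ for some }i\in V\}$.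
   Context: $G=(V,E)$ is a finite connected undirected graph without loops, with positive conductances $(W_e)_{e\in E}$; $W_{x,y}=W_{\{x,y\}}$ if $\{x,y\}\in E$ and $W_{x,y}=0$ otherwise. $\mathcal{E}(f,f)=\frac12\sum_{x,y\in V}W_{x,y}(f(x)-f(y))^2$ for $f\in\mathbb{R}^V$, and operations such as $\sqrt{\Phi^2-2\ell(t)}=(\sqrt{\Phi_i^2-2\ell_i(t)})_{i\in V}$ are coordinatewise. $X$ is the right-continuous continuous-time Markov jump process on $V$ with jump rate $W_{i,j}$ from $i$ to $j$; $\mathbb{P}_{x_0,t}$ is its law, started at $x_0$, on the time interval $[0,t]$. Reversed vertex-reinforced jump process (RVRJP): the continuous-time process $(\tilde Y_s)_{0\le s\le\tilde S}$ on $V$ started at $x_0$ such that, conditionally on $(\tilde Y_r,r\le s)$, if $\tilde Y_s=i$ the process jumps to a neighbour $j$ of $i$ at rate $W_{i,j}\tilde L_j(s)$, where $\tilde L_j(s)=\Phi_j-\int_0^s1_{\{\tilde Y_r=j\}}\,dr$; it is defined up to the stopping time $\tilde S=\inf\{s\ge0:\tilde L_j(s)=0\text{ for some }j\in V\}$. Time change: $\tilde D(s)=\frac12\sum_{i\in V}(\Phi_i^2-\tilde L_i^2(s))$, $\tilde Z_t=\tilde Y_{\tilde D^{-1}(t)}$, with local times $\ell^{\tilde Z}_i(t)=\int_0^t 1_{\{\tilde Z_r=i\}}\,dr$. Thus $\tilde Z$ jumps from $\tilde Z_t=i$ to a neighbour $j$, conditionally on the past at time $t$, at rate $W_{i,j}\sqrt{(\Phi_j^2-2\ell_j^{\tilde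 Z}(t))/(\Phi_i^2-2\ell_i^{\tilde Z}(t))}$, and stops at $\tilde T=\tilde D(\tilde S)=\inf\{t\ge0:\ell_i^{\tilde Z}(t)=\frac12\Phi_i^2\text{ for some }i\in V\}$. $\mathbb{P}^{\tilde Z}_{\Phi,x_0,t}$ is the law of $\tilde Z$ on $[0,t\wedge\tilde T]$ started at $x_0$ with initial condition $\Phi$. *)

theory Defs
  imports "HOL-Probability.Probability"
begin

text \<open>The vertex set is the whole finite type \<open>'v\<close>; edges are two-element sets of vertices.\<close>

definition connected_simple_graph :: "'v set set \<Rightarrow> bool" where
  "connected_simple_graph E \<longleftrightarrow>
     (\<forall>e\<in>E. card e = 2) \<and> (\<forall>x y. (x, y) \<in> {(u, v). {u, v} \<in> E}\<^sup>*)"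

definition conductance :: "'v set set \<Rightarrow> ('v set \<Rightarrow> real) \<Rightarrow> 'v \<Rightarrow> 'v \<Rightarrow> real" where
  "conductance E W x y = (if {x, y} \<in> E then W {x, y} else 0)"

definition dirichlet :: "('v::finite \<Rightarrow> 'v \<Rightarrow> real) \<Rightarrow> ('v \<Rightarrow> real) \<Rightarrow> real" where
  "dirichlet w f = (1/2) * (\<Sum>x\<in>UNIV. \<Sum>y\<in>UNIV. w x y * (f x - f y)\<^sup>2)"

text \<open>A path is a function on the half-line of nonnegative times; its values at negative times
  never matter. The vertices carry the discrete topology, so right-continuity means being
  constant on a right neighbourhood of every time.\<close>

definition right_continuous_path :: "(real \<Rightarrow> 'v) \<Rightarrow> bool" where
  "right_continuous_path x \<longleftrightarrow> (\<forall>s\<ge>0. \<forall>\<^sub>F r in at_right s. x r = x s)"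

definition path_space :: "(real \<Rightarrow> 'v) measure" where
  "path_space =
     restrict_space (PiM {0..} (\<lambda>_. count_space UNIV)) {x. right_continuous_path x}"

definition local_time :: "(real \<Rightarrow> 'v) \<Rightarrow> 'v \<Rightarrow> real \<Rightarrow> real" where
  "local_time x j s = (LBINT r:{0..s}. of_bool (x r = j))"

text \<open>The law of a process observed on a random time interval \<open>[0, \<tau>]\<close> is the law, on the path
  space, of the process kept constant after \<open>\<tau>\<close>.\<close>

definition stop_path :: "real \<Rightarrow> (real \<Rightarrow> 'v) \<Rightarrow> real \<Rightarrow> 'v" where
  "stop_path a x = (\<lambda>s\<in>{0..}. x (min s a))"

definition stopped_law ::
  "'w measure \<Rightarrow> ('w \<Rightarrow> real) \<Rightarrow> (real \<Rightarrow> 'w \<Rightarrow> 'v) \<Rightarrow> (real \<Rightarrow> 'v) measure" where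
  "stopped_law M \<tau> Y = distr M path_space (\<lambda>\<omega>. stop_path (\<tau> \<omega>) (\<lambda>s. Y s \<omega>))"

definition natural_filtration ::
  "'w measure \<Rightarrow> (real \<Rightarrow> 'w \<Rightarrow> 'v) \<Rightarrow> real \<Rightarrow> 'w measure" where
  "natural_filtration M Y s =
     sigma (space M) (\<Union>r\<in>{0..s}. {Y r -` A \<inter> space M | A. A \<in> UNIV})"

text \<open>First jump strictly after \<open>s\<close>; it is \<open>\<infinity>\<close> if there is none.\<close>

definition next_jump :: "(real \<Rightarrow> 'v) \<Rightarrow> real \<Rightarrow> ereal" where
  "next_jump x s = (INF r\<in>{r. s < r \<and> x r \<noteq> x s}. ereal r)"

text \<open>\<open>rate x r j\<close> is the rate of jumping to \<open>j\<close> at time \<open>r\<close> when the trajectory is \<open>x\<close>; it is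
  meant to depend on \<open>x\<close> only up to time \<open>r\<close>. That the process jumps at these rates
  conditionally on its past up to \<open>s\<close> means that, given this past, the time and the target of
  the first jump after \<open>s\<close> have the density
  \<open>(r, j) \<mapsto> rate y r j * exp (- \<integral>\<^sub>s\<^sup>r (\<Sum>k. rate y q k) dq)\<close>,
  where \<open>y\<close> is the trajectory that stays after \<open>s\<close> where it was at time \<open>s\<close>.\<close>

definition jump_density ::
  "((real \<Rightarrow> 'v::finite) \<Rightarrow> real \<Rightarrow> 'v \<Rightarrow> real) \<Rightarrow> (real \<Rightarrow> 'v) \<Rightarrow> real \<Rightarrow> real \<Rightarrow> 'v \<Rightarrow> real" where
  "jump_density rate y s r j =
     rate y r j * exp (- (LBINT q:{s..r}. (\<Sum>k\<in>UNIV. rate y q k)))"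

definition jump_process ::
  "((real \<Rightarrow> 'v::finite) \<Rightarrow> real \<Rightarrow> 'v \<Rightarrow> real) \<Rightarrow> 'v \<Rightarrow> 'w measure \<Rightarrow> (real \<Rightarrow> 'w \<Rightarrow> 'v) \<Rightarrow> bool" where
  "jump_process rate x0 M Y \<longleftrightarrow>
     prob_space M \<and>
     (\<forall>s\<ge>0. Y s \<in> measurable M (count_space UNIV)) \<and>
     (\<forall>\<omega>\<in>space M. right_continuous_path (\<lambda>s. Y s \<omega>)) \<and>
     (AE \<omega> in M. Y 0 \<omega> = x0) \<and>
     (\<forall>s v j. 0 \<le> s \<longrightarrow> s \<le> v \<longrightarrow>
        (AE \<omega> in M.
           real_cond_exp M (natural_filtration M Y s)
             (indicator {\<omega> \<in> space M.
                next_jump (\<lambda>r. Y r \<omega>) s \<le> ereal v \<and>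
                Y (real_of_ereal (next_jump (\<lambda>r. Y r \<omega>) s)) \<omega> = j}) \<omega>
           = (LBINT r:{s..v}. jump_density rate (\<lambda>q. Y (min q s) \<omega>) s r j)))"

definition markov_jump_process ::
  "('v::finite \<Rightarrow> 'v \<Rightarrow> real) \<Rightarrow> 'v \<Rightarrow> 'w measure \<Rightarrow> (real \<Rightarrow> 'w \<Rightarrow> 'v) \<Rightarrow> bool" where
  "markov_jump_process w = jump_process (\<lambda>x r j. w (x r) j)"

definition remaining :: "('v \<Rightarrow> real) \<Rightarrow> (real \<Rightarrow> 'v) \<Rightarrow> 'v \<Rightarrow> real \<Rightarrow> real" where
  "remaining \<Phi> y j s = \<Phi> j - local_time y j s"

text \<open>The infima in \<open>rvrjp_end\<close> and \<open>exhaustion_time\<close> are over nonempty sets, since the local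
  times at time \<open>s\<close> sum up to \<open>s\<close>.\<close>

definition rvrjp_end :: "('v \<Rightarrow> real) \<Rightarrow> (real \<Rightarrow> 'v) \<Rightarrow> real" where
  "rvrjp_end \<Phi> y = Inf {s. 0 \<le> s \<and> (\<exists>j. remaining \<Phi> y j s = 0)}"

text \<open>The process is defined only up to \<open>rvrjp_end\<close>; it is represented by the process that stays
  put from then on.\<close>

definition rvrjp ::
  "('v::finite \<Rightarrow> 'v \<Rightarrow> real) \<Rightarrow> ('v \<Rightarrow> real) \<Rightarrow> 'v \<Rightarrow> 'w measure \<Rightarrow> (real \<Rightarrow> 'w \<Rightarrow> 'v) \<Rightarrow> bool" where
  "rvrjp w \<Phi> = jump_process
     (\<lambda>y s j. if s < rvrjp_end \<Phi> y then w (y s) j * remaining \<Phi> y j s else 0)"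

definition clock :: "('v::finite \<Rightarrow> real) \<Rightarrow> (real \<Rightarrow> 'v) \<Rightarrow> real \<Rightarrow> real" where
  "clock \<Phi> y s = (1/2) * (\<Sum>i\<in>UNIV. (\<Phi> i)\<^sup>2 - (remaining \<Phi> y i s)\<^sup>2)"

text \<open>The time-changed path is meaningful on \<open>[0, time_changed_end \<Phi> y]\<close>, the image of
  \<open>[0, rvrjp_end \<Phi> y]\<close> under the strictly increasing \<open>clock \<Phi> y\<close>.\<close>

definition time_changed :: "('v::finite \<Rightarrow> real) \<Rightarrow> (real \<Rightarrow> 'v) \<Rightarrow> real \<Rightarrow> 'v" where
  "time_changed \<Phi> y t = y (the_inv_into {0..rvrjp_end \<Phi> y} (clock \<Phi> y) t)"

definition time_changed_end :: "('v::finite \<Rightarrow> real) \<Rightarrow> (real \<Rightarrow> 'v) \<Rightarrow> real" where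
  "time_changed_end \<Phi> y = clock \<Phi> y (rvrjp_end \<Phi> y)"

definition time_changed_rvrjp_law ::
  "('v::finite \<Rightarrow> real) \<Rightarrow> real \<Rightarrow> 'w measure \<Rightarrow> (real \<Rightarrow> 'w \<Rightarrow> 'v) \<Rightarrow> (real \<Rightarrow> 'v) measure" where
  "time_changed_rvrjp_law \<Phi> t M Y =
     stopped_law M (\<lambda>\<omega>. min t (time_changed_end \<Phi> (\<lambda>s. Y s \<omega>)))
       (\<lambda>u \<omega>. time_changed \<Phi> (\<lambda>s. Y s \<omega>) u)"

definition exhaustion_time :: "('v \<Rightarrow> real) \<Rightarrow> (real \<Rightarrow> 'v) \<Rightarrow> real" where
  "exhaustion_time \<Phi> x = Inf {t. 0 \<le> t \<and> (\<exists>i. local_time x i t = (1/2) * (\<Phi> i)\<^sup>2)}"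

definition markov_jump_law ::
  "('v \<Rightarrow> real) \<Rightarrow> real \<Rightarrow> 'w measure \<Rightarrow> (real \<Rightarrow> 'w \<Rightarrow> 'v) \<Rightarrow> (real \<Rightarrow> 'v) measure" where
  "markov_jump_law \<Phi> t N X =
     stopped_law N (\<lambda>\<omega>. min t (exhaustion_time \<Phi> (\<lambda>s. X s \<omega>))) X"

text \<open>Stopping a path at \<open>min t (exhaustion_time \<Phi> x)\<close> changes neither this time nor the local
  times up to it, so the density may be evaluated on stopped paths.\<close>

definition rvrjp_density ::
  "('v::finite \<Rightarrow> 'v \<Rightarrow> real) \<Rightarrow> ('v \<Rightarrow> real) \<Rightarrow> 'v \<Rightarrow> real \<Rightarrow> (real \<Rightarrow> 'v) \<Rightarrow> real" where
  "rvrjp_density w \<Phi> x0 t x =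
     (let \<tau> = min t (exhaustion_time \<Phi> x);
          \<psi> = (\<lambda>j. sqrt ((\<Phi> j)\<^sup>2 - 2 * local_time x j \<tau>))
      in exp (- (1/2) * (dirichlet w \<psi> - dirichlet w \<Phi>)) *
         ((\<Prod>j\<in>UNIV - {x0}. \<Phi> j) / (\<Prod>j\<in>UNIV - {x \<tau>}. \<psi> j)))"

end

theory Submission
  imports Defs
begin

text \<open>
  Both processes have bounded jump rates that do not change while the process stays put, as long as
  it has not been stopped. For such a process the law of the stopped trajectory can be computed from
  the rates alone. Let \<open>G\<close> be a functional of the stopped trajectory. Its expectation \<open>u(s, x)\<close>, given
  that the trajectory up to time \<open>s\<close> is \<open>x\<close>, solves the first-jump equation
  \[ u(s,x) = e^{-c(\sigma-s)} G(x) + \int_s^{\sigma} \sum_j c_j e^{-c(r-s)}\, u(r, x^{r \to j})\, dr, \]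
  where \<open>x\<close> is frozen after \<open>s\<close>, the \<open>c\<^sub>j\<close> are its jump rates with sum \<open>c\<close>, \<open>\<sigma>\<close> is the time at which
  it is stopped and \<open>x\<^bsup>r\<rightarrow>j\<^esup>\<close> jumps to \<open>j\<close> at time \<open>r\<close>. Picard iteration from zero gives the minimal
  solution; its \<open>n\<close>-th iterate only counts trajectories with fewer than \<open>n\<close> jumps.

  The hypothesis on the processes describes the next jump after a \<^emph>\<open>deterministic\<close> time, whereas the
  first-jump equation follows the process from one random jump time to the next. The two are
  reconciled by cutting time into small steps (\<open>prediction_step\<close>). In a step of length \<open>h\<close> the hypothesis gives
  the law of the first jump; the value \<open>u\<close> moves by at most \<open>O(h)\<close> between this jump and the end of the
  step, unless a second jump occurs, which has probability \<open>O(h\<^sup>2)\<close>. Hence \<open>E u(s, Y)\<close> changes by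
  \<open>O(h\<^sup>2)\<close> over a step, and not at all over a whole interval (\<open>stopped_expectation\<close>).

  It remains to compare the Picard iterates of the two processes. Write \<open>L\<^sub>j\<close> for the remaining local
  time of the reinforced process, so that \<open>L\<^sub>j\<^sup>2 = \<Phi>\<^sub>j\<^sup>2 - 2\<ell>\<^sub>j\<close> for the time-changed trajectory, and put
  \[ \rho(L,i) = e^{-\frac12(\mathcal{E}(L,L)-\mathcal{E}(\Phi,\Phi))}\,
       \frac{\prod_{j\ne x_0}\Phi_j}{\prod_{j\ne i}L_j}. \]
  While the reinforced process waits at \<open>i\<close> during \<open>[s, r]\<close> and the time-changed clock goes from \<open>u\<close> to \<open>v\<close>,
  only \<open>L\<^sub>i\<close> decreases, and expanding the Dirichlet form shows that \<open>\<rho>\<close> is multiplied by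
  \<open>exp (W\<^sub>i (v - u) - c (r - s))\<close> with \<open>W\<^sub>i = \<Sum>\<^sub>j W\<^sub>i\<^sub>j\<close> and \<open>c = \<Sum>\<^sub>j W\<^sub>i\<^sub>j L\<^sub>j\<close>: this is the quotient of the
  probabilities of not jumping under the two dynamics (\<open>weight_move\<close>). When the process jumps from \<open>i\<close> to
  \<open>j\<close>, then \<open>\<rho>\<close> is multiplied by \<open>L\<^sub>j / L\<^sub>i\<close>, which is the quotient of the jump rates \<open>W\<^sub>i\<^sub>j L\<^sub>j\<close> and \<open>W\<^sub>i\<^sub>j\<close> up
  to the Jacobian \<open>dv = L\<^sub>i dr\<close> of the time change (\<open>weight_switch\<close>). So \<open>\<rho>\<close> transports each Picard iterate of
  the reinforced process to the one of the Markov process (\<open>picard_matched\<close>), by one substitution in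
  the integral over the next jump time. At the start \<open>\<rho> = 1\<close>, and at the stopping time \<open>\<rho>\<close> is the
  claimed density.
\<close>

section \<open>Paths\<close>

lemma space_path_space: "space path_space = {x \<in> extensional {0..}. right_continuous_path x}"
  by (auto simp: path_space_def space_restrict_space space_PiM PiE_def)

lemma measurable_path_spaceI:
  assumes "\<And>\<omega>. \<omega> \<in> space M \<Longrightarrow> g \<omega> \<in> space path_space"
    and "\<And>r. 0 \<le> r \<Longrightarrow> (\<lambda>\<omega>. g \<omega> r) \<in> measurable M (count_space UNIV)"
  shows "g \<in> measurable M path_space"
  unfolding path_space_def
proof (rule measurable_restrict_space2)
  show "g \<in> space M \<rightarrow> {x. right_continuous_path x}"
    using assms(1) by (auto simp: space_path_space)
  show "g \<in> M \<rightarrow>\<^sub>M Pi\<^sub>M {0..} (\<lambda>_. count_space UNIV)"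
  proof (rule measurable_PiM_single')
    show "(\<lambda>\<omega> i. g \<omega> i) \<in> space M \<rightarrow> (\<Pi>\<^sub>E i\<in>{0..}. space (count_space UNIV))"
    proof (rule funcsetI)
      fix \<omega> assume "\<omega> \<in> space M"
      then have "g \<omega> \<in> extensional {0..}"
        using assms(1) by (simp add: space_path_space)
      then show "(\<lambda>i. g \<omega> i) \<in> (\<Pi>\<^sub>E i\<in>{0..}. space (count_space UNIV))"
        by (simp add: PiE_def)
    qed
  qed (use assms(2) in auto)
qed

lemma measurable_path_coordinate:
  assumes "0 \<le> r"
  shows "(\<lambda>x. x r) \<in> measurable path_space (count_space UNIV)"
  unfolding path_space_def
  by (intro measurable_restrict_space1 measurable_component_singleton) (use assms in auto)

text \<open>The first point of the grid of mesh \<open>1 / (n + 1)\<close> strictly to the right of \<open>r\<close>. It is a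
  function of the floor of \<open>r (n + 1)\<close>, hence takes countably many values.\<close>

definition grid_above :: "nat \<Rightarrow> real \<Rightarrow> real" where
  "grid_above n r = (of_int \<lfloor>r * real (Suc n)\<rfloor> + 1) / real (Suc n)"

lemma grid_above_bounds: "r < grid_above n r" "grid_above n r \<le> r + 1 / real (Suc n)"
proof -
  have "r * real (Suc n) < of_int \<lfloor>r * real (Suc n)\<rfloor> + 1" by linarith
  then show "r < grid_above n r" unfolding grid_above_def
    by (subst pos_less_divide_eq) auto
  have "of_int \<lfloor>r * real (Suc n)\<rfloor> + 1 \<le> r * real (Suc n) + 1" by linarith
  then have "grid_above n r \<le> (r * real (Suc n) + 1) / real (Suc n)"
    unfolding grid_above_def by (intro divide_right_mono) auto
  then show "grid_above n r \<le> r + 1 / real (Suc n)"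
    by (simp add: add_divide_distrib del: of_nat_Suc)
qed

lemma right_continuous_path_grid:
  assumes "right_continuous_path x" "0 \<le> r"
  shows "\<exists>N. \<forall>n\<ge>N. x (grid_above n r) = x r"
proof -
  obtain b where b: "r < b" "\<And>y. r < y \<Longrightarrow> y < b \<Longrightarrow> x y = x r"
    using assms unfolding right_continuous_path_def eventually_at_right_field by blast
  obtain N where N: "1 / real (Suc N) < b - r"
    using b(1) by (metis nat_approx_posE diff_gt_0_iff_gt)
  have "x (grid_above n r) = x r" if "n \<ge> N" for n
  proof (rule b(2))
    show "r < grid_above n r" by (rule grid_above_bounds)
    have "1 / real (Suc n) \<le> 1 / real (Suc N)" using that by (simp add: frac_le)
    then show "grid_above n r < b" using grid_above_bounds(2)[of n r] N by linarith
  qed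
  then show ?thesis by blast
qed

text \<open>The value of a right-continuous path at \<open>r\<close> is the eventually constant limit of its values at
  the grid points above \<open>r\<close>. For each mesh these are countably many fixed times, so that evaluation at
  a random time is measurable. At negative times all paths have the same value.\<close>

lemma measurable_path_at:
  fixes g :: "'w \<Rightarrow> real \<Rightarrow> 'v::finite"
  assumes f[measurable]: "f \<in> borel_measurable M" and g: "g \<in> measurable M path_space"
  shows "(\<lambda>\<omega>. g \<omega> (f \<omega>)) \<in> measurable M (count_space UNIV)"
proof -
  have coord: "(\<lambda>\<omega>. g \<omega> r) \<in> measurable M (count_space UNIV)" if "0 \<le> r" for r
    using measurable_compose[OF g measurable_path_coordinate[OF that]] .
  have grid: "(\<lambda>\<omega>. g \<omega> (max 0 (grid_above n (f \<omega>)))) \<in> measurable M (count_space UNIV)" for n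
    unfolding grid_above_def
    by (rule measurable_compose_countable[where
          f = "\<lambda>k \<omega>. g \<omega> (max 0 ((of_int k + 1) / real (Suc n)))" and g = "\<lambda>\<omega>. \<lfloor>f \<omega> * real (Suc n)\<rfloor>"])
      (auto intro!: coord)
  have "{\<omega> \<in> space M. g \<omega> (f \<omega>) = i} \<in> sets M" for i
  proof -
    have "{\<omega> \<in> space M. g \<omega> (f \<omega>) = i} =
      {\<omega> \<in> space M. if f \<omega> < 0 then undefined = i
         else \<exists>N. \<forall>n\<ge>N. g \<omega> (max 0 (grid_above n (f \<omega>))) = i}" (is "?A = ?B")
    proof -
      have "g \<omega> (f \<omega>) = i \<longleftrightarrow> (if f \<omega> < 0 then undefined = i
         else \<exists>N. \<forall>n\<ge>N. g \<omega> (max 0 (grid_above n (f \<omega>))) = i)" if w: "\<omega> \<in> space M" for \<omega>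
      proof -
        have *: "right_continuous_path (g \<omega>)" "g \<omega> \<in> extensional {0..}"
          using measurable_space[OF g w] by (auto simp: space_path_space)
        show ?thesis
        proof (cases "f \<omega> < 0")
          case True then show ?thesis using * by (auto simp: extensional_def)
        next
          case False
          then obtain N where N: "\<forall>n\<ge>N. g \<omega> (grid_above n (f \<omega>)) = g \<omega> (f \<omega>)"
            using right_continuous_path_grid[OF *(1)] by force
          have m: "max 0 (grid_above n (f \<omega>)) = grid_above n (f \<omega>)" for n
            using grid_above_bounds(1)[of "f \<omega>" n] False by linarith
          show ?thesis unfolding m using False N by (auto intro: exI[of _ N]) (metis nle_le)
        qed
      qed
      then show ?thesis by blast
    qed
    also have "\<dots> \<in> sets M"
      using grid by measurable
    finally show ?thesis .
  qed
  then show ?thesis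
    by (auto simp: measurable_count_space_eq2 vimage_def Int_def conj_commute)
qed


section \<open>Local times and hitting times\<close>

lemma right_continuous_pathD:
  assumes "right_continuous_path x" "0 \<le> s"
  shows "\<exists>b>s. \<forall>r. s \<le> r \<longrightarrow> r < b \<longrightarrow> x r = x s"
proof -
  obtain b where b: "s < b" "\<forall>r. s < r \<longrightarrow> r < b \<longrightarrow> x r = x s"
    using assms unfolding right_continuous_path_def eventually_at_right_field by blast
  then have "\<forall>r. s \<le> r \<longrightarrow> r < b \<longrightarrow> x r = x s"
    unfolding le_less by blast
  with b(1) show ?thesis by blast
qed

lemma right_continuous_pathI:
  assumes "\<And>s. 0 \<le> s \<Longrightarrow> \<exists>b>s. \<forall>r. s < r \<longrightarrow> r < b \<longrightarrow> x r = x s"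
  shows "right_continuous_path x"
  using assms unfolding right_continuous_path_def eventually_at_right_field by blast

lemma right_continuous_path_cong:
  assumes "\<And>s. 0 \<le> s \<Longrightarrow> x s = y s"
  shows "right_continuous_path x \<longleftrightarrow> right_continuous_path y"
proof -
  have "right_continuous_path y" if rc: "right_continuous_path x" and eq: "\<And>s. 0 \<le> s \<Longrightarrow> x s = y s" for x y :: "real \<Rightarrow> 'a"
  proof (rule right_continuous_pathI)
    fix s :: real assume "0 \<le> s"
    obtain b where b: "s < b" "\<And>r. s \<le> r \<Longrightarrow> r < b \<Longrightarrow> x r = x s"
      using right_continuous_pathD[OF rc \<open>0 \<le> s\<close>] by blast
    have "y r = y s" if "s < r" "r < b" for r
      using b(2)[of r] that eq[of r] eq[of s] \<open>0 \<le> s\<close> by simp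
    with b(1) show "\<exists>b>s. \<forall>r. s < r \<longrightarrow> r < b \<longrightarrow> y r = y s" by blast
  qed
  then show ?thesis using assms by metis
qed

lemma restrict_in_path_space:
  "right_continuous_path x \<Longrightarrow> restrict x {0..} \<in> space path_space"
  using right_continuous_path_cong[of x "restrict x {0..}"] by (simp add: space_path_space)

lemma path_level_set:
  fixes x :: "real \<Rightarrow> 'v::finite"
  assumes "right_continuous_path x" "A \<subseteq> {0..}" "A \<in> sets borel"
  shows "{r \<in> A. x r = j} \<in> sets borel"
proof -
  have "(\<lambda>r. (restrict x {0..}) r) \<in> measurable borel (count_space UNIV)"
    using restrict_in_path_space[OF assms(1)] by (intro measurable_path_at[where g = "\<lambda>_. restrict x {0..}" and f = "\<lambda>r. r"]) auto
  then have "{r \<in> A. restrict x {0..} r = j} \<in> sets borel"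
    using assms(3) by measurable
  also have "{r \<in> A. restrict x {0..} r = j} = {r \<in> A. x r = j}"
    using assms(2) by (auto simp: restrict_def)
  finally show ?thesis .
qed

lemma local_time_eq_measure: "local_time x j s = measure lborel {r \<in> {0..s}. x r = j}"
proof -
  have "local_time x j s = integral\<^sup>L lborel (indicator {r \<in> {0..s}. x r = j})"
    unfolding local_time_def set_lebesgue_integral_def
    by (intro Bochner_Integration.integral_cong) (auto simp: indicator_def)
  then show ?thesis by simp
qed

text \<open>A single time is a null set, so the value of the path at \<open>s\<close> itself is irrelevant. This is why
  everything computed from local times at \<open>s\<close> is unaffected by a jump at \<open>s\<close>.\<close>

lemma local_time_cong:
  assumes "\<And>q. 0 \<le> q \<Longrightarrow> q < s \<Longrightarrow> x q = y q"
  shows "local_time x j s = local_time y j s"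
  unfolding local_time_def set_lebesgue_integral_def
proof (rule integral_discrete_difference[where X = "{s}"])
  fix r assume "r \<notin> {s}"
  then show "indicator {0..s} r *\<^sub>R (of_bool (x r = j) :: real) = indicator {0..s} r *\<^sub>R of_bool (y r = j)"
  proof (cases "0 \<le> r \<and> r < s")
    case False
    with \<open>r \<notin> {s}\<close> have "indicator {0..s} r = (0::real)" by (auto simp: indicator_def)
    then show ?thesis by simp
  qed (simp add: assms)
qed simp_all

lemma local_time_0 [simp]: "local_time x j 0 = 0"
proof -
  have "{r \<in> {0..0}. x r = j} = (if x 0 = j then {0} else {})" by auto
  then show ?thesis by (simp add: local_time_eq_measure)
qed

lemma emeasure_lborel_bounded:
  fixes B :: "real set"
  assumes "B \<subseteq> {c..d}"
  shows "emeasure lborel B \<noteq> \<infinity>"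
proof -
  have "emeasure lborel B \<le> emeasure lborel {c..d}" by (intro emeasure_mono assms) auto
  also have "\<dots> < \<infinity>" by (simp add: emeasure_lborel_Icc_eq)
  finally show ?thesis by simp
qed

text \<open>The interval may be taken open on both sides, which fits paths that are known to be
  constant up to a jump time, but not at it.\<close>

lemma local_time_add:
  fixes x :: "real \<Rightarrow> 'v::finite"
  assumes "right_continuous_path x" "0 \<le> a" "a \<le> b"
  shows "local_time x j b = local_time x j a + measure lborel {r \<in> {a<..<b}. x r = j}"
proof -
  have "local_time x j b = measure lborel ({r \<in> {0..a}. x r = j} \<union> {r \<in> {a<..b}. x r = j})"
  proof -
    have "{r \<in> {0..b}. x r = j} = {r \<in> {0..a}. x r = j} \<union> {r \<in> {a<..b}. x r = j}"
      using assms(2,3) by auto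
    then show ?thesis by (simp add: local_time_eq_measure)
  qed
  also have "\<dots> = local_time x j a + measure lborel {r \<in> {a<..b}. x r = j}"
  proof -
    have "measure lborel ({r \<in> {0..a}. x r = j} \<union> {r \<in> {a<..b}. x r = j}) =
        measure lborel {r \<in> {0..a}. x r = j} + measure lborel {r \<in> {a<..b}. x r = j}"
    proof (rule measure_Union)
      show "{r \<in> {0..a}. x r = j} \<in> sets lborel"
        unfolding sets_lborel by (rule path_level_set[OF assms(1)]) simp_all
      have "{a<..b} \<subseteq> {0..}" using assms(2) by force
      then show "{r \<in> {a<..b}. x r = j} \<in> sets lborel"
        unfolding sets_lborel by (rule path_level_set[OF assms(1)]) simp_all
      show "emeasure lborel {r \<in> {0..a}. x r = j} \<noteq> \<infinity>"
        by (rule emeasure_lborel_bounded[of _ 0 a]) blast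
      show "emeasure lborel {r \<in> {a<..b}. x r = j} \<noteq> \<infinity>"
        by (rule emeasure_lborel_bounded[of _ a b]) force
      show "{r \<in> {0..a}. x r = j} \<inter> {r \<in> {a<..b}. x r = j} = {}" by force
    qed
    then show ?thesis by (simp add: local_time_eq_measure)
  qed
  also have "measure lborel {r \<in> {a<..b}. x r = j} = measure lborel {r \<in> {a<..<b}. x r = j}"
  proof -
    have "integral\<^sup>L lborel (indicator {r \<in> {a<..b}. x r = j}) =
        (integral\<^sup>L lborel (indicator {r \<in> {a<..<b}. x r = j}) :: real)"
      by (rule integral_discrete_difference[where X = "{b}"]) (auto simp: indicator_def)
    then show ?thesis by simp
  qed
  finally show ?thesis .
qed

lemma local_time_frozen:
  fixes x :: "real \<Rightarrow> 'v::finite"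
  assumes "right_continuous_path x" "0 \<le> a" "a \<le> b" "\<And>q. a < q \<Longrightarrow> q < b \<Longrightarrow> x q = i"
  shows "local_time x j b = local_time x j a + (if j = i then b - a else 0)"
proof -
  have "{r \<in> {a<..<b}. x r = j} = (if j = i then {a<..<b} else {})"
  proof (rule set_eqI)
    fix r
    show "r \<in> {r \<in> {a<..<b}. x r = j} \<longleftrightarrow> r \<in> (if j = i then {a<..<b} else {})"
      using assms(4)[of r] by (cases "j = i") auto
  qed
  then show ?thesis
    unfolding local_time_add[OF assms(1-3), of j] using assms(3) by (simp del: mem_Collect_eq)
qed

lemma local_time_mono:
  fixes x :: "real \<Rightarrow> 'v::finite"
  assumes "right_continuous_path x" "0 \<le> a" "a \<le> b"
  shows "local_time x j a \<le> local_time x j b" "local_time x j b \<le> local_time x j a + (b - a)"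
proof -
  have "{a<..<b} \<subseteq> {0..}" using assms(2) by force
  then have m: "{r \<in> {a<..<b}. x r = j} \<in> sets borel"
    by (rule path_level_set[OF assms(1)]) simp
  have "measure lborel {r \<in> {a<..<b}. x r = j} \<le> measure lborel {a<..<b}"
  proof (rule measure_mono_fmeasurable)
    show "{a<..<b} \<in> fmeasurable lborel"
      using assms(3) by (intro fmeasurableI) simp_all
  qed (use m in auto)
  also have "\<dots> = b - a" using assms(3) by simp
  finally have le: "measure lborel {r \<in> {a<..<b}. x r = j} \<le> b - a" .
  have nn: "0 \<le> measure lborel {r \<in> {a<..<b}. x r = j}" by (rule measure_nonneg)
  show "local_time x j a \<le> local_time x j b" "local_time x j b \<le> local_time x j a + (b - a)"
    unfolding local_time_add[OF assms, of j] using nn le by linarith+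
qed

lemma local_time_nonneg: "0 \<le> local_time x j s"
  by (simp add: local_time_eq_measure)

lemma continuous_on_local_time:
  fixes x :: "real \<Rightarrow> 'v::finite"
  assumes "right_continuous_path x"
  shows "continuous_on {0..} (local_time x j)"
proof -
  have "1-lipschitz_on {0..} (local_time x j)"
  proof (rule lipschitz_onI)
    fix a b :: real assume "a \<in> {0..}" "b \<in> {0..}"
    then show "dist (local_time x j a) (local_time x j b) \<le> 1 * dist a b"
      using local_time_mono[OF assms, of a b j] local_time_mono[OF assms, of b a j]
      by (cases "a \<le> b") (auto simp: dist_real_def)
  qed auto
  then show ?thesis by (rule lipschitz_on_continuous_on)
qed

lemma sum_local_time:
  fixes x :: "real \<Rightarrow> 'v::finite"
  assumes "right_continuous_path x" "0 \<le> s"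
  shows "(\<Sum>j\<in>UNIV. local_time x j s) = s"
proof -
  have "(\<Sum>j\<in>UNIV. measure lborel {r \<in> {0..s}. x r = j}) = measure lborel (\<Union>j. {r \<in> {0..s}. x r = j})"
  proof (rule measure_finite_Union[symmetric])
    show "range (\<lambda>j. {r \<in> {0..s}. x r = j}) \<subseteq> sets lborel"
      using path_level_set[OF assms(1), of "{0..s}"] by (auto simp del: atLeastAtMost_iff)
    fix j
    show "emeasure lborel {r \<in> {0..s}. x r = j} \<noteq> \<infinity>"
      by (rule emeasure_lborel_bounded[of _ 0 s]) force
  qed (auto simp: disjoint_family_on_def)
  also have "(\<Union>j. {r \<in> {0..s}. x r = j}) = {0..s}" by auto
  finally show ?thesis using assms(2) by (simp add: local_time_eq_measure)
qed

lemma measurable_local_time [measurable (raw)]: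
  fixes g :: "'w \<Rightarrow> real \<Rightarrow> 'v::finite"
  assumes [measurable]: "f \<in> borel_measurable M" "g \<in> measurable M path_space"
  shows "(\<lambda>\<omega>. local_time (g \<omega>) j (f \<omega>)) \<in> borel_measurable M"
proof -
  have [measurable]: "(\<lambda>p. g (fst p) (snd p)) \<in> measurable (M \<Otimes>\<^sub>M lborel) (count_space UNIV)"
    by (rule measurable_path_at) measurable
  have "(\<lambda>\<omega>. \<integral>r. (if 0 \<le> r \<and> r \<le> f \<omega> \<and> g \<omega> r = j then 1 else 0 :: real) \<partial>lborel) \<in> borel_measurable M"
    by (rule lborel.borel_measurable_lebesgue_integral) (simp add: split_beta', measurable)
  also have "(\<lambda>\<omega>. \<integral>r. (if 0 \<le> r \<and> r \<le> f \<omega> \<and> g \<omega> r = j then 1 else 0 :: real) \<partial>lborel) =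
     (\<lambda>\<omega>. local_time (g \<omega>) j (f \<omega>))"
    unfolding local_time_def set_lebesgue_integral_def
    by (intro ext Bochner_Integration.integral_cong) (auto simp: indicator_def)
  finally show ?thesis .
qed

text \<open>The trajectory that follows \<open>x\<close> before \<open>r\<close> and sits in \<open>j\<close> from \<open>r\<close> on. With a history that is frozen
  after some \<open>s \<le> r\<close> in place of \<open>x\<close>, this is the history after the next jump.\<close>

definition redirect :: "(real \<Rightarrow> 'v) \<Rightarrow> real \<Rightarrow> 'v \<Rightarrow> real \<Rightarrow> 'v" where
  "redirect x r j = (\<lambda>q\<in>{0..}. if q < r then x q else j)"

lemma redirect_at: "0 \<le> q \<Longrightarrow> redirect x r j q = (if q < r then x q else j)"
  by (simp add: redirect_def)

lemma stop_path_at: "0 \<le> q \<Longrightarrow> stop_path a x q = x (min q a)"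
  by (simp add: stop_path_def)

lemma redirect_in_path_space:
  assumes "right_continuous_path x"
  shows "redirect x r j \<in> space path_space"
proof -
  have "right_continuous_path (redirect x r j)"
  proof (rule right_continuous_pathI)
    fix s :: real assume s: "0 \<le> s"
    obtain b where b: "s < b" "\<And>r. s \<le> r \<Longrightarrow> r < b \<Longrightarrow> x r = x s"
      using right_continuous_pathD[OF assms s] by blast
    show "\<exists>b>s. \<forall>q. s < q \<longrightarrow> q < b \<longrightarrow> redirect x r j q = redirect x r j s"
    proof (cases "s < r")
      case True
      have "redirect x r j q = redirect x r j s" if "s < q" "q < min b r" for q
        using b(2)[of q] that s True by (simp add: redirect_at)
      then show ?thesis using b(1) True by (intro exI[of _ "min b r"]) simp
    next
      case False
      then show ?thesis using s by (intro exI[of _ "s + 1"]) (auto simp: redirect_at)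
    qed
  qed
  then show ?thesis by (simp add: space_path_space redirect_def)
qed

lemma stop_path_in_path_space:
  assumes "right_continuous_path x" "0 \<le> a"
  shows "stop_path a x \<in> space path_space"
proof -
  have "stop_path a x = redirect x a (x a)"
    using assms(2) by (auto simp: redirect_def stop_path_def restrict_def fun_eq_iff)
  then show ?thesis using redirect_in_path_space[OF assms(1)] by simp
qed

lemma path_space_rc: "x \<in> space path_space \<Longrightarrow> right_continuous_path x"
  by (simp add: space_path_space)

lemma measurable_redirect [measurable (raw)]:
  fixes g :: "'w \<Rightarrow> real \<Rightarrow> 'v::finite"
  assumes [measurable]: "f \<in> borel_measurable M" and g[measurable]: "g \<in> measurable M path_space"
    and [measurable]: "k \<in> measurable M (count_space UNIV)"
  shows "(\<lambda>\<omega>. redirect (g \<omega>) (f \<omega>) (k \<omega>)) \<in> measurable M path_space"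
proof (rule measurable_path_spaceI)
  fix r :: real assume "0 \<le> r"
  moreover have [measurable]: "(\<lambda>\<omega>. g \<omega> r) \<in> measurable M (count_space UNIV)"
    by (rule measurable_path_at) measurable
  ultimately show "(\<lambda>\<omega>. redirect (g \<omega>) (f \<omega>) (k \<omega>) r) \<in> measurable M (count_space UNIV)"
    by (simp add: redirect_at)
qed (use measurable_space[OF g] in \<open>auto intro!: redirect_in_path_space dest: path_space_rc\<close>)

lemma measurable_stop_path:
  fixes g :: "'w \<Rightarrow> real \<Rightarrow> 'v::finite"
  assumes [measurable]: "f \<in> borel_measurable M" and g[measurable]: "g \<in> measurable M path_space"
    and "\<And>\<omega>. \<omega> \<in> space M \<Longrightarrow> 0 \<le> f \<omega>"
  shows "(\<lambda>\<omega>. stop_path (f \<omega>) (g \<omega>)) \<in> measurable M path_space"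
proof (rule measurable_path_spaceI)
  fix r :: real assume "0 \<le> r"
  moreover have "(\<lambda>\<omega>. g \<omega> (min r (f \<omega>))) \<in> measurable M (count_space UNIV)"
    by (rule measurable_path_at) measurable
  ultimately show "(\<lambda>\<omega>. stop_path (f \<omega>) (g \<omega>) r) \<in> measurable M (count_space UNIV)"
    by (simp add: stop_path_at)
qed (use measurable_space[OF g] assms(3) in \<open>auto intro!: stop_path_in_path_space dest: path_space_rc\<close>)

lemma stop_path_stop_path:
  "0 \<le> a \<Longrightarrow> 0 \<le> b \<Longrightarrow> stop_path a (stop_path b x) = stop_path (min a b) x"
  by (auto simp: stop_path_def fun_eq_iff ac_simps)

lemma stop_path_redirect:
  "0 \<le> r \<Longrightarrow> r \<le> s \<Longrightarrow> stop_path s (redirect x r j) = redirect x r j"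
  by (auto simp: stop_path_def redirect_def fun_eq_iff)

text \<open>Both stopping rules of the theorem have this form: the reinforced process ends when a local time
  reaches \<open>\<Phi>\<^sub>i\<close>, the Markov process is stopped when one reaches \<open>\<Phi>\<^sub>i\<^sup>2 / 2\<close>.\<close>

definition first_hit :: "('v \<Rightarrow> real) \<Rightarrow> (real \<Rightarrow> 'v) \<Rightarrow> real" where
  "first_hit \<theta> x = Inf {s. 0 \<le> s \<and> (\<exists>i. local_time x i s = \<theta> i)}"

context
  fixes \<theta> :: "'v::finite \<Rightarrow> real" and x :: "real \<Rightarrow> 'v"
  assumes pos: "\<And>i. 0 < \<theta> i" and rc: "right_continuous_path x"
begin

lemma hit_before:
  assumes "0 \<le> s" "\<theta> i \<le> local_time x i s"
  shows "\<exists>q. 0 \<le> q \<and> q \<le> s \<and> local_time x i q = \<theta> i"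
proof (rule IVT')
  show "local_time x i 0 \<le> \<theta> i" using pos[of i] by simp
  show "continuous_on {0..s} (local_time x i)"
    by (rule continuous_on_subset[OF continuous_on_local_time[OF rc]]) auto
qed (use assms in auto)

lemma hit_exists: "\<exists>s\<le>(\<Sum>i\<in>UNIV. \<theta> i). 0 \<le> s \<and> (\<exists>i. local_time x i s = \<theta> i)"
proof -
  let ?s = "\<Sum>i\<in>UNIV. \<theta> i"
  have s: "0 \<le> ?s" using pos by (intro sum_nonneg) (auto intro: less_imp_le)
  have "\<exists>i. \<theta> i \<le> local_time x i ?s"
  proof (rule ccontr)
    assume "\<not> ?thesis"
    then have "(\<Sum>i\<in>UNIV. local_time x i ?s) < ?s"
      by (intro sum_strict_mono) (auto simp: not_le)
    then show False using sum_local_time[OF rc s] by simp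
  qed
  then obtain i where "\<theta> i \<le> local_time x i ?s" ..
  from hit_before[OF s this] show ?thesis by blast
qed

lemma first_hit_in: "0 \<le> first_hit \<theta> x" "\<exists>i. local_time x i (first_hit \<theta> x) = \<theta> i"
proof -
  let ?A = "{s. 0 \<le> s \<and> (\<exists>i. local_time x i s = \<theta> i)}"
  have "?A = (\<Union>i. {s \<in> {0..}. local_time x i s = \<theta> i})" by auto
  also have "closed \<dots>"
    by (intro closed_UN finite ballI
        continuous_closed_preimage_constant[OF continuous_on_local_time[OF rc] closed_atLeast])
  finally have "closed ?A" .
  moreover have "?A \<noteq> {}" using hit_exists by blast
  ultimately have "Inf ?A \<in> ?A"
    by (intro closed_contains_Inf) (auto intro!: bdd_belowI[of _ 0])
  then show "0 \<le> first_hit \<theta> x" "\<exists>i. local_time x i (first_hit \<theta> x) = \<theta> i"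
    by (auto simp: first_hit_def)
qed

lemma first_hit_le: "0 \<le> s \<Longrightarrow> \<theta> i \<le> local_time x i s \<Longrightarrow> first_hit \<theta> x \<le> s"
proof -
  assume "0 \<le> s" "\<theta> i \<le> local_time x i s"
  then obtain q where "0 \<le> q" "q \<le> s" "local_time x i q = \<theta> i" using hit_before by blast
  then have "first_hit \<theta> x \<le> q"
    unfolding first_hit_def by (intro cInf_lower) (auto intro!: bdd_belowI[of _ 0])
  with \<open>q \<le> s\<close> show ?thesis by simp
qed

text \<open>The local times are continuous and nondecreasing, so the levels are not reached before \<open>s\<close> exactly
  if all local times are still below them at \<open>s\<close>. This turns the infimum into a condition at one time,
  from which measurability and the dependence on the past are read off.\<close>

lemma less_first_hit_iff:
  assumes "0 \<le> s"
  shows "s < first_hit \<theta> x \<longleftrightarrow> (\<forall>i. local_time x i s < \<theta> i)"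
proof
  assume "s < first_hit \<theta> x"
  then show "\<forall>i. local_time x i s < \<theta> i"
    using first_hit_le[OF assms] by (meson not_le)
next
  assume *: "\<forall>i. local_time x i s < \<theta> i"
  show "s < first_hit \<theta> x"
  proof (rule ccontr)
    assume "\<not> ?thesis"
    moreover obtain i where "local_time x i (first_hit \<theta> x) = \<theta> i" using first_hit_in by blast
    ultimately show False
      using local_time_mono(1)[OF rc first_hit_in(1), of s i] * by (auto simp: not_less) (meson leD)
  qed
qed

lemma first_hit_bounds: "0 < first_hit \<theta> x" "first_hit \<theta> x \<le> (\<Sum>i\<in>UNIV. \<theta> i)"
proof -
  show "0 < first_hit \<theta> x" using less_first_hit_iff[of 0] pos by simp
  obtain s i where "s \<le> (\<Sum>i\<in>UNIV. \<theta> i)" "0 \<le> s" "local_time x i s = \<theta> i" using hit_exists by blast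
  then show "first_hit \<theta> x \<le> (\<Sum>i\<in>UNIV. \<theta> i)" using first_hit_le[of s i] by auto
qed

lemma local_time_le_first_hit:
  assumes "0 \<le> s" "s \<le> first_hit \<theta> x"
  shows "local_time x i s \<le> \<theta> i"
proof (rule ccontr)
  assume contr: "\<not> ?thesis"
  then have "first_hit \<theta> x = s" using first_hit_le[OF assms(1), of i] assms(2) by auto
  obtain q where q: "0 \<le> q" "q \<le> s" "local_time x i q = \<theta> i"
    using hit_before[OF assms(1), of i] contr by auto
  have "first_hit \<theta> x \<le> q" using q by (intro first_hit_le[of q i]) auto
  then show False using q \<open>first_hit \<theta> x = s\<close> contr by simp
qed

end

text \<open>Only the path strictly before the hitting time matters, since local times do not see single
  times: a jump at the hitting time does not change it.\<close>

lemma first_hit_cong: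
  fixes x :: "real \<Rightarrow> 'v::finite"
  assumes pos: "\<And>i. 0 < \<theta> i" and x: "right_continuous_path x" and y: "right_continuous_path y"
    and eq: "\<And>q. 0 \<le> q \<Longrightarrow> q < first_hit \<theta> x \<Longrightarrow> y q = x q"
  shows "first_hit \<theta> y = first_hit \<theta> x"
proof -
  have lt: "local_time y i s = local_time x i s" if "s \<le> first_hit \<theta> x" for i s
    using that eq by (intro local_time_cong) auto
  have "s < first_hit \<theta> y \<longleftrightarrow> s < first_hit \<theta> x" if "0 \<le> s" "s \<le> first_hit \<theta> x" for s
    using less_first_hit_iff[OF pos x that(1)] less_first_hit_iff[OF pos y that(1)] lt[OF that(2)] by simp
  moreover have "0 < first_hit \<theta> x" "0 < first_hit \<theta> y"
    using first_hit_bounds[OF pos x] first_hit_bounds[OF pos y] by auto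
  ultimately show ?thesis
    by (cases "first_hit \<theta> y < first_hit \<theta> x") (metis less_le less_irrefl, metis less_le less_irrefl not_le)
qed

lemma measurable_first_hit [measurable]:
  fixes \<theta> :: "'v::finite \<Rightarrow> real"
  assumes pos: "\<And>i. 0 < \<theta> i"
  shows "first_hit \<theta> \<in> borel_measurable path_space"
  unfolding borel_measurable_iff_greater
proof
  fix a :: real
  have "{x \<in> space path_space. a < first_hit \<theta> x} =
     {x \<in> space path_space. 0 \<le> a \<longrightarrow> (\<forall>i. local_time x i a < \<theta> i)}"
  proof -
    have "a < first_hit \<theta> x \<longleftrightarrow> (0 \<le> a \<longrightarrow> (\<forall>i. local_time x i a < \<theta> i))" if "x \<in> space path_space" for x
    proof (cases "0 \<le> a")
      case True then show ?thesis using less_first_hit_iff[OF pos path_space_rc[OF that]] by simp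
    next
      case False
      moreover have "0 < first_hit \<theta> x" by (rule first_hit_bounds(1)[OF pos path_space_rc[OF that]])
      ultimately show ?thesis by linarith
    qed
    then show ?thesis by blast
  qed
  also have "\<dots> \<in> sets path_space" by measurable
  finally show "{x \<in> space path_space. a < first_hit \<theta> x} \<in> sets path_space" .
qed


section \<open>The first-jump equation\<close>

lemma nn_integral_exponential:
  fixes c s b :: real
  assumes "0 \<le> c" "s \<le> b"
  shows "(\<integral>\<^sup>+r. ennreal (c * exp (- c * (r - s))) * indicator {s..b} r \<partial>lborel)
    = ennreal (1 - exp (- c * (b - s)))"
proof -
  have "(\<integral>\<^sup>+r. ennreal (c * exp (- c * (r - s))) * indicator {s..b} r \<partial>lborel) =
      ennreal ((- exp (- c * (b - s))) - (- exp (- c * (s - s))))"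
    by (rule nn_integral_FTC_Icc) (use assms in \<open>auto intro!: derivative_eq_intros\<close>)
  then show ?thesis by simp
qed

lemma measurable_window_integral:
  fixes f :: "'a \<Rightarrow> real \<Rightarrow> ennreal"
  assumes f: "(\<lambda>p. f (fst p) (snd p)) \<in> borel_measurable (M \<Otimes>\<^sub>M lborel)"
    and [measurable]: "lo \<in> borel_measurable M" "hi \<in> borel_measurable M"
  shows "(\<lambda>\<omega>. \<integral>\<^sup>+r. f \<omega> r * indicator {lo \<omega>..hi \<omega>} r \<partial>lborel) \<in> borel_measurable M"
proof -
  note [measurable] = f
  have "(\<lambda>p. f (fst p) (snd p) * (if lo (fst p) \<le> snd p \<and> snd p \<le> hi (fst p) then 1 else 0))
      \<in> borel_measurable (M \<Otimes>\<^sub>M lborel)"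
    by measurable
  then have "(\<lambda>\<omega>. \<integral>\<^sup>+r. f \<omega> r * (if lo \<omega> \<le> r \<and> r \<le> hi \<omega> then 1 else 0) \<partial>lborel) \<in> borel_measurable M"
    by (intro lborel.borel_measurable_nn_integral) (simp add: split_beta')
  also have "(\<lambda>\<omega>. \<integral>\<^sup>+r. f \<omega> r * (if lo \<omega> \<le> r \<and> r \<le> hi \<omega> then 1 else 0) \<partial>lborel) =
      (\<lambda>\<omega>. \<integral>\<^sup>+r. f \<omega> r * indicator {lo \<omega>..hi \<omega>} r \<partial>lborel)"
    by (intro ext nn_integral_cong) (auto simp: indicator_def)
  finally show ?thesis .
qed

lemma nn_integral_singleton: "(\<integral>\<^sup>+r. f r * indicator {a..a} r \<partial>lborel) = 0" for a :: real
proof -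
  have "(\<integral>\<^sup>+r. f r * indicator {a..a} r \<partial>lborel) = (\<integral>\<^sup>+(r::real). 0 \<partial>lborel)"
    by (rule nn_integral_cong_AE, use AE_lborel_singleton[of a] in eventually_elim) auto
  then show ?thesis by simp
qed

text \<open>A time \<open>\<sigma>\<close>, at which trajectories are going to be stopped, together with rates that are constant
  in time on a trajectory that stays put, until \<open>\<sigma>\<close>. The waiting time for the next jump is therefore
  exponential up to \<open>\<sigma>\<close>. The last condition says that \<open>\<sigma>\<close> is predictable: it is determined by the
  trajectory strictly before it, so that a jump at \<open>\<sigma>\<close> or later does not move it.\<close>

locale rate_functional =
  fixes rate :: "(real \<Rightarrow> 'v::finite) \<Rightarrow> real \<Rightarrow> 'v \<Rightarrow> real"
    and \<sigma> :: "(real \<Rightarrow> 'v) \<Rightarrow> real" and C v :: real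
  assumes rate_nonneg: "x \<in> space path_space \<Longrightarrow> 0 \<le> r \<Longrightarrow> 0 \<le> rate x r j"
    and rate_sum_le: "x \<in> space path_space \<Longrightarrow> 0 \<le> r \<Longrightarrow> (\<Sum>j\<in>UNIV. rate x r j) \<le> C"
    and rate_measurable: "(\<lambda>p. rate (snd p) (fst p) j) \<in> borel_measurable (borel \<Otimes>\<^sub>M path_space)"
    and rate_restrict: "0 \<le> r \<Longrightarrow> rate (restrict x {0..}) r = rate x r"
    and rate_frozen: "x \<in> space path_space \<Longrightarrow> stop_path s x = x \<Longrightarrow> 0 \<le> s \<Longrightarrow> s \<le> r \<Longrightarrow> r < \<sigma> x \<Longrightarrow>
      rate x r j = rate x s j"
    and \<sigma>_measurable [measurable]: "\<sigma> \<in> borel_measurable path_space"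
    and \<sigma>_nonneg: "x \<in> space path_space \<Longrightarrow> 0 \<le> \<sigma> x"
    and \<sigma>_le: "x \<in> space path_space \<Longrightarrow> \<sigma> x \<le> v"
    and \<sigma>_cong: "x \<in> space path_space \<Longrightarrow> y \<in> space path_space \<Longrightarrow>
      (\<And>q. 0 \<le> q \<Longrightarrow> q < \<sigma> x \<Longrightarrow> y q = x q) \<Longrightarrow> \<sigma> y = \<sigma> x"
begin

lemma measurable_rate [measurable (raw)]:
  assumes "f \<in> borel_measurable M" "g \<in> measurable M path_space"
  shows "(\<lambda>\<omega>. rate (g \<omega>) (f \<omega>) j) \<in> borel_measurable M"
  using measurable_compose[OF measurable_Pair[OF assms] rate_measurable[of j]] by simp

lemma measurable_\<sigma> [measurable (raw)]:
  "g \<in> measurable M path_space \<Longrightarrow> (\<lambda>\<omega>. \<sigma> (g \<omega>)) \<in> borel_measurable M"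
  by (rule measurable_compose[OF _ \<sigma>_measurable])

abbreviation total :: "real \<Rightarrow> (real \<Rightarrow> 'v) \<Rightarrow> real" where
  "total s x \<equiv> (\<Sum>j\<in>UNIV. rate x s j)"

lemma total_nonneg: "x \<in> space path_space \<Longrightarrow> 0 \<le> s \<Longrightarrow> 0 \<le> total s x"
  by (intro sum_nonneg rate_nonneg)

lemma C_nonneg: "0 \<le> C"
proof -
  have "restrict (\<lambda>_. undefined) {0..} \<in> space path_space"
    by (rule restrict_in_path_space) (simp add: right_continuous_path_def)
  from total_nonneg[OF this] rate_sum_le[OF this] show ?thesis by (meson order_refl order_trans)
qed

abbreviation stopped :: "(real \<Rightarrow> 'v) \<Rightarrow> real \<Rightarrow> 'v" where
  "stopped x \<equiv> stop_path (\<sigma> x) x"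

lemma measurable_stopped [measurable]: "stopped \<in> measurable path_space path_space"
  by (rule measurable_stop_path) (auto intro: \<sigma>_nonneg)

lemma stopped_in: "x \<in> space path_space \<Longrightarrow> stopped x \<in> space path_space"
  using measurable_space[OF measurable_stopped] .

text \<open>The density of jumping at time \<open>r\<close>, summed over the targets \<open>j\<close> with the value of \<open>S\<close> at the history
  after this jump. The rates are taken at time \<open>s\<close>, since \<open>x\<close> stands for a history that is
  frozen after \<open>s\<close>.\<close>

definition jump_weight :: "(real \<Rightarrow> (real \<Rightarrow> 'v) \<Rightarrow> ennreal) \<Rightarrow> real \<Rightarrow> (real \<Rightarrow> 'v) \<Rightarrow> real \<Rightarrow> ennreal" where
  "jump_weight S s x r =
    (\<Sum>j\<in>UNIV. ennreal (rate x s j * exp (- total s x * (r - s))) * S r (redirect x r j))"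

text \<open>The right-hand side of the first-jump equation. A history that has already passed \<open>\<sigma>\<close> has no further
  freedom and is simply evaluated.\<close>

definition first_step ::
  "((real \<Rightarrow> 'v) \<Rightarrow> ennreal) \<Rightarrow> (real \<Rightarrow> (real \<Rightarrow> 'v) \<Rightarrow> ennreal) \<Rightarrow> real \<Rightarrow> (real \<Rightarrow> 'v) \<Rightarrow> ennreal" where
  "first_step G S s x = (if s \<le> \<sigma> x
     then ennreal (exp (- total s x * (\<sigma> x - s))) * G (stopped x) +
       (\<integral>\<^sup>+r. jump_weight S s x r * indicator {s..\<sigma> x} r \<partial>lborel)
     else G (stopped x))"

definition picard :: "((real \<Rightarrow> 'v) \<Rightarrow> ennreal) \<Rightarrow> nat \<Rightarrow> real \<Rightarrow> (real \<Rightarrow> 'v) \<Rightarrow> ennreal" where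
  "picard G n = (first_step G ^^ n) (\<lambda>_ _. 0)"

text \<open>The minimal solution of the first-jump equation: the expectation of \<open>G\<close> at the stopped trajectory,
  given the history \<open>x\<close> up to time \<open>s\<close>.\<close>

definition prediction :: "((real \<Rightarrow> 'v) \<Rightarrow> ennreal) \<Rightarrow> real \<Rightarrow> (real \<Rightarrow> 'v) \<Rightarrow> ennreal" where
  "prediction G s x = (SUP n. picard G n s x)"

lemma picard_0 [simp]: "picard G 0 = (\<lambda>_ _. 0)"
  and picard_Suc: "picard G (Suc n) = first_step G (picard G n)"
  by (simp_all add: picard_def)

lemma jump_weight_mono: "S \<le> S' \<Longrightarrow> jump_weight S s x r \<le> jump_weight S' s x r"
  unfolding jump_weight_def by (intro sum_mono mult_left_mono) (auto simp: le_fun_def)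

lemma first_step_mono: "G \<le> G' \<Longrightarrow> S \<le> S' \<Longrightarrow> first_step G S \<le> first_step G' S'"
  unfolding first_step_def le_fun_def[of "\<lambda>s x. _ s x" "\<lambda>s x. _ s x"]
  by (auto intro!: add_mono mult_left_mono nn_integral_mono mult_right_mono jump_weight_mono simp: le_fun_def)

lemma incseq_picard: "incseq (picard G)"
proof (rule incseq_SucI)
  fix n show "picard G n \<le> picard G (Suc n)"
  proof (induction n)
    case 0 show ?case by (simp add: le_fun_def)
  next
    case (Suc n) then show ?case
      unfolding picard_Suc[of G "Suc n"] picard_Suc[of G n] by (intro first_step_mono) auto
  qed
qed

lemma measurable_jump_weight:
  assumes S: "(\<lambda>p. S (fst p) (snd p)) \<in> borel_measurable (borel \<Otimes>\<^sub>M path_space)"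
    and [measurable]: "f \<in> borel_measurable M" "g \<in> measurable M path_space" "h \<in> borel_measurable M"
  shows "(\<lambda>\<omega>. jump_weight S (f \<omega>) (g \<omega>) (h \<omega>)) \<in> borel_measurable M"
proof -
  have [measurable]: "(\<lambda>\<omega>. S (h \<omega>) (redirect (g \<omega>) (h \<omega>) j)) \<in> borel_measurable M" for j
    using measurable_compose[OF measurable_Pair[of h M borel "\<lambda>\<omega>. redirect (g \<omega>) (h \<omega>) j" path_space] S]
    by simp
  show ?thesis unfolding jump_weight_def by measurable
qed

lemma measurable_first_step:
  assumes S: "(\<lambda>p. S (fst p) (snd p)) \<in> borel_measurable (borel \<Otimes>\<^sub>M path_space)"
    and G[measurable]: "G \<in> borel_measurable path_space"
  shows "(\<lambda>p. first_step G S (fst p) (snd p)) \<in> borel_measurable (borel \<Otimes>\<^sub>M path_space)"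
proof -
  have "(\<lambda>p. jump_weight S (fst (fst p)) (snd (fst p)) (snd p))
      \<in> borel_measurable ((borel \<Otimes>\<^sub>M path_space) \<Otimes>\<^sub>M lborel)"
    by (rule measurable_jump_weight[OF S]) measurable
  then have [measurable]: "(\<lambda>p. \<integral>\<^sup>+r. jump_weight S (fst p) (snd p) r * indicator {fst p..\<sigma> (snd p)} r \<partial>lborel)
     \<in> borel_measurable (borel \<Otimes>\<^sub>M path_space)"
    by (rule measurable_window_integral) measurable
  show ?thesis unfolding first_step_def by measurable
qed

lemma measurable_picard:
  assumes "G \<in> borel_measurable path_space"
  shows "(\<lambda>p. picard G n (fst p) (snd p)) \<in> borel_measurable (borel \<Otimes>\<^sub>M path_space)"
  by (induction n) (simp_all add: picard_Suc measurable_first_step assms)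

lemma measurable_prediction:
  assumes "G \<in> borel_measurable path_space"
  shows "(\<lambda>p. prediction G (fst p) (snd p)) \<in> borel_measurable (borel \<Otimes>\<^sub>M path_space)"
  unfolding prediction_def using measurable_picard[OF assms] by measurable

lemma measurable_prediction_at:
  assumes "G \<in> borel_measurable path_space" "f \<in> borel_measurable M" "g \<in> measurable M path_space"
  shows "(\<lambda>\<omega>. prediction G (f \<omega>) (g \<omega>)) \<in> borel_measurable M"
  using measurable_compose[OF measurable_Pair[OF assms(2,3)] measurable_prediction[OF assms(1)]] by simp

lemma jump_mass:
  assumes x: "x \<in> space path_space" and s: "0 \<le> s" "s \<le> b"
  shows "(\<integral>\<^sup>+r. jump_weight (\<lambda>_ _. K) s x r * indicator {s..b} r \<partial>lborel) = K * ennreal (1 - exp (- total s x * (b - s)))"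
proof -
  have "jump_weight (\<lambda>_ _. K) s x r = K * ennreal (total s x * exp (- total s x * (r - s)))" for r
    unfolding jump_weight_def sum_distrib_right[symmetric]
    by (subst sum_ennreal) (auto intro!: mult_nonneg_nonneg rate_nonneg x s simp: sum_distrib_right mult.commute)
  then show ?thesis
    using nn_integral_exponential[OF total_nonneg[OF x s(1)] s(2)]
    by (simp add: mult.assoc nn_integral_cmult)
qed

text \<open>The density of the first jump integrates to the probability of jumping. This bounds every
  iterate by a bound for \<open>G\<close>.\<close>

lemma jump_integral_le:
  assumes x: "x \<in> space path_space" and s: "0 \<le> s" "s \<le> b"
    and S: "\<And>r y. 0 \<le> r \<Longrightarrow> y \<in> space path_space \<Longrightarrow> S r y \<le> K"
  shows "(\<integral>\<^sup>+r. jump_weight S s x r * indicator {s..b} r \<partial>lborel) \<le> K * ennreal (1 - exp (- total s x * (b - s)))"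
  unfolding jump_mass[OF x s, symmetric]
proof (rule nn_integral_mono)
  fix r
  have "jump_weight S s x r \<le> jump_weight (\<lambda>_ _. K) s x r" if "s \<le> r"
    unfolding jump_weight_def using that s
    by (intro sum_mono mult_left_mono S redirect_in_path_space path_space_rc[OF x]) auto
  then show "jump_weight S s x r * indicator {s..b} r \<le> jump_weight (\<lambda>_ _. K) s x r * indicator {s..b} r"
    by (auto simp: indicator_def)
qed

lemma survival_split: "x \<in> space path_space \<Longrightarrow> 0 \<le> s \<Longrightarrow> s \<le> b \<Longrightarrow>
    (K::ennreal) = ennreal (exp (- total s x * (b - s))) * K + K * ennreal (1 - exp (- total s x * (b - s)))"
  using total_nonneg[of x s]
  by (simp add: mult.commute[of K] distrib_right[symmetric] ennreal_plus[symmetric] del: ennreal_plus)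

lemma picard_le:
  assumes G: "\<And>x. x \<in> space path_space \<Longrightarrow> G x \<le> K"
  shows "0 \<le> s \<Longrightarrow> x \<in> space path_space \<Longrightarrow> picard G n s x \<le> K"
proof (induction n arbitrary: s x)
  case (Suc n)
  show ?case
  proof (cases "s \<le> \<sigma> x")
    case True
    have "picard G (Suc n) s x \<le> ennreal (exp (- total s x * (\<sigma> x - s))) * K +
        K * ennreal (1 - exp (- total s x * (\<sigma> x - s)))"
      unfolding picard_Suc first_step_def if_P[OF True] using True Suc
      by (intro add_mono mult_left_mono jump_integral_le G stopped_in) auto
    then show ?thesis using survival_split[OF Suc.prems(2,1) True] by simp
  qed (use Suc G stopped_in in \<open>auto simp: picard_Suc first_step_def\<close>)
qed simp

lemma prediction_le:
  assumes "\<And>x. x \<in> space path_space \<Longrightarrow> G x \<le> K" "0 \<le> s" "x \<in> space path_space"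
  shows "prediction G s x \<le> K"
  unfolding prediction_def by (intro SUP_least picard_le assms)

lemma picard_tendsto: "(\<lambda>n. picard G n s x) \<longlonglongrightarrow> prediction G s x"
proof -
  have "incseq (\<lambda>n. picard G n s x)"
    using incseq_picard[of G] by (auto simp: incseq_def le_fun_def)
  then show ?thesis unfolding prediction_def by (rule LIMSEQ_SUP)
qed

text \<open>Monotone convergence under the integral. It is used for the fixed point of the iteration and
  again for the truncation of an unbounded \<open>G\<close>.\<close>

lemma first_step_tendsto:
  assumes x: "x \<in> space path_space"
    and S: "\<And>n. (\<lambda>p. S n (fst p) (snd p)) \<in> borel_measurable (borel \<Otimes>\<^sub>M path_space)" "incseq S"
    and lim: "\<And>r y. (\<lambda>n. S n r y) \<longlonglongrightarrow> S' r y" "(\<lambda>n. G n (stopped x)) \<longlonglongrightarrow> G' (stopped x)"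
  shows "(\<lambda>n. first_step (G n) (S n) s x) \<longlonglongrightarrow> first_step G' S' s x"
proof -
  have mono: "incseq (\<lambda>n r. jump_weight (S n) s x r * indicator {s..\<sigma> x} r)"
    using S(2) by (auto simp: incseq_def le_fun_def intro!: mult_right_mono jump_weight_mono)
  have "(\<lambda>n. jump_weight (S n) s x r * indicator {s..\<sigma> x} r) \<longlonglongrightarrow>
      jump_weight S' s x r * indicator {s..\<sigma> x} r" for r
    unfolding jump_weight_def
    by (cases "r \<in> {s..\<sigma> x}") (auto intro!: tendsto_sum ennreal_tendsto_cmult lim)
  then have "(\<lambda>n. \<integral>\<^sup>+r. jump_weight (S n) s x r * indicator {s..\<sigma> x} r \<partial>lborel) \<longlonglongrightarrow>
     (\<integral>\<^sup>+r. jump_weight S' s x r * indicator {s..\<sigma> x} r \<partial>lborel)"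
  proof (rule nn_integral_LIMSEQ[OF mono, rotated])
    fix n
    have [measurable]: "(\<lambda>r. jump_weight (S n) s x r) \<in> borel_measurable lborel"
      using x by (intro measurable_jump_weight[OF S(1), where g = "\<lambda>_. x"]) auto
    show "(\<lambda>r. jump_weight (S n) s x r * indicator {s..\<sigma> x} r) \<in> borel_measurable lborel"
      by measurable
  qed
  then show ?thesis
    unfolding first_step_def by (auto intro!: tendsto_add ennreal_tendsto_cmult lim)
qed

lemma prediction_eq:
  assumes G: "G \<in> borel_measurable path_space" and x: "x \<in> space path_space"
  shows "prediction G s x = first_step G (prediction G) s x"
proof (rule LIMSEQ_unique)
  show "(\<lambda>n. picard G (Suc n) s x) \<longlonglongrightarrow> prediction G s x"
    using picard_tendsto by (rule LIMSEQ_Suc)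
  show "(\<lambda>n. picard G (Suc n) s x) \<longlonglongrightarrow> first_step G (prediction G) s x"
    unfolding picard_Suc
    by (rule first_step_tendsto[OF x measurable_picard[OF G] incseq_picard]) (auto intro: picard_tendsto)
qed

lemma prediction_after:
  assumes G: "G \<in> borel_measurable path_space" and x: "x \<in> space path_space" and "\<sigma> x \<le> s"
  shows "prediction G s x = G (stopped x)"
proof (cases "s = \<sigma> x")
  case True
  then show ?thesis
    by (subst prediction_eq[OF G x]) (simp add: first_step_def nn_integral_singleton)
next
  case False
  then show ?thesis using assms by (subst prediction_eq[OF G x]) (simp add: first_step_def)
qed

text \<open>The waiting time is memoryless: having waited from \<open>s\<close> to \<open>b\<close>, the process faces the same
  equation at \<open>b\<close>. Hence the first-jump equation can be cut off at any time \<open>b \<le> \<sigma>\<close>.\<close>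

lemma prediction_flow:
  assumes G: "G \<in> borel_measurable path_space" and x: "x \<in> space path_space" "stop_path s x = x"
    and s: "0 \<le> s" "s \<le> b" "b \<le> \<sigma> x"
  shows "prediction G s x = ennreal (exp (- total s x * (b - s))) * prediction G b x +
    (\<integral>\<^sup>+r. jump_weight (prediction G) s x r * indicator {s..b} r \<partial>lborel)"
proof (cases "b = \<sigma> x")
  case True
  then show ?thesis
    using s prediction_after[OF G x(1), of b] by (subst prediction_eq[OF G x(1)]) (simp add: first_step_def)
next
  case False
  with s have b: "b < \<sigma> x" by simp
  let ?c = "total s x" and ?J = "jump_weight (prediction G)"
  have rate_b: "rate x b j = rate x s j" for j
    by (rule rate_frozen) (use x s b in auto)
  have meas [measurable]: "?J u x \<in> borel_measurable borel" for u
    using x by (intro measurable_jump_weight[OF measurable_prediction[OF G], where g = "\<lambda>_. x"]) auto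
  have shift: "ennreal (exp (- ?c * (b - s))) * ?J b x r = ?J s x r" if "b \<le> r" for r
  proof -
    have "ennreal (exp (- ?c * (b - s))) * ennreal (rate x s j * exp (- ?c * (r - b)))
        = ennreal (rate x s j * exp (- ?c * (r - s)))" for j
      using rate_nonneg[OF x(1) s(1), of j]
      by (simp add: ennreal_mult[symmetric] exp_add[symmetric] mult.left_commute algebra_simps)
    then show ?thesis
      unfolding jump_weight_def rate_b sum_distrib_left mult.assoc[symmetric] by simp
  qed
  have "(\<integral>\<^sup>+r. ?J s x r * indicator {s..\<sigma> x} r \<partial>lborel) =
      (\<integral>\<^sup>+r. ?J s x r * indicator {s..b} r + ?J s x r * indicator {b..\<sigma> x} r \<partial>lborel)"
    by (rule nn_integral_cong_AE, use AE_lborel_singleton[of b] in eventually_elim)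
      (use s in \<open>auto simp: indicator_def\<close>)
  also have "\<dots> = (\<integral>\<^sup>+r. ?J s x r * indicator {s..b} r \<partial>lborel) + (\<integral>\<^sup>+r. ?J s x r * indicator {b..\<sigma> x} r \<partial>lborel)"
    by (intro nn_integral_add) measurable
  also have "(\<integral>\<^sup>+r. ?J s x r * indicator {b..\<sigma> x} r \<partial>lborel) =
      (\<integral>\<^sup>+r. ennreal (exp (- ?c * (b - s))) * (?J b x r * indicator {b..\<sigma> x} r) \<partial>lborel)"
  proof (rule nn_integral_cong)
    fix r
    show "?J s x r * indicator {b..\<sigma> x} r = ennreal (exp (- ?c * (b - s))) * (?J b x r * indicator {b..\<sigma> x} r)"
      using shift[of r] by (cases "r \<in> {b..\<sigma> x}") simp_all
  qed
  also have "\<dots> = ennreal (exp (- ?c * (b - s))) * (\<integral>\<^sup>+r. ?J b x r * indicator {b..\<sigma> x} r \<partial>lborel)"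
    by (intro nn_integral_cmult) measurable
  finally have split: "(\<integral>\<^sup>+r. ?J s x r * indicator {s..\<sigma> x} r \<partial>lborel) =
    (\<integral>\<^sup>+r. ?J s x r * indicator {s..b} r \<partial>lborel) +
    ennreal (exp (- ?c * (b - s))) * (\<integral>\<^sup>+r. ?J b x r * indicator {b..\<sigma> x} r \<partial>lborel)" .
  have e: "ennreal (exp (- ?c * (\<sigma> x - s))) = ennreal (exp (- ?c * (b - s))) * ennreal (exp (- ?c * (\<sigma> x - b)))"
    by (simp add: ennreal_mult[symmetric] exp_add[symmetric] algebra_simps)
  have b_eq: "prediction G b x = ennreal (exp (- ?c * (\<sigma> x - b))) * G (stopped x) +
       (\<integral>\<^sup>+r. ?J b x r * indicator {b..\<sigma> x} r \<partial>lborel)"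
    using b by (subst prediction_eq[OF G x(1)]) (simp add: first_step_def rate_b)
  have "prediction G s x = ennreal (exp (- ?c * (\<sigma> x - s))) * G (stopped x) +
       (\<integral>\<^sup>+r. ?J s x r * indicator {s..\<sigma> x} r \<partial>lborel)"
    using s by (subst prediction_eq[OF G x(1)]) (simp add: first_step_def)
  then show ?thesis
    unfolding split e b_eq by (simp add: distrib_left mult.assoc ac_simps)
qed

text \<open>In a waiting period of length \<open>s' - s\<close> the process would have jumped with probability at most
  \<open>C (s' - s)\<close>, and only a jump can change the prediction, by at most \<open>K\<close>.\<close>

lemma prediction_regular:
  assumes G: "G \<in> borel_measurable path_space" and K: "\<And>x. x \<in> space path_space \<Longrightarrow> G x \<le> ennreal K" "0 \<le> K"
    and x: "x \<in> space path_space" "stop_path s x = x" and s: "0 \<le> s" "s \<le> s'"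
  shows "prediction G s x \<le> prediction G s' x + ennreal (K * C * (s' - s))"
    and "prediction G s' x \<le> prediction G s x + ennreal (K * C * (s' - s))"
proof -
  have "prediction G s x \<le> prediction G s' x + ennreal (K * C * (s' - s)) \<and>
     prediction G s' x \<le> prediction G s x + ennreal (K * C * (s' - s))"
  proof (cases "\<sigma> x < s")
    case True
    then show ?thesis using s prediction_after[OF G x(1), of s] prediction_after[OF G x(1), of s'] by simp
  next
    case False
    define b where "b = min s' (\<sigma> x)"
    have b: "s \<le> b" "b \<le> \<sigma> x" "b \<le> s'" using False s by (auto simp: b_def)
    have s'b: "prediction G s' x = prediction G b x"
      using prediction_after[OF G x(1), of s'] prediction_after[OF G x(1), of b]
      by (cases "s' \<le> \<sigma> x") (auto simp: b_def)
    let ?e = "exp (- total s x * (b - s))"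
    have "1 - ?e \<le> total s x * (b - s)" using exp_ge_add_one_self[of "- total s x * (b - s)"] by simp
    also have "\<dots> \<le> C * (s' - s)"
      using b rate_sum_le[OF x(1) s(1)] C_nonneg by (intro mult_mono) auto
    finally have e: "K * (1 - ?e) \<le> K * C * (s' - s)" using K(2) by (simp add: mult.assoc mult_left_mono)
    have e0: "0 \<le> total s x * (b - s)" using total_nonneg[OF x(1) s(1)] b(1) by simp
    then have e1: "0 \<le> 1 - ?e" by simp
    have Ke: "ennreal K * ennreal (1 - ?e) \<le> ennreal (K * C * (s' - s))"
      using e e1 K(2) by (simp add: ennreal_mult[symmetric] ennreal_leI)
    have "ennreal ?e * prediction G b x \<le> 1 * prediction G b x"
      using e0 by (intro mult_right_mono) auto
    moreover have "(\<integral>\<^sup>+r. jump_weight (prediction G) s x r * indicator {s..b} r \<partial>lborel) \<le> ennreal K * ennreal (1 - ?e)"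
      by (rule jump_integral_le[OF x(1) s(1) b(1)]) (intro prediction_le K(1))
    ultimately have *: "prediction G s x \<le> prediction G b x + ennreal (K * C * (s' - s))"
      unfolding prediction_flow[OF G x s(1) b(1,2)] using Ke
      by (intro add_mono) (auto intro: order_trans)
    have split: "prediction G b x = ennreal ?e * prediction G b x + prediction G b x * ennreal (1 - ?e)"
      by (rule survival_split[OF x(1) s(1) b(1)])
    moreover have "ennreal ?e * prediction G b x \<le> prediction G s x"
      unfolding prediction_flow[OF G x s(1) b(1,2)] by simp
    moreover have "prediction G b x * ennreal (1 - ?e) \<le> ennreal (K * C * (s' - s))"
      by (rule order_trans[OF _ Ke], intro mult_right_mono prediction_le K(1) x) (use b s in auto)
    ultimately have "prediction G b x \<le> prediction G s x + ennreal (K * C * (s' - s))"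
      by (subst split) (intro add_mono)
    with * show ?thesis unfolding s'b by simp
  qed
  then show "prediction G s x \<le> prediction G s' x + ennreal (K * C * (s' - s))"
    and "prediction G s' x \<le> prediction G s x + ennreal (K * C * (s' - s))" by auto
qed

end


section \<open>The first jump after a fixed time\<close>

text \<open>By right-continuity the infimum in \<open>next_jump\<close> is attained, by a jump away from the position
  held since \<open>s\<close>.\<close>

lemma first_jump:
  fixes x :: "real \<Rightarrow> 'v"
  assumes x: "right_continuous_path x" and s: "0 \<le> s" and jump: "s < r" "r \<le> v" "x r \<noteq> x s"
  shows "\<exists>\<tau>. next_jump x s = ereal \<tau> \<and> s < \<tau> \<and> \<tau> \<le> r \<and> x \<tau> \<noteq> x s \<and>
    (\<forall>q. s \<le> q \<longrightarrow> q < \<tau> \<longrightarrow> x q = x s)"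
proof -
  define A where "A = {r. s < r \<and> x r \<noteq> x s}"
  define \<tau> where "\<tau> = Inf A"
  have rA: "r \<in> A" using jump by (simp add: A_def)
  have bdd: "bdd_below A" by (rule bdd_belowI[of _ s]) (auto simp: A_def)
  obtain b where b: "s < b" "\<And>q. s \<le> q \<Longrightarrow> q < b \<Longrightarrow> x q = x s"
    using right_continuous_pathD[OF x s] by blast
  have "b \<le> \<tau>" unfolding \<tau>_def
  proof (rule cInf_greatest)
    fix q assume "q \<in> A"
    then show "b \<le> q" using b(2)[of q] by (cases "q < b") (auto simp: A_def)
  qed (use rA in blast)
  with b have "s < \<tau>" by simp
  have before: "x q = x s" if "s \<le> q" "q < \<tau>" for q
  proof (rule ccontr)
    assume "x q \<noteq> x s"
    with that have "q \<in> A" by (cases "q = s") (auto simp: A_def)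
    then have "\<tau> \<le> q" unfolding \<tau>_def by (rule cInf_lower[OF _ bdd])
    with that show False by simp
  qed
  have at: "x \<tau> \<noteq> x s"
  proof
    assume eq: "x \<tau> = x s"
    obtain b' where b': "\<tau> < b'" "\<And>q. \<tau> \<le> q \<Longrightarrow> q < b' \<Longrightarrow> x q = x \<tau>"
      using right_continuous_pathD[OF x order_trans[OF s less_imp_le[OF \<open>s < \<tau>\<close>]]] by blast
    have "b' \<le> Inf A"
    proof (rule cInf_greatest)
      fix q assume "q \<in> A"
      then have "\<tau> \<le> q" unfolding \<tau>_def by (rule cInf_lower[OF _ bdd])
      then show "b' \<le> q" using b'(2)[of q] eq \<open>q \<in> A\<close> by (cases "q < b'") (auto simp: A_def)
    qed (use rA in auto)
    with b' show False by (simp add: \<tau>_def)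
  qed
  have "next_jump x s = ereal \<tau>"
    unfolding next_jump_def A_def[symmetric]
  proof (rule antisym)
    show "(INF r\<in>A. ereal r) \<le> ereal \<tau>" by (rule INF_lower) (use at \<open>s < \<tau>\<close> in \<open>simp add: A_def\<close>)
    show "ereal \<tau> \<le> (INF r\<in>A. ereal r)"
      by (rule INF_greatest) (auto simp: \<tau>_def intro: cInf_lower[OF _ bdd])
  qed
  moreover have "\<tau> \<le> r" unfolding \<tau>_def by (rule cInf_lower[OF rA bdd])
  moreover have "\<forall>q. s \<le> q \<longrightarrow> q < \<tau> \<longrightarrow> x q = x s" using before by (intro allI impI)
  ultimately show ?thesis using \<open>s < \<tau>\<close> at by (intro exI[of _ \<tau>] conjI)
qed

lemma next_jump_le_iff:
  assumes "right_continuous_path x" "0 \<le> s"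
  shows "next_jump x s \<le> ereal v \<longleftrightarrow> (\<exists>r. s < r \<and> r \<le> v \<and> x r \<noteq> x s)"
proof
  assume le: "next_jump x s \<le> ereal v"
  show "\<exists>r. s < r \<and> r \<le> v \<and> x r \<noteq> x s"
  proof (cases "\<exists>r>s. x r \<noteq> x s")
    case True
    then obtain r where r: "s < r" "x r \<noteq> x s" by blast
    obtain \<tau> where "next_jump x s = ereal \<tau>" "s < \<tau>" "x \<tau> \<noteq> x s"
      using first_jump[OF assms r(1) order_refl r(2)] by blast
    then show ?thesis using le by auto
  next
    case False
    then have none: "{r. s < r \<and> x r \<noteq> x s} = {}" by auto
    have "next_jump x s = \<infinity>" unfolding next_jump_def none by (simp add: top_ereal_def)
    then show ?thesis using le by simp
  qed
next
  assume "\<exists>r. s < r \<and> r \<le> v \<and> x r \<noteq> x s"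
  then obtain r where r: "s < r" "r \<le> v" "x r \<noteq> x s" by blast
  then have "next_jump x s \<le> ereal r" unfolding next_jump_def by (intro INF_lower) auto
  with r show "next_jump x s \<le> ereal v" by (meson ereal_less_eq(3) order_trans)
qed

definition jumping :: "real \<Rightarrow> real \<Rightarrow> (real \<Rightarrow> 'v) set" where
  "jumping s v = {x \<in> space path_space. \<exists>r. s < r \<and> r \<le> v \<and> x r \<noteq> x s}"

text \<open>By right-continuity a jump in the window is seen at a rational time, or at the right endpoint if
  the jump takes place just there.\<close>

lemma jumping_measurable [measurable]:
  assumes "0 \<le> s"
  shows "(jumping s v :: (real \<Rightarrow> 'v::finite) set) \<in> sets path_space"
proof -
  have "(jumping s v :: (real \<Rightarrow> 'v) set) = {x \<in> space path_space. (s < v \<and> x v \<noteq> x s) \<or>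
      (\<exists>q::rat. s < of_rat q \<and> of_rat q < v \<and> x (of_rat q) \<noteq> x s)}" (is "_ = {x \<in> _. ?P x}")
  proof (intro set_eqI iffI)
    fix x :: "real \<Rightarrow> 'v" assume "x \<in> jumping s v"
    then obtain r where x: "x \<in> space path_space" and r: "s < r" "r \<le> v" "x r \<noteq> x s"
      by (auto simp: jumping_def)
    show "x \<in> {x \<in> space path_space. ?P x}"
    proof (cases "r = v")
      case False
      obtain b where b: "r < b" "\<And>q. r \<le> q \<Longrightarrow> q < b \<Longrightarrow> x q = x r"
        using right_continuous_pathD[OF path_space_rc[OF x] order_trans[OF assms less_imp_le[OF r(1)]]] by blast
      obtain q where q: "r < of_rat q" "of_rat q < min b v"
        using of_rat_dense[of r "min b v"] b(1) r False by auto
      then have "x (of_rat q) = x r" using b(2)[of "of_rat q"] by simp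
      then have "s < of_rat q \<and> of_rat q < v \<and> x (of_rat q) \<noteq> x s" using r q by simp
      then show ?thesis using x by blast
    qed (use r x in auto)
  next
    fix x :: "real \<Rightarrow> 'v" assume "x \<in> {x \<in> space path_space. ?P x}"
    then show "x \<in> jumping s v" unfolding jumping_def by (auto intro: less_imp_le)
  qed
  also have "\<dots> \<in> sets path_space"
  proof -
    have [measurable]: "(\<lambda>x. x r) \<in> measurable path_space (count_space (UNIV :: 'v set))" for r
      using measurable_path_at[of "\<lambda>_. r" path_space "\<lambda>x. x"] by simp
    show ?thesis by measurable
  qed
  finally show ?thesis .
qed

locale rate_process = rate_functional rate \<sigma> C v
  for rate :: "(real \<Rightarrow> 'v::finite) \<Rightarrow> real \<Rightarrow> 'v \<Rightarrow> real" and \<sigma> C v +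
  fixes x0 :: 'v and M :: "'w measure" and Y :: "real \<Rightarrow> 'w \<Rightarrow> 'v"
  assumes process: "jump_process rate x0 M Y"
begin

sublocale prob_space M
  using process by (simp add: jump_process_def)

text \<open>The process kept constant after \<open>s\<close>, which is the past up to \<open>s\<close> as an element of the path space, is
  what the rates are evaluated at.\<close>

definition history :: "real \<Rightarrow> 'w \<Rightarrow> real \<Rightarrow> 'v" where
  "history s \<omega> = stop_path s (\<lambda>r. Y r \<omega>)"

definition trajectory :: "'w \<Rightarrow> real \<Rightarrow> 'v" where
  "trajectory \<omega> = restrict (\<lambda>r. Y r \<omega>) {0..}"

lemma Y_rc: "\<omega> \<in> space M \<Longrightarrow> right_continuous_path (\<lambda>r. Y r \<omega>)"
  using process by (simp add: jump_process_def)

lemma Y_measurable: "0 \<le> s \<Longrightarrow> Y s \<in> measurable M (count_space UNIV)"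
  using process by (simp add: jump_process_def)

lemma trajectory_in: "\<omega> \<in> space M \<Longrightarrow> trajectory \<omega> \<in> space path_space"
  unfolding trajectory_def by (intro restrict_in_path_space Y_rc)

lemma trajectory_at: "0 \<le> r \<Longrightarrow> trajectory \<omega> r = Y r \<omega>"
  by (simp add: trajectory_def)

lemma measurable_trajectory [measurable]: "trajectory \<in> measurable M path_space"
proof (rule measurable_path_spaceI)
  fix r :: real assume "0 \<le> r"
  then show "(\<lambda>\<omega>. trajectory \<omega> r) \<in> measurable M (count_space UNIV)"
    using Y_measurable by (simp add: trajectory_at)
qed (rule trajectory_in)

lemma history_eq: "0 \<le> s \<Longrightarrow> history s \<omega> = stop_path s (trajectory \<omega>)"
  by (auto simp: history_def trajectory_def stop_path_def fun_eq_iff)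

lemma history_at: "0 \<le> r \<Longrightarrow> history s \<omega> r = Y (min r s) \<omega>"
  by (simp add: history_def stop_path_def)

lemma history_in: "0 \<le> s \<Longrightarrow> \<omega> \<in> space M \<Longrightarrow> history s \<omega> \<in> space path_space"
  unfolding history_def by (intro stop_path_in_path_space Y_rc)

lemma history_frozen: "0 \<le> s \<Longrightarrow> s \<le> r \<Longrightarrow> stop_path r (history s \<omega>) = history s \<omega>"
  by (simp add: history_eq stop_path_stop_path min_absorb2)

lemma measurable_history [measurable]: "0 \<le> s \<Longrightarrow> history s \<in> measurable M path_space"
  using measurable_stop_path[of "\<lambda>_. s" M trajectory] by (simp add: history_eq cong: measurable_cong)

definition jump_event :: "real \<Rightarrow> real \<Rightarrow> 'w set" where
  "jump_event s t = {\<omega> \<in> space M. \<exists>r. s < r \<and> r \<le> t \<and> Y r \<omega> \<noteq> Y s \<omega>}"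

definition jump_time :: "real \<Rightarrow> 'w \<Rightarrow> real" where
  "jump_time s \<omega> = real_of_ereal (next_jump (\<lambda>r. Y r \<omega>) s)"

lemma jump_event_history:
  assumes "0 \<le> s" "t \<le> u" "0 \<le> u" "\<omega> \<in> space M"
  shows "\<omega> \<in> jump_event s t \<longleftrightarrow> history u \<omega> \<in> jumping s t"
proof (cases "s < t")
  case True
  have "Y r \<omega> = history u \<omega> r" if "s \<le> r" "r \<le> t" for r
    using that assms by (simp add: history_at min_absorb1)
  then show ?thesis using assms history_in[OF assms(3,4)] True
    unfolding jump_event_def jumping_def by (auto simp: order.order_iff_strict[of s s])
qed (auto simp: jump_event_def jumping_def)

lemma jump_event_measurable [measurable]: "0 \<le> s \<Longrightarrow> jump_event s t \<in> sets M"
proof -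
  assume s: "0 \<le> s"
  let ?u = "max 0 t"
  have "jump_event s t = history ?u -` jumping s t \<inter> space M"
    using jump_event_history[OF s, of t ?u] by (auto simp: jump_event_def)
  also have "\<dots> \<in> sets M" using s by measurable
  finally show ?thesis .
qed

lemma jump_timeD:
  assumes "\<omega> \<in> jump_event s t" "0 \<le> s"
  shows "s < jump_time s \<omega>" "jump_time s \<omega> \<le> t" "Y (jump_time s \<omega>) \<omega> \<noteq> Y s \<omega>"
    "\<And>q. s \<le> q \<Longrightarrow> q < jump_time s \<omega> \<Longrightarrow> Y q \<omega> = Y s \<omega>"
proof -
  obtain r where r: "\<omega> \<in> space M" "s < r" "r \<le> t" "Y r \<omega> \<noteq> Y s \<omega>"
    using assms(1) by (auto simp: jump_event_def)
  obtain \<tau> where \<tau>: "next_jump (\<lambda>r. Y r \<omega>) s = ereal \<tau>" "s < \<tau>" "\<tau> \<le> r" "Y \<tau> \<omega> \<noteq> Y s \<omega>"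
    "\<And>q. s \<le> q \<Longrightarrow> q < \<tau> \<Longrightarrow> Y q \<omega> = Y s \<omega>"
    using first_jump[of "\<lambda>r. Y r \<omega>", OF Y_rc[OF r(1)] assms(2) r(2-4)] by blast
  have [simp]: "jump_time s \<omega> = \<tau>" by (simp add: jump_time_def \<tau>(1))
  show "s < jump_time s \<omega>" "jump_time s \<omega> \<le> t" "Y (jump_time s \<omega>) \<omega> \<noteq> Y s \<omega>" using \<tau>(1-4) r by auto
  show "Y q \<omega> = Y s \<omega>" if "s \<le> q" "q < jump_time s \<omega>" for q using \<tau>(5)[of q] that by simp
qed

lemma jump_time_le_iff:
  assumes "0 \<le> s" "\<omega> \<in> jump_event s t"
  shows "jump_time s \<omega> \<le> a \<longleftrightarrow> \<omega> \<in> jump_event s a"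
proof
  assume "jump_time s \<omega> \<le> a"
  then show "\<omega> \<in> jump_event s a"
    using jump_timeD(1,3)[OF assms(2,1)] assms(2) unfolding jump_event_def by blast
next
  assume "\<omega> \<in> jump_event s a"
  then show "jump_time s \<omega> \<le> a" by (rule jump_timeD(2)[OF _ assms(1)])
qed

text \<open>Without a jump in the window the value \<open>t + 1\<close> lies outside of the window. The first jump may be at
  infinity, and \<open>jump_time\<close> is then zero, which would be taken for an early time.\<close>

definition capped_time :: "real \<Rightarrow> real \<Rightarrow> 'w \<Rightarrow> real" where
  "capped_time s t \<omega> = (if \<omega> \<in> jump_event s t then jump_time s \<omega> else t + 1)"

lemma measurable_capped_time [measurable]:
  assumes s: "0 \<le> s"
  shows "capped_time s t \<in> borel_measurable M"
  unfolding borel_measurable_iff_le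
proof
  fix a
  have "{\<omega> \<in> space M. capped_time s t \<omega> \<le> a} =
      (jump_event s t \<inter> jump_event s a) \<union> (if t + 1 \<le> a then space M - jump_event s t else {})"
  proof -
    have "capped_time s t \<omega> \<le> a \<longleftrightarrow>
        (\<omega> \<in> jump_event s t \<and> \<omega> \<in> jump_event s a) \<or> (t + 1 \<le> a \<and> \<omega> \<notin> jump_event s t)" for \<omega>
      by (cases "\<omega> \<in> jump_event s t") (simp_all add: capped_time_def jump_time_le_iff[OF s])
    moreover have "jump_event s t \<subseteq> space M" by (auto simp: jump_event_def)
    ultimately show ?thesis by (cases "t + 1 \<le> a") (simp; blast)+
  qed
  also have "\<dots> \<in> sets M" using s by auto
  finally show "{\<omega> \<in> space M. capped_time s t \<omega> \<le> a} \<in> sets M" .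
qed

definition target_event :: "real \<Rightarrow> real \<Rightarrow> 'v \<Rightarrow> 'w set" where
  "target_event s t j = {\<omega> \<in> jump_event s t. Y (jump_time s \<omega>) \<omega> = j}"

lemma target_event_measurable [measurable]:
  assumes s: "0 \<le> s"
  shows "target_event s t j \<in> sets M"
proof -
  have [measurable]: "(\<lambda>\<omega>. trajectory \<omega> (capped_time s t \<omega>)) \<in> measurable M (count_space UNIV)"
    by (rule measurable_path_at[OF measurable_capped_time[OF s] measurable_trajectory])
  have "target_event s t j = jump_event s t \<inter> {\<omega> \<in> space M. trajectory \<omega> (capped_time s t \<omega>) = j}"
  proof -
    have at: "trajectory \<omega> (capped_time s t \<omega>) = Y (jump_time s \<omega>) \<omega>" if "\<omega> \<in> jump_event s t" for \<omega>
      using jump_timeD(1)[OF that s] s that by (simp add: capped_time_def trajectory_at)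
    have sub: "jump_event s t \<subseteq> space M" by (auto simp: jump_event_def)
    show ?thesis
    proof (rule set_eqI)
      fix \<omega>
      show "\<omega> \<in> target_event s t j \<longleftrightarrow>
          \<omega> \<in> jump_event s t \<inter> {\<omega> \<in> space M. trajectory \<omega> (capped_time s t \<omega>) = j}"
        using at[of \<omega>] sub by (cases "\<omega> \<in> jump_event s t") (auto simp: target_event_def)
    qed
  qed
  also have "\<dots> \<in> sets M" using s by measurable
  finally show ?thesis .
qed

end


section \<open>The joint law of the past and the first jump\<close>

context rate_functional
begin

lemma measurable_jump_density:
  "(\<lambda>p. jump_density rate (fst p) s (snd p) j) \<in> borel_measurable (path_space \<Otimes>\<^sub>M borel)"
proof -
  have "(\<lambda>p. \<integral>q. (if s \<le> q \<and> q \<le> snd p then 1 else 0) * total q (fst p) \<partial>lborel)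
      \<in> borel_measurable (path_space \<Otimes>\<^sub>M borel)"
    by (rule lborel.borel_measurable_lebesgue_integral) (simp add: split_beta', measurable)
  also have "(\<lambda>p. \<integral>q. (if s \<le> q \<and> q \<le> snd p then 1 else 0) * total q (fst p) \<partial>lborel) =
      (\<lambda>p. LBINT q:{s..snd p}. total q (fst p))"
    unfolding set_lebesgue_integral_def
    by (intro ext Bochner_Integration.integral_cong) (auto simp: indicator_def)
  finally have [measurable]: "(\<lambda>p. LBINT q:{s..snd p}. total q (fst p)) \<in> borel_measurable (path_space \<Otimes>\<^sub>M borel)" .
  show ?thesis unfolding jump_density_def by measurable
qed

lemma measurable_jump_density_at:
  assumes "f \<in> measurable M path_space" "g \<in> borel_measurable M"
  shows "(\<lambda>\<omega>. jump_density rate (f \<omega>) s (g \<omega>) j) \<in> borel_measurable M"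
  using measurable_compose[OF measurable_Pair[OF assms] measurable_jump_density] by simp

lemma jump_density_bounds:
  assumes x: "x \<in> space path_space" and s: "0 \<le> s" "s \<le> r"
  shows "0 \<le> jump_density rate x s r j" "jump_density rate x s r j \<le> rate x r j"
proof -
  have "0 \<le> (LBINT q:{s..r}. total q x)"
    unfolding set_lebesgue_integral_def
    by (rule Bochner_Integration.integral_nonneg) (use total_nonneg[OF x] s in \<open>auto simp: indicator_def\<close>)
  moreover have "0 \<le> rate x r j" using x s by (intro rate_nonneg) auto
  ultimately show "0 \<le> jump_density rate x s r j" "jump_density rate x s r j \<le> rate x r j"
    unfolding jump_density_def by (auto intro: mult_left_le)
qed

text \<open>As long as the rates are constant on the frozen history, the density is that of an
  exponential waiting time.\<close>

lemma jump_density_frozen: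
  assumes x: "x \<in> space path_space" "stop_path s x = x" and s: "0 \<le> s" "s \<le> r" "r < \<sigma> x"
  shows "jump_density rate x s r j = rate x s j * exp (- total s x * (r - s))"
proof -
  have "(LBINT q:{s..r}. total q x) = (LBINT q:{s..r}. total s x)"
  proof (rule set_lebesgue_integral_cong)
    show "\<forall>q. q \<in> {s..r} \<longrightarrow> total q x = total s x"
    proof (intro allI impI sum.cong refl)
      fix q k assume "q \<in> {s..r}"
      then show "rate x q k = rate x s k" using s by (intro rate_frozen x) auto
    qed
  qed simp
  also have "\<dots> = total s x * (r - s)" using s by (simp add: set_lebesgue_integral_def)
  finally show ?thesis using rate_frozen[OF x s] by (simp add: jump_density_def)
qed

lemma jump_density_integral:
  assumes x: "x \<in> space path_space" and s: "0 \<le> s"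
  shows "ennreal (LBINT r:{s..a}. jump_density rate x s r j) =
    (\<integral>\<^sup>+r. ennreal (jump_density rate x s r j) * indicator {s..a} r \<partial>lborel)"
    and "0 \<le> (LBINT r:{s..a}. jump_density rate x s r j)"
proof -
  have bd: "0 \<le> jump_density rate x s r j" "jump_density rate x s r j \<le> C" if "s \<le> r" for r
  proof -
    have "rate x r j \<le> total r x"
      by (rule member_le_sum) (use rate_nonneg[OF x] s that in auto)
    then show "0 \<le> jump_density rate x s r j" "jump_density rate x s r j \<le> C"
      using jump_density_bounds[OF x s that, of j] rate_sum_le[OF x, of r] s that by auto
  qed
  have meas: "(\<lambda>r. jump_density rate x s r j) \<in> borel_measurable lborel"
    by (rule measurable_jump_density_at) (use x in auto)
  have "integrable lborel (\<lambda>r. indicator {s..a} r *\<^sub>R jump_density rate x s r j)"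
  proof (rule integrableI_bounded_set_indicator[where B = C])
    show "AE r in lborel. r \<in> {s..a} \<longrightarrow> norm (jump_density rate x s r j) \<le> C"
      using bd by auto
    show "emeasure lborel {s..a} < \<infinity>" by (simp add: emeasure_lborel_Icc_eq)
  qed (use meas in auto)
  then have "ennreal (LBINT r:{s..a}. jump_density rate x s r j) =
      (\<integral>\<^sup>+r. ennreal (indicator {s..a} r *\<^sub>R jump_density rate x s r j) \<partial>lborel)"
    unfolding set_lebesgue_integral_def
    by (intro nn_integral_eq_integral[symmetric]) (auto simp: indicator_def bd)
  also have "\<dots> = (\<integral>\<^sup>+r. ennreal (jump_density rate x s r j) * indicator {s..a} r \<partial>lborel)"
    by (intro nn_integral_cong) (auto simp: indicator_def)
  finally show "ennreal (LBINT r:{s..a}. jump_density rate x s r j) =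
    (\<integral>\<^sup>+r. ennreal (jump_density rate x s r j) * indicator {s..a} r \<partial>lborel)" .
  show "0 \<le> (LBINT r:{s..a}. jump_density rate x s r j)"
    unfolding set_lebesgue_integral_def
    by (rule Bochner_Integration.integral_nonneg) (auto simp: indicator_def bd)
qed

end

context rate_process
begin

lemma natural_filtration_subalgebra: "subalgebra M (natural_filtration M Y s)"
  unfolding subalgebra_def
proof
  show "space (natural_filtration M Y s) = space M" by (simp add: natural_filtration_def space_measure_of_conv)
  have gen: "(\<Union>r\<in>{0..s}. {Y r -` A \<inter> space M |A. A \<in> UNIV}) \<subseteq> sets M"
    using measurable_sets[OF Y_measurable] by auto
  have Pow: "(\<Union>r\<in>{0..s}. {Y r -` A \<inter> space M |A. A \<in> UNIV}) \<subseteq> Pow (space M)"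
    by blast
  show "sets (natural_filtration M Y s) \<subseteq> sets M"
    unfolding natural_filtration_def sets_measure_of[OF Pow] by (rule sets.sigma_sets_subset[OF gen])
qed

lemma history_adapted:
  assumes s: "0 \<le> s"
  shows "history s \<in> measurable (natural_filtration M Y s) path_space"
proof (rule measurable_path_spaceI)
  have space: "space (natural_filtration M Y s) = space M"
    using natural_filtration_subalgebra by (simp add: subalgebra_def)
  show "history s \<omega> \<in> space path_space" if "\<omega> \<in> space (natural_filtration M Y s)" for \<omega>
    using that s by (simp add: space history_in)
  fix r :: real assume r: "0 \<le> r"
  show "(\<lambda>\<omega>. history s \<omega> r) \<in> measurable (natural_filtration M Y s) (count_space UNIV)"
  proof (rule measurableI)
    fix A :: "'v set"
    have Pow: "(\<Union>r\<in>{0..s}. {Y r -` A \<inter> space M |A. A \<in> UNIV}) \<subseteq> Pow (space M)"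
      by blast
    have "min r s \<in> {0..s}" using r s by simp
    then have "Y (min r s) -` A \<inter> space M \<in> (\<Union>r\<in>{0..s}. {Y r -` A \<inter> space M |A. A \<in> UNIV})"
      by blast
    then have "Y (min r s) -` A \<inter> space M \<in> sets (natural_filtration M Y s)"
      unfolding natural_filtration_def sets_measure_of[OF Pow] by (rule sigma_sets.Basic)
    then show "(\<lambda>\<omega>. history s \<omega> r) -` A \<inter> space (natural_filtration M Y s) \<in> sets (natural_filtration M Y s)"
      using r by (simp add: space history_at)
  qed simp
qed

text \<open>The defining property of the process, integrated over an event of the past. It turns
  the conditional expectation into an identity between measures of sets.\<close>

lemma first_jump_law:
  assumes s: "0 \<le> s" "s \<le> a" and A: "A \<in> sets path_space"
  shows "emeasure M (target_event s a j \<inter> (history s -` A \<inter> space M)) =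
    (\<integral>\<^sup>+\<omega>. indicator A (history s \<omega>) *
      (\<integral>\<^sup>+r. ennreal (jump_density rate (history s \<omega>) s r j) * indicator {s..a} r \<partial>lborel) \<partial>M)"
proof -
  let ?F = "natural_filtration M Y s" and ?B = "history s -` A \<inter> space M" and ?E = "target_event s a j"
  let ?g = "\<lambda>\<omega>. LBINT r:{s..a}. jump_density rate (history s \<omega>) s r j"
  interpret F: finite_measure_subalgebra M ?F
    using natural_filtration_subalgebra by unfold_locales
  have B: "?B \<in> sets ?F"
    using measurable_sets[OF history_adapted[OF s(1)] A] natural_filtration_subalgebra
    by (simp add: subalgebra_def)
  then have BM: "?B \<in> sets M" using natural_filtration_subalgebra by (auto simp: subalgebra_def)
  have EM: "?E \<in> sets M" using s by simp
  have E: "{\<omega> \<in> space M. next_jump (\<lambda>r. Y r \<omega>) s \<le> ereal a \<and>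
      Y (real_of_ereal (next_jump (\<lambda>r. Y r \<omega>) s)) \<omega> = j} = ?E"
    using next_jump_le_iff[OF Y_rc s(1)]
    by (auto simp: target_event_def jump_event_def jump_time_def)
  have rate_eq: "rate (\<lambda>q. Y (min q s) \<omega>) r = rate (history s \<omega>) r" if "s \<le> r" for \<omega> r
    using rate_restrict[of r "\<lambda>q. Y (min q s) \<omega>"] s that by (simp add: history_def stop_path_def)
  have jd: "jump_density rate (\<lambda>q. Y (min q s) \<omega>) s r j = jump_density rate (history s \<omega>) s r j"
    if "s \<le> r" for \<omega> r
  proof -
    have "(LBINT q:{s..r}. \<Sum>k\<in>UNIV. rate (\<lambda>q. Y (min q s) \<omega>) q k) = (LBINT q:{s..r}. total q (history s \<omega>))"
      by (rule set_lebesgue_integral_cong) (simp_all add: rate_eq)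
    then show ?thesis using that by (simp add: jump_density_def rate_eq)
  qed
  have g_eq: "(LBINT r:{s..a}. jump_density rate (\<lambda>q. Y (min q s) \<omega>) s r j) = ?g \<omega>" for \<omega>
    by (rule set_lebesgue_integral_cong) (simp_all add: jd)
  have cond: "AE \<omega> in M. real_cond_exp M ?F (indicator ?E) \<omega> = ?g \<omega>"
    using process s unfolding jump_process_def E[symmetric] g_eq[symmetric] by blast
  have int_E: "integrable M (indicator ?E :: _ \<Rightarrow> real)"
    using EM by (intro integrable_real_indicator) (auto simp: less_top[symmetric])
  have g_meas: "?g \<in> borel_measurable M"
  proof -
    have [measurable]: "(\<lambda>p. jump_density rate (history s (fst p)) s (snd p) j) \<in> borel_measurable (M \<Otimes>\<^sub>M lborel)"
      using s by (intro measurable_jump_density_at) measurable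
    show ?thesis
      unfolding set_lebesgue_integral_def
      by (rule lborel.borel_measurable_lebesgue_integral) (simp add: split_beta', measurable)
  qed
  have g_int: "integrable M ?g"
    by (rule integrable_cong_AE[THEN iffD1, OF _ _ cond F.real_cond_exp_int(1)[OF int_E]]) (use g_meas in auto)
  have "measure M (?E \<inter> ?B) = (\<integral>\<omega>. indicator ?B \<omega> *\<^sub>R indicator ?E \<omega> \<partial>M)"
    using BM EM by (simp add: indicator_inter_arith[symmetric] Int_commute)
  also have "\<dots> = (\<integral>\<omega>. indicator ?B \<omega> *\<^sub>R real_cond_exp M ?F (indicator ?E) \<omega> \<partial>M)"
    using F.real_cond_exp_intA[OF int_E B] by (simp add: set_lebesgue_integral_def)
  also have "\<dots> = (\<integral>\<omega>. indicator ?B \<omega> *\<^sub>R ?g \<omega> \<partial>M)"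
    by (rule integral_cong_AE) (use BM g_meas cond in auto)
  finally have meas_eq: "measure M (?E \<inter> ?B) = (\<integral>\<omega>. indicator ?B \<omega> *\<^sub>R ?g \<omega> \<partial>M)" .
  have "emeasure M (?E \<inter> ?B) = ennreal (\<integral>\<omega>. indicator ?B \<omega> *\<^sub>R ?g \<omega> \<partial>M)"
    by (simp add: emeasure_eq_measure meas_eq)
  also have "\<dots> = (\<integral>\<^sup>+\<omega>. ennreal (indicator ?B \<omega> *\<^sub>R ?g \<omega>) \<partial>M)"
    using jump_density_integral(2)[OF history_in[OF s(1)] s(1)]
    by (intro nn_integral_eq_integral[symmetric] integrable_mult_indicator BM g_int)
      (auto simp: indicator_def)
  also have "\<dots> = (\<integral>\<^sup>+\<omega>. indicator A (history s \<omega>) *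
      (\<integral>\<^sup>+r. ennreal (jump_density rate (history s \<omega>) s r j) * indicator {s..a} r \<partial>lborel) \<partial>M)"
    using jump_density_integral(1)[OF history_in[OF s(1)] s(1)]
    by (intro nn_integral_cong) (simp add: indicator_def)
  finally show ?thesis .
qed

end


text \<open>The conditional distribution of the jump time is given by its values on half-lines. Together with
  the events of the past these form an intersection-stable generator.\<close>

lemma sets_times_atMost:
  "sets (N \<Otimes>\<^sub>M (borel :: real measure)) =
    sigma_sets (space N \<times> UNIV) {A \<times> {..a} | A a. A \<in> sets N}"
proof -
  have "sets (N \<Otimes>\<^sub>M (borel :: real measure)) =
      sets (sigma (space N) (sets N) \<Otimes>\<^sub>M sigma UNIV (range (\<lambda>a::real. {..a})))"
    by (intro sets_pair_measure_cong)
      (simp_all add: borel_eq_atMost[symmetric] sets.sigma_sets_eq sets.space_closed)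
  also have "\<dots> = sets (sigma (space N \<times> UNIV)
      {A \<times> B | A B. A \<in> sets N \<and> B \<in> range (\<lambda>a::real. {..a})})"
  proof (subst sigma_prod)
    show "\<exists>E\<subseteq>sets N. countable E \<and> space N = \<Union> E" by (intro exI[of _ "{space N}"]) auto
    have "UNIV = (\<Union>n::nat. {..real n})" using real_arch_simple by auto
    then show "\<exists>E\<subseteq>range (\<lambda>a::real. {..a}). countable E \<and> UNIV = \<Union> E"
      by (intro exI[of _ "range (\<lambda>n::nat. {..real n})"]) auto
  qed (auto simp: sets.space_closed)
  also have "\<dots> = sigma_sets (space N \<times> UNIV) {A \<times> {..a} | A a. A \<in> sets N}"
  proof -
    have "{A \<times> B | A B. A \<in> sets N \<and> B \<in> range (\<lambda>a::real. {..a})} = {A \<times> {..a} | A a. A \<in> sets N}"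
      by blast
    moreover have "{A \<times> {..a} | A (a::real). A \<in> sets N} \<subseteq> Pow (space N \<times> UNIV)"
      using sets.sets_into_space by blast
    ultimately show ?thesis by (simp only: sets_measure_of)
  qed
  finally show ?thesis .
qed

lemma measure_eqI_times_atMost:
  fixes M1 M2 :: "('a \<times> real) measure"
  assumes sets: "sets M1 = sets (N \<Otimes>\<^sub>M borel)" "sets M2 = sets (N \<Otimes>\<^sub>M borel)"
    and finite: "emeasure M1 (space M1) \<noteq> \<infinity>"
    and eq: "\<And>A a. A \<in> sets N \<Longrightarrow> emeasure M1 (A \<times> {..a}) = emeasure M2 (A \<times> {..a})"
  shows "M1 = M2"
proof (rule measure_eqI_generator_eq[where E = "{A \<times> {..a} | A a. A \<in> sets N}"
      and \<Omega> = "space N \<times> UNIV" and A = "\<lambda>n. space N \<times> {..real n}"])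
  show "Int_stable {A \<times> {..a::real} | A a. A \<in> sets N}"
  proof (rule Int_stableI)
    fix X Y assume "X \<in> {A \<times> {..a::real} | A a. A \<in> sets N}" "Y \<in> {A \<times> {..a::real} | A a. A \<in> sets N}"
    then obtain A a B b where "X = A \<times> {..a::real}" "Y = B \<times> {..b::real}" "A \<in> sets N" "B \<in> sets N" by blast
    then have "X \<inter> Y = (A \<inter> B) \<times> {..min a b}" "A \<inter> B \<in> sets N" by auto
    then show "X \<inter> Y \<in> {A \<times> {..a::real} | A a. A \<in> sets N}" by blast
  qed
  show "{A \<times> {..a::real} | A a. A \<in> sets N} \<subseteq> Pow (space N \<times> UNIV)"
    using sets.sets_into_space by blast
  show "sets M1 = sigma_sets (space N \<times> UNIV) {A \<times> {..a} | A a. A \<in> sets N}"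
    "sets M2 = sigma_sets (space N \<times> UNIV) {A \<times> {..a} | A a. A \<in> sets N}"
    using sets by (simp_all only: sets_times_atMost)
  show "range (\<lambda>n. space N \<times> {..real n}) \<subseteq> {A \<times> {..a} | A a. A \<in> sets N}" by blast
  show "(\<Union>n. space N \<times> {..real n}) = space N \<times> UNIV" using real_arch_simple by auto
  show "emeasure M1 (space N \<times> {..real n}) \<noteq> \<infinity>" for n
  proof -
    have "emeasure M1 (space N \<times> {..real n}) \<le> emeasure M1 (space M1)" by (rule emeasure_space)
    with finite show ?thesis by (auto simp: top_unique)
  qed
  show "emeasure M1 X = emeasure M2 X" if "X \<in> {A \<times> {..a} | A a. A \<in> sets N}" for X
    using that eq by blast
qed

context rate_process
begin

lemma jump_event_min:
  assumes "0 \<le> s"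
  shows "jump_event s t \<inter> jump_event s a = jump_event s (min t a)"
proof (rule set_eqI)
  fix \<omega>
  show "\<omega> \<in> jump_event s t \<inter> jump_event s a \<longleftrightarrow> \<omega> \<in> jump_event s (min t a)"
  proof
    assume *: "\<omega> \<in> jump_event s t \<inter> jump_event s a"
    then have "jump_time s \<omega> \<le> t" "jump_time s \<omega> \<le> a" using jump_timeD(2)[OF _ assms] by auto
    then show "\<omega> \<in> jump_event s (min t a)" using jump_time_le_iff[OF assms, of \<omega> t "min t a"] * by auto
  next
    assume "\<omega> \<in> jump_event s (min t a)"
    then show "\<omega> \<in> jump_event s t \<inter> jump_event s a" unfolding jump_event_def by (auto; blast)
  qed
qed

lemma target_event_min:
  assumes "0 \<le> s"
  shows "target_event s t j \<inter> {\<omega> \<in> space M. capped_time s t \<omega> \<le> a} = target_event s (min t a) j"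
proof (rule set_eqI)
  fix \<omega>
  show "\<omega> \<in> target_event s t j \<inter> {\<omega> \<in> space M. capped_time s t \<omega> \<le> a} \<longleftrightarrow> \<omega> \<in> target_event s (min t a) j"
    unfolding target_event_def jump_event_min[OF assms, symmetric]
    using jump_time_le_iff[OF assms, of \<omega> t a]
    by (cases "\<omega> \<in> jump_event s t") (auto simp: capped_time_def jump_event_def)
qed

text \<open>Past and jump time have a joint law with density \<open>jump_density\<close> with respect to the law of the past
  times Lebesgue measure, on the event of jumping to \<open>j\<close>. By \<open>first_jump_law\<close> this
  holds on products with half-lines, and these determine the measure.\<close>

lemma joint_jump_law:
  assumes s: "0 \<le> s" "s \<le> t" and H: "H \<in> borel_measurable (path_space \<Otimes>\<^sub>M borel)"
  shows "(\<integral>\<^sup>+\<omega>. indicator (target_event s t j) \<omega> * H (history s \<omega>, jump_time s \<omega>) \<partial>M) =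
    (\<integral>\<^sup>+\<omega>. \<integral>\<^sup>+r. ennreal (jump_density rate (history s \<omega>) s r j) * indicator {s..t} r *
        H (history s \<omega>, r) \<partial>lborel \<partial>M)"
proof -
  note [measurable] = measurable_history[OF s(1)] target_event_measurable[OF s(1)] measurable_capped_time[OF s(1)]
  let ?E = "target_event s t j" and ?f = "\<lambda>\<omega>. (history s \<omega>, capped_time s t \<omega>)"
  let ?d = "\<lambda>p. ennreal (jump_density rate (fst p) s (snd p) j) * indicator {s..t} (snd p)"
  \<comment> \<open>The law of past and jump time on the event, and the measure with the claimed density.\<close>
  define \<mu> where "\<mu> = distr (density M (indicator ?E)) (path_space \<Otimes>\<^sub>M borel) ?f"
  define Q where "Q = distr M path_space (history s)"
  define \<nu> where "\<nu> = density (Q \<Otimes>\<^sub>M lborel) ?d"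
  have f[measurable]: "?f \<in> measurable M (path_space \<Otimes>\<^sub>M borel)" by measurable
  have sets_Q: "sets (Q \<Otimes>\<^sub>M lborel) = sets (path_space \<Otimes>\<^sub>M borel)"
    by (intro sets_pair_measure_cong) (simp_all add: Q_def)
  have meas_Q: "borel_measurable (Q \<Otimes>\<^sub>M lborel) = borel_measurable (path_space \<Otimes>\<^sub>M borel)"
    by (rule measurable_cong_sets[OF sets_Q refl])
  have jd[measurable]: "(\<lambda>p. jump_density rate (fst p) s (snd p) j) \<in> borel_measurable (path_space \<Otimes>\<^sub>M borel)"
    by (rule measurable_jump_density)
  have d[measurable]: "?d \<in> borel_measurable (path_space \<Otimes>\<^sub>M borel)" by measurable
  have int_\<mu>: "(\<integral>\<^sup>+p. F p \<partial>\<mu>) = (\<integral>\<^sup>+\<omega>. indicator ?E \<omega> * F (history s \<omega>, capped_time s t \<omega>) \<partial>M)"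
    if [measurable]: "F \<in> borel_measurable (path_space \<Otimes>\<^sub>M borel)" for F
    unfolding \<mu>_def by (subst nn_integral_distr) (simp_all add: nn_integral_density)
  have int_\<nu>: "(\<integral>\<^sup>+p. F p \<partial>\<nu>) = (\<integral>\<^sup>+\<omega>. \<integral>\<^sup>+r. ?d (history s \<omega>, r) * F (history s \<omega>, r) \<partial>lborel \<partial>M)"
    if F[measurable]: "F \<in> borel_measurable (path_space \<Otimes>\<^sub>M borel)" for F
  proof -
    have dF: "(\<lambda>p. ?d p * F p) \<in> borel_measurable (Q \<Otimes>\<^sub>M lborel)" unfolding meas_Q by measurable
    have "(\<integral>\<^sup>+p. F p \<partial>\<nu>) = (\<integral>\<^sup>+p. ?d p * F p \<partial>(Q \<Otimes>\<^sub>M lborel))"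
      unfolding \<nu>_def by (rule nn_integral_density) (simp_all only: meas_Q d F)
    also have "\<dots> = (\<integral>\<^sup>+x. \<integral>\<^sup>+r. ?d (x, r) * F (x, r) \<partial>lborel \<partial>Q)"
      by (rule lborel.nn_integral_fst[OF dF, symmetric])
    also have "\<dots> = (\<integral>\<^sup>+\<omega>. \<integral>\<^sup>+r. ?d (history s \<omega>, r) * F (history s \<omega>, r) \<partial>lborel \<partial>M)"
    proof -
      have "(\<lambda>x. \<integral>\<^sup>+r. ?d (x, r) * F (x, r) \<partial>lborel) \<in> borel_measurable Q"
        by (rule lborel.borel_measurable_nn_integral_fst[OF dF])
      then show ?thesis unfolding Q_def by (intro nn_integral_distr) simp_all
    qed
    finally show ?thesis .
  qed
  have "\<mu> = \<nu>"
  proof (rule measure_eqI_times_atMost[where N = path_space])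
    show "sets \<mu> = sets (path_space \<Otimes>\<^sub>M borel)" by (simp add: \<mu>_def)
    show "sets \<nu> = sets (path_space \<Otimes>\<^sub>M borel)" unfolding \<nu>_def sets_density by (rule sets_Q)
    have "emeasure \<mu> (space \<mu>) = (\<integral>\<^sup>+p. 1 \<partial>\<mu>)" by simp
    also have "\<dots> = emeasure M ?E" by (subst int_\<mu>) simp_all
    finally show "emeasure \<mu> (space \<mu>) \<noteq> \<infinity>" by simp
    fix A :: "(real \<Rightarrow> 'v) set" and a :: real assume A[measurable]: "A \<in> sets path_space"
    then have Aa: "A \<times> {..a} \<in> sets (path_space \<Otimes>\<^sub>M borel)" by measurable
    have "emeasure \<mu> (A \<times> {..a}) = (\<integral>\<^sup>+p. indicator (A \<times> {..a}) p \<partial>\<mu>)"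
      using Aa by (intro nn_integral_indicator[symmetric]) (simp add: \<mu>_def)
    also have "\<dots> = (\<integral>\<^sup>+\<omega>. indicator ?E \<omega> * indicator (A \<times> {..a}) (history s \<omega>, capped_time s t \<omega>) \<partial>M)"
      using Aa by (intro int_\<mu>) simp
    also have "\<dots> = (\<integral>\<^sup>+\<omega>. indicator (target_event s (min t a) j \<inter> (history s -` A \<inter> space M)) \<omega> \<partial>M)"
      unfolding target_event_min[OF s(1), symmetric]
      by (intro nn_integral_cong) (auto simp: indicator_def)
    also have "\<dots> = emeasure M (target_event s (min t a) j \<inter> (history s -` A \<inter> space M))"
      using s by (intro nn_integral_indicator) measurable
    also have "\<dots> = (\<integral>\<^sup>+\<omega>. \<integral>\<^sup>+r. ?d (history s \<omega>, r) * indicator (A \<times> {..a}) (history s \<omega>, r) \<partial>lborel \<partial>M)"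
    proof (cases "s \<le> a")
      case True
      then have "s \<le> min t a" using s by simp
      have "indicator A (history s \<omega>) * (\<integral>\<^sup>+r. ennreal (jump_density rate (history s \<omega>) s r j) * indicator {s..min t a} r \<partial>lborel) =
         (\<integral>\<^sup>+r. ?d (history s \<omega>, r) * indicator (A \<times> {..a}) (history s \<omega>, r) \<partial>lborel)" for \<omega>
        by (cases "history s \<omega> \<in> A")
          (auto intro!: nn_integral_cong simp: indicator_def split: if_splits)
      then show ?thesis using first_jump_law[OF s(1) \<open>s \<le> min t a\<close> A] by simp
    next
      case False
      then have "target_event s (min t a) j = {}" by (auto simp: target_event_def jump_event_def)
      moreover have zero: "?d (history s \<omega>, r) * indicator (A \<times> {..a}) (history s \<omega>, r) = 0" for \<omega> r
        using False by (auto simp: indicator_def)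
      ultimately show ?thesis by (simp only: zero emeasure_empty Int_empty_left nn_integral_0_iff nn_integral_const mult_zero_left)
    qed
    also have "\<dots> = (\<integral>\<^sup>+p. indicator (A \<times> {..a}) p \<partial>\<nu>)"
      using Aa by (intro int_\<nu>[symmetric]) simp
    also have "\<dots> = emeasure \<nu> (A \<times> {..a})"
      using Aa by (intro nn_integral_indicator) (simp only: \<nu>_def sets_density sets_Q)
    finally show "emeasure \<mu> (A \<times> {..a}) = emeasure \<nu> (A \<times> {..a})" .
  qed
  have "(\<integral>\<^sup>+\<omega>. indicator ?E \<omega> * H (history s \<omega>, jump_time s \<omega>) \<partial>M) =
      (\<integral>\<^sup>+\<omega>. indicator ?E \<omega> * H (history s \<omega>, capped_time s t \<omega>) \<partial>M)"
    by (intro nn_integral_cong) (auto simp: indicator_def capped_time_def target_event_def)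
  also have "\<dots> = (\<integral>\<^sup>+p. H p \<partial>\<nu>)" using int_\<mu>[OF H] \<open>\<mu> = \<nu>\<close> by simp
  also have "\<dots> = (\<integral>\<^sup>+\<omega>. \<integral>\<^sup>+r. ?d (history s \<omega>, r) * H (history s \<omega>, r) \<partial>lborel \<partial>M)"
    by (rule int_\<nu>[OF H])
  finally show ?thesis by simp
qed

text \<open>Restricted to jumps up to \<open>\<sigma>\<close>, the density is explicit. At \<open>\<sigma>\<close> itself the rates need not be
  constant any more, but a jump exactly at \<open>\<sigma>\<close> has probability zero.\<close>

lemma first_jump_before_\<sigma>:
  assumes s: "0 \<le> s" "s \<le> t"
    and H: "\<And>j. (\<lambda>p. H j (fst p) (snd p)) \<in> borel_measurable (path_space \<Otimes>\<^sub>M borel)"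
  shows "(\<integral>\<^sup>+\<omega>. (\<Sum>j\<in>UNIV. indicator (target_event s t j) \<omega> *
        (if s \<le> \<sigma> (history s \<omega>) \<and> jump_time s \<omega> \<le> \<sigma> (history s \<omega>) then H j (history s \<omega>) (jump_time s \<omega>) else 0)) \<partial>M) =
    (\<integral>\<^sup>+\<omega>. (if s \<le> \<sigma> (history s \<omega>) then
        (\<integral>\<^sup>+r. (\<Sum>j\<in>UNIV. ennreal (rate (history s \<omega>) s j * exp (- total s (history s \<omega>) * (r - s))) * H j (history s \<omega>) r) *
          indicator {s..min t (\<sigma> (history s \<omega>))} r \<partial>lborel) else 0) \<partial>M)"
proof -
  note [measurable] = measurable_history[OF s(1)] target_event_measurable[OF s(1)] measurable_capped_time[OF s(1)] H
  define H' where "H' j p = (if s \<le> \<sigma> (fst p) \<and> snd p \<le> \<sigma> (fst p) then H j (fst p) (snd p) else 0)" for j p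
  have H'[measurable]: "H' j \<in> borel_measurable (path_space \<Otimes>\<^sub>M borel)" for j
    unfolding H'_def by measurable
  define I where "I j \<omega> = (\<integral>\<^sup>+r. ennreal (jump_density rate (history s \<omega>) s r j) * indicator {s..t} r *
        H' j (history s \<omega>, r) \<partial>lborel)" for j \<omega>
  have I_meas: "I j \<in> borel_measurable M" for j
  proof -
    have [measurable]: "(\<lambda>p. jump_density rate (history s (fst p)) s (snd p) j) \<in> borel_measurable (M \<Otimes>\<^sub>M lborel)"
      by (intro measurable_jump_density_at) measurable
    show ?thesis
      unfolding I_def by (rule lborel.borel_measurable_nn_integral) (simp add: split_beta', measurable)
  qed
  have lhs_meas: "(\<lambda>\<omega>. indicator (target_event s t j) \<omega> * H' j (history s \<omega>, jump_time s \<omega>)) \<in> borel_measurable M" for j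
  proof -
    have "(\<lambda>\<omega>. indicator (target_event s t j) \<omega> * H' j (history s \<omega>, capped_time s t \<omega>)) \<in> borel_measurable M"
      by measurable
    also have "(\<lambda>\<omega>. indicator (target_event s t j) \<omega> * H' j (history s \<omega>, capped_time s t \<omega>)) =
        (\<lambda>\<omega>. indicator (target_event s t j) \<omega> * H' j (history s \<omega>, jump_time s \<omega>))"
      by (auto simp: fun_eq_iff indicator_def capped_time_def target_event_def)
    finally show ?thesis .
  qed
  have I_eq: "(\<Sum>j\<in>UNIV. I j \<omega>) = (if s \<le> \<sigma> (history s \<omega>) then
        (\<integral>\<^sup>+r. (\<Sum>j\<in>UNIV. ennreal (rate (history s \<omega>) s j * exp (- total s (history s \<omega>) * (r - s))) * H j (history s \<omega>) r) *
          indicator {s..min t (\<sigma> (history s \<omega>))} r \<partial>lborel) else 0)" if \<omega>: "\<omega> \<in> space M" for \<omega>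
  proof (cases "s \<le> \<sigma> (history s \<omega>)")
    case False
    then show ?thesis by (simp add: I_def H'_def)
  next
    case True
    let ?h = "history s \<omega>"
    have h: "?h \<in> space path_space" "stop_path s ?h = ?h"
      using history_in[OF s(1) \<omega>] history_frozen[OF s(1) order_refl] by auto
    have [measurable]: "(\<lambda>r. H j ?h r) \<in> borel_measurable borel" for j
    proof -
      have "(\<lambda>r. (?h, r)) \<in> measurable borel (path_space \<Otimes>\<^sub>M borel)" using h by measurable
      from measurable_compose[OF this H[of j]] show ?thesis by simp
    qed
    have "I j \<omega> = (\<integral>\<^sup>+r. ennreal (rate ?h s j * exp (- total s ?h * (r - s))) * H j ?h r * indicator {s..min t (\<sigma> ?h)} r \<partial>lborel)" for j
      unfolding I_def
    proof (rule nn_integral_cong_AE, use AE_lborel_singleton[of "\<sigma> ?h"] in eventually_elim)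
      fix r assume "r \<noteq> \<sigma> ?h"
      show "ennreal (jump_density rate ?h s r j) * indicator {s..t} r * H' j (?h, r) =
        ennreal (rate ?h s j * exp (- total s ?h * (r - s))) * H j ?h r * indicator {s..min t (\<sigma> ?h)} r"
      proof (cases "s \<le> r \<and> r < \<sigma> ?h")
        case True
        then show ?thesis using jump_density_frozen[OF h s(1), of r j] \<open>s \<le> \<sigma> ?h\<close>
          by (simp add: H'_def indicator_def)
      next
        case False
        with \<open>r \<noteq> \<sigma> ?h\<close> have "r < s \<or> \<sigma> ?h < r" by auto
        then show ?thesis by (auto simp: H'_def indicator_def)
      qed
    qed
    then have "(\<Sum>j\<in>UNIV. I j \<omega>) = (\<integral>\<^sup>+r. (\<Sum>j\<in>UNIV. ennreal (rate ?h s j * exp (- total s ?h * (r - s))) * H j ?h r * indicator {s..min t (\<sigma> ?h)} r) \<partial>lborel)"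
      by (simp only:) (intro nn_integral_sum[symmetric], measurable)
    then show ?thesis using True by (simp add: sum_distrib_right)
  qed
  have "(\<integral>\<^sup>+\<omega>. (\<Sum>j\<in>UNIV. indicator (target_event s t j) \<omega> * H' j (history s \<omega>, jump_time s \<omega>)) \<partial>M) =
      (\<Sum>j\<in>UNIV. \<integral>\<^sup>+\<omega>. indicator (target_event s t j) \<omega> * H' j (history s \<omega>, jump_time s \<omega>) \<partial>M)"
    by (intro nn_integral_sum lhs_meas)
  also have "\<dots> = (\<Sum>j\<in>UNIV. \<integral>\<^sup>+\<omega>. I j \<omega> \<partial>M)"
    unfolding I_def by (intro sum.cong refl joint_jump_law s H')
  also have "\<dots> = (\<integral>\<^sup>+\<omega>. (\<Sum>j\<in>UNIV. I j \<omega>) \<partial>M)"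
    by (intro nn_integral_sum[symmetric] I_meas)
  finally show ?thesis
    unfolding H'_def fst_conv snd_conv by (rule trans) (intro nn_integral_cong I_eq)
qed

end


section \<open>Two jumps in a short window\<close>

context rate_process
begin

lemma jump_event_prob:
  assumes s: "0 \<le> s" "s \<le> t" and A: "A \<in> sets path_space"
  shows "emeasure M (jump_event s t \<inter> (history s -` A \<inter> space M)) \<le>
    ennreal (C * (t - s)) * emeasure M (history s -` A \<inter> space M)"
proof -
  note [measurable] = measurable_history[OF s(1)] target_event_measurable[OF s(1)] A
  let ?B = "history s -` A \<inter> space M"
  define I where "I j \<omega> = (\<integral>\<^sup>+r. ennreal (jump_density rate (history s \<omega>) s r j) * indicator {s..t} r \<partial>lborel)" for j \<omega>
  have I_meas [measurable]: "I j \<in> borel_measurable M" for j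
    unfolding I_def
    by (intro measurable_window_integral measurable_compose[OF _ measurable_ennreal] measurable_jump_density_at) measurable
  have I_le: "(\<Sum>j\<in>UNIV. I j \<omega>) \<le> ennreal (C * (t - s))" if \<omega>: "\<omega> \<in> space M" for \<omega>
  proof -
    have h: "history s \<omega> \<in> space path_space" using history_in[OF s(1) \<omega>] .
    have [measurable]: "(\<lambda>r. jump_density rate (history s \<omega>) s r j) \<in> borel_measurable borel" for j
      using h by (intro measurable_jump_density_at) auto
    have "(\<Sum>j\<in>UNIV. I j \<omega>) = (\<integral>\<^sup>+r. (\<Sum>j\<in>UNIV. ennreal (jump_density rate (history s \<omega>) s r j) * indicator {s..t} r) \<partial>lborel)"
      unfolding I_def by (intro nn_integral_sum[symmetric]) measurable
    also have "\<dots> \<le> (\<integral>\<^sup>+r. ennreal C * indicator {s..t} r \<partial>lborel)"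
    proof (rule nn_integral_mono)
      fix r
      show "(\<Sum>j\<in>UNIV. ennreal (jump_density rate (history s \<omega>) s r j) * indicator {s..t} r) \<le> ennreal C * indicator {s..t} r"
      proof (cases "r \<in> {s..t}")
        case True
        have "(\<Sum>j\<in>UNIV. ennreal (jump_density rate (history s \<omega>) s r j)) =
            ennreal (\<Sum>j\<in>UNIV. jump_density rate (history s \<omega>) s r j)"
          using True by (intro sum_ennreal jump_density_bounds(1)[OF h s(1)]) auto
        also have "\<dots> \<le> ennreal (total r (history s \<omega>))"
          using True by (intro ennreal_leI sum_mono jump_density_bounds(2)[OF h s(1)]) auto
        also have "\<dots> \<le> ennreal C"
          using True s by (intro ennreal_leI rate_sum_le[OF h]) auto
        finally show ?thesis using True by simp
      qed simp
    qed
    also have "\<dots> = ennreal (C * (t - s))"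
      using s C_nonneg by (simp add: nn_integral_cmult ennreal_mult)
    finally show ?thesis .
  qed
  have "jump_event s t \<inter> ?B = (\<Union>j\<in>UNIV. target_event s t j \<inter> ?B)"
    by (auto simp: target_event_def)
  also have "emeasure M \<dots> \<le> (\<Sum>j\<in>UNIV. emeasure M (target_event s t j \<inter> ?B))"
    by (rule emeasure_subadditive_finite) auto
  also have "\<dots> = (\<Sum>j\<in>UNIV. \<integral>\<^sup>+\<omega>. indicator A (history s \<omega>) * I j \<omega> \<partial>M)"
    using first_jump_law[OF s A] by (simp add: I_def)
  also have "\<dots> = (\<integral>\<^sup>+\<omega>. (\<Sum>j\<in>UNIV. indicator A (history s \<omega>) * I j \<omega>) \<partial>M)"
    by (intro nn_integral_sum[symmetric]) measurable
  also have "\<dots> \<le> (\<integral>\<^sup>+\<omega>. ennreal (C * (t - s)) * indicator ?B \<omega> \<partial>M)"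
    using I_le by (intro nn_integral_mono) (auto simp: sum_distrib_left[symmetric] indicator_def)
  also have "\<dots> = ennreal (C * (t - s)) * emeasure M ?B"
    by (rule nn_integral_cmult_indicator) measurable
  finally show ?thesis .
qed

lemma jump_event_prob_le:
  assumes s: "0 \<le> s" "s \<le> t"
  shows "emeasure M (jump_event s t) \<le> ennreal (C * (t - s))"
proof -
  have "history s -` space path_space \<inter> space M = space M"
    using history_in[OF s(1)] by auto
  moreover have "jump_event s t \<inter> space M = jump_event s t" by (auto simp: jump_event_def)
  ultimately show ?thesis
    using jump_event_prob[OF s sets.top] by (simp add: emeasure_space_1)
qed

text \<open>The event of a jump in the earlier window belongs to the past of the later one, where the
  conditional probability of a jump is at most the length of the window times \<open>C\<close>.\<close>

lemma two_windows_prob: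
  assumes "0 \<le> s" "s \<le> t" "t \<le> u" "u \<le> w"
  shows "emeasure M (jump_event s t \<inter> jump_event u w) \<le> ennreal (C * (t - s)) * ennreal (C * (w - u))"
proof -
  have u: "0 \<le> u" using assms by simp
  have eq: "jump_event s t = history u -` jumping s t \<inter> space M"
    using jump_event_history[OF assms(1,3) u] by (auto simp: jump_event_def[of s t])
  have "emeasure M (jump_event u w \<inter> jump_event s t) \<le> ennreal (C * (w - u)) * emeasure M (jump_event s t)"
    unfolding eq by (rule jump_event_prob[OF u assms(4) jumping_measurable[OF assms(1)]])
  also have "\<dots> \<le> ennreal (C * (w - u)) * ennreal (C * (t - s))"
    by (intro mult_left_mono jump_event_prob_le assms) auto
  finally show ?thesis by (simp add: Int_commute mult.commute)
qed

text \<open>The window is cut into \<open>m\<close> cells. Both jumps are then described by deterministic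
  times, for which conditional probabilities are available, unlike for the first jump time.\<close>

definition crowded :: "real \<Rightarrow> real \<Rightarrow> nat \<Rightarrow> 'w set" where
  "crowded s t m = (\<Union>(k, l)\<in>{(k, l). k < l \<and> l < m}.
     jump_event (s + real k * ((t - s) / real m)) (s + real (Suc k) * ((t - s) / real m)) \<inter>
     jump_event (s + real l * ((t - s) / real m)) (s + real (Suc l) * ((t - s) / real m)))"

lemma finite_pairs: "finite {(k, l). k < l \<and> l < (m::nat)}" "card {(k, l). k < l \<and> l < (m::nat)} \<le> m * m"
proof -
  have sub: "{(k, l). k < l \<and> l < m} \<subseteq> {..<m} \<times> {..<m}" by auto
  then show "finite {(k, l). k < l \<and> l < m}" by (rule finite_subset) auto
  show "card {(k, l). k < l \<and> l < m} \<le> m * m"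
    using card_mono[OF _ sub] by (simp add: card_cartesian_product)
qed

lemma crowded_measurable [measurable]: "0 \<le> s \<Longrightarrow> s \<le> t \<Longrightarrow> crowded s t m \<in> sets M"
  unfolding crowded_def using finite_pairs(1)[of m] by (intro sets.finite_UN) auto

text \<open>There are at most \<open>m\<^sup>2\<close> pairs of cells, each with probability at most \<open>(C (t - s) / m)\<^sup>2\<close>: the
  bound does not depend on \<open>m\<close>.\<close>

lemma crowded_prob:
  assumes s: "0 \<le> s" "s \<le> t" and m: "0 < m"
  shows "emeasure M (crowded s t m) \<le> ennreal ((C * (t - s))\<^sup>2)"
proof -
  let ?h = "(t - s) / real m"
  let ?J = "\<lambda>k. jump_event (s + real k * ?h) (s + real (Suc k) * ?h)"
  let ?I = "{(k, l). k < l \<and> l < m}"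
  have h: "0 \<le> ?h" using s by simp
  have diff: "(s + real (Suc k) * d) - (s + real k * d) = d" for k and d :: real
    by (simp add: algebra_simps)
  have "emeasure M (crowded s t m) \<le> (\<Sum>p\<in>?I. emeasure M (?J (fst p) \<inter> ?J (snd p)))"
  proof -
    have eq: "crowded s t m = (\<Union>p\<in>?I. ?J (fst p) \<inter> ?J (snd p))"
      unfolding crowded_def by (rule SUP_cong[OF refl]) (simp only: case_prod_beta)
    show ?thesis unfolding eq
    proof (rule emeasure_subadditive_finite[OF finite_pairs(1)])
      have "?J k \<in> sets M" for k
        by (rule jump_event_measurable) (intro add_nonneg_nonneg s mult_nonneg_nonneg h, simp)
      then show "(\<lambda>p. ?J (fst p) \<inter> ?J (snd p)) ` ?I \<subseteq> sets M"
        by (intro image_subsetI sets.Int)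
    qed
  qed
  also have "\<dots> \<le> (\<Sum>p\<in>?I. ennreal ((C * ?h)\<^sup>2))"
  proof (rule sum_mono)
    fix p assume "p \<in> ?I"
    then have kl: "Suc (fst p) \<le> snd p" by auto
    have "emeasure M (?J (fst p) \<inter> ?J (snd p)) \<le>
        ennreal (C * ((s + real (Suc (fst p)) * ?h) - (s + real (fst p) * ?h))) *
        ennreal (C * ((s + real (Suc (snd p)) * ?h) - (s + real (snd p) * ?h)))"
    proof (rule two_windows_prob)
      show "s + real (Suc (fst p)) * ?h \<le> s + real (snd p) * ?h"
        using kl h by (intro add_left_mono mult_right_mono) auto
      show "0 \<le> s + real (fst p) * ?h"
        by (intro add_nonneg_nonneg s mult_nonneg_nonneg h) simp
    qed (intro add_left_mono mult_right_mono h, simp)+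
    also have "\<dots> = ennreal (C * ?h) * ennreal (C * ?h)" unfolding diff ..
    also have "\<dots> = ennreal ((C * ?h)\<^sup>2)"
      using C_nonneg h by (simp only: power2_eq_square ennreal_mult mult_nonneg_nonneg)
    finally show "emeasure M (?J (fst p) \<inter> ?J (snd p)) \<le> ennreal ((C * ?h)\<^sup>2)" .
  qed
  also have "\<dots> = ennreal (real (card ?I) * (C * ?h)\<^sup>2)"
    by (simp add: ennreal_mult ennreal_of_nat_eq_real_of_nat)
  also have "\<dots> \<le> ennreal (real (m * m) * (C * ?h)\<^sup>2)"
    using finite_pairs(2)[of m] by (intro ennreal_leI mult_right_mono) (auto simp del: of_nat_mult)
  also have "real (m * m) * (C * ?h)\<^sup>2 = (C * (t - s))\<^sup>2"
    using m by (simp add: field_simps power2_eq_square)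
  finally show ?thesis .
qed

text \<open>The limes inferior of the events for finer and finer cells; it is a measurable event that contains
  all double jumps. The successor avoids a division into zero cells.\<close>

definition clustered :: "real \<Rightarrow> real \<Rightarrow> 'w set" where
  "clustered s t = (\<Union>n. {\<omega> \<in> space M. \<forall>m\<ge>n. \<omega> \<in> crowded s t (Suc m)})"

lemma clustered_measurable [measurable]: "0 \<le> s \<Longrightarrow> s \<le> t \<Longrightarrow> clustered s t \<in> sets M"
  unfolding clustered_def by measurable

lemma clustered_prob:
  assumes s: "0 \<le> s" "s \<le> t"
  shows "emeasure M (clustered s t) \<le> ennreal ((C * (t - s))\<^sup>2)"
proof -
  let ?A = "\<lambda>n. {\<omega> \<in> space M. \<forall>m\<ge>n. \<omega> \<in> crowded s t (Suc m)}"
  have "(SUP n. emeasure M (?A n)) = emeasure M (clustered s t)"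
    unfolding clustered_def
  proof (rule SUP_emeasure_incseq)
    show "range ?A \<subseteq> sets M" using s by auto
    show "incseq ?A" by (rule incseq_SucI) auto
  qed
  moreover have "emeasure M (?A n) \<le> ennreal ((C * (t - s))\<^sup>2)" for n
  proof -
    have "emeasure M (?A n) \<le> emeasure M (crowded s t (Suc n))"
      using s by (intro emeasure_mono) auto
    also have "\<dots> \<le> ennreal ((C * (t - s))\<^sup>2)" by (rule crowded_prob[OF s]) simp
    finally show ?thesis .
  qed
  ultimately show ?thesis by (metis (no_types, lifting) SUP_least)
qed

lemma grid_index:
  assumes h: "0 < (h::real)" and q: "s < q" "q \<le> s + real m * h"
  shows "\<exists>k<m. s + real k * h < q \<and> q \<le> s + real (Suc k) * h"
proof -
  define k where "k = nat (\<lceil>(q - s) / h\<rceil> - 1)"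
  have pos: "0 < (q - s) / h" using h q by simp
  then have k: "real k = of_int \<lceil>(q - s) / h\<rceil> - 1" unfolding k_def by (simp add: of_nat_nat)
  have "real k < (q - s) / h" "(q - s) / h \<le> real k + 1" using k by linarith+
  then have "real k * h < q - s" "q - s \<le> (real k + 1) * h"
    using h by (simp_all add: pos_less_divide_eq pos_divide_le_eq)
  moreover have "real k * h < real m * h" using calculation(1) q by linarith
  then have "k < m" using h by simp
  ultimately show ?thesis by (intro exI[of _ k]) (auto simp: algebra_simps)
qed

text \<open>Two jump times \<open>\<tau> < \<rho>\<close> fall into different cells as soon as the cells are shorter than \<open>\<rho> - \<tau>\<close>.\<close>

lemma two_jumps_clustered:
  assumes s: "0 \<le> s" and \<omega>: "\<omega> \<in> jump_event s t"
    and again: "\<omega> \<in> jump_event (jump_time s \<omega>) t"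
  shows "\<omega> \<in> clustered s t"
proof -
  define \<tau> where "\<tau> = jump_time s \<omega>"
  define \<rho> where "\<rho> = jump_time \<tau> \<omega>"
  note first = jump_timeD[OF \<omega> s, folded \<tau>_def]
  have \<tau>0: "0 \<le> \<tau>" using s first(1) by simp
  note second = jump_timeD[OF again[folded \<tau>_def] \<tau>0, folded \<rho>_def]
  have sp: "\<omega> \<in> space M" using \<omega> by (simp add: jump_event_def)
  have st: "s < t" using first(1,2) by simp
  obtain n where n: "(t - s) / (\<rho> - \<tau>) < real n" using reals_Archimedean2 by blast
  have "\<omega> \<in> crowded s t (Suc m)" if "n \<le> m" for m
  proof -
    define h where "h = (t - s) / real (Suc m)"
    have h: "0 < h" using st by (simp add: h_def)
    have top: "s + real (Suc m) * h = t" by (simp add: h_def)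
    have "(t - s) / (\<rho> - \<tau>) < real (Suc m)" using n that by linarith
    then have h_small: "h < \<rho> - \<tau>"
      using second(1) by (simp add: h_def pos_divide_less_eq mult.commute del: of_nat_Suc)
    obtain k where k: "s + real k * h < \<tau>" "\<tau> \<le> s + real (Suc k) * h"
      using grid_index[OF h first(1)] first(2) top by metis
    have "s < \<rho>" using first(1) second(1) by simp
    then obtain l where l: "l < Suc m" "s + real l * h < \<rho>" "\<rho> \<le> s + real (Suc l) * h"
      using grid_index[OF h] second(2) top by metis
    have "real (Suc k) * h < real (Suc l) * h" using k(1) l(3) h_small by (simp add: distrib_right)
    then have "k < l" using h by simp
    then have "real (Suc k) * h \<le> real l * h" using h by (intro mult_right_mono) auto
    then have l': "\<tau> \<le> s + real l * h" using k(2) by linarith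
    have k0: "s \<le> s + real k * h" using h by simp
    have "Y (s + real k * h) \<omega> = Y s \<omega>" by (rule first(4)[OF k0 k(1)])
    then have "\<omega> \<in> jump_event (s + real k * h) (s + real (Suc k) * h)"
      using first(3) k sp unfolding jump_event_def by (intro CollectI conjI exI[of _ \<tau>]) simp_all
    moreover have "Y (s + real l * h) \<omega> = Y \<tau> \<omega>" by (rule second(4)[OF l' l(2)])
    then have "\<omega> \<in> jump_event (s + real l * h) (s + real (Suc l) * h)"
      using second(3) l sp unfolding jump_event_def by (intro CollectI conjI exI[of _ \<rho>]) simp_all
    ultimately show ?thesis
      using \<open>k < l\<close> l(1) unfolding crowded_def h_def by blast
  qed
  then show ?thesis using sp unfolding clustered_def by blast
qed

end


section \<open>The law of the stopped trajectory\<close>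

context rate_functional
begin

lemma stopped_agree:
  assumes x: "x \<in> space path_space" and y: "y \<in> space path_space"
    and eq: "\<And>q. 0 \<le> q \<Longrightarrow> q \<le> \<sigma> x \<Longrightarrow> y q = x q"
  shows "\<sigma> y = \<sigma> x" "stopped y = stopped x"
proof -
  show \<sigma>: "\<sigma> y = \<sigma> x" by (rule \<sigma>_cong[OF x y]) (simp add: eq)
  show "stopped y = stopped x"
    unfolding stop_path_def \<sigma>
  proof (rule restrict_ext)
    fix s :: real assume "s \<in> {0..}"
    then show "y (min s (\<sigma> x)) = x (min s (\<sigma> x))" using \<sigma>_nonneg[OF x] by (intro eq) auto
  qed
qed

end

context rate_process
begin

lemma sum_target_events:
  fixes F :: "'v \<Rightarrow> ennreal"
  shows "(\<Sum>j\<in>UNIV. indicator (target_event s t j) \<omega> * F j) =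
    (if \<omega> \<in> jump_event s t then F (Y (jump_time s \<omega>) \<omega>) else 0)"
proof -
  have "indicator (target_event s t j) \<omega> * F j =
      (if Y (jump_time s \<omega>) \<omega> = j then (if \<omega> \<in> jump_event s t then F j else 0) else 0)" for j
    by (simp add: target_event_def indicator_def)
  then show ?thesis by simp
qed

text \<open>The prediction at time \<open>t\<close> under the pretence that nothing happens between the first jump after \<open>s\<close> and
  \<open>t\<close>. Its expectation is exact by the law of the first jump, and it differs from the true
  prediction at \<open>t\<close> only by what happens after that jump.\<close>

definition one_jump :: "((real \<Rightarrow> 'v) \<Rightarrow> ennreal) \<Rightarrow> real \<Rightarrow> real \<Rightarrow> 'w \<Rightarrow> ennreal" where
  "one_jump G s t \<omega> =
    (if \<sigma> (history s \<omega>) < s then prediction G s (history s \<omega>)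
     else if \<omega> \<in> jump_event s t \<and> jump_time s \<omega> \<le> \<sigma> (history s \<omega>)
       then prediction G (jump_time s \<omega>) (redirect (history s \<omega>) (jump_time s \<omega>) (Y (jump_time s \<omega>) \<omega>))
     else prediction G (min t (\<sigma> (history s \<omega>))) (history s \<omega>))"

text \<open>On the event of a jump before \<open>\<sigma>\<close> the law of the first jump gives the integral in the cut-off
  first-jump equation. The weight of the complementary event follows by subtracting from the whole, which
  is legitimate since the prediction is bounded.\<close>

lemma expected_one_jump:
  assumes G: "G \<in> borel_measurable path_space" and K: "\<And>x. x \<in> space path_space \<Longrightarrow> G x \<le> ennreal K"
    and s: "0 \<le> s" "s \<le> t"
  shows "(\<integral>\<^sup>+\<omega>. one_jump G s t \<omega> \<partial>M) = (\<integral>\<^sup>+\<omega>. prediction G s (history s \<omega>) \<partial>M)"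
    and "one_jump G s t \<in> borel_measurable M"
proof -
  note hist[measurable] = measurable_history[OF s(1)]
  note [measurable] = target_event_measurable[OF s(1)] measurable_capped_time[OF s(1)] jump_event_measurable[OF s(1)]
  let ?h = "history s" and ?U = "prediction G"
  let ?b = "\<lambda>\<omega>. min t (\<sigma> (?h \<omega>))"
  let ?e = "\<lambda>\<omega>. exp (- total s (?h \<omega>) * (?b \<omega> - s))"
  let ?B = "{\<omega> \<in> space M. \<omega> \<in> jump_event s t \<and> capped_time s t \<omega> \<le> \<sigma> (?h \<omega>)}"
  have B[measurable]: "?B \<in> sets M" by measurable
  have B_iff: "\<omega> \<in> ?B \<longleftrightarrow> \<omega> \<in> jump_event s t \<and> jump_time s \<omega> \<le> \<sigma> (?h \<omega>)" for \<omega>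
    by (auto simp: capped_time_def jump_event_def)
  have U_at[measurable]: "(\<lambda>\<omega>. ?U (f \<omega>) (?h \<omega>)) \<in> borel_measurable M" if "f \<in> borel_measurable M" for f
    by (rule measurable_prediction_at[OF G that hist])
  define jumped where "jumped H \<omega> = (\<Sum>j\<in>UNIV. indicator (target_event s t j) \<omega> *
      (if s \<le> \<sigma> (?h \<omega>) \<and> jump_time s \<omega> \<le> \<sigma> (?h \<omega>) then H j (?h \<omega>) (jump_time s \<omega>) else 0))"
    for H :: "'v \<Rightarrow> (real \<Rightarrow> 'v) \<Rightarrow> real \<Rightarrow> ennreal" and \<omega>
  have jumped: "jumped H \<omega> = (if s \<le> \<sigma> (?h \<omega>) \<and> \<omega> \<in> ?B then H (Y (jump_time s \<omega>) \<omega>) (?h \<omega>) (jump_time s \<omega>) else 0)" for H \<omega>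
    unfolding jumped_def sum_target_events B_iff by simp
  have jumped_meas: "jumped H \<in> borel_measurable M"
    if H[measurable]: "\<And>j. (\<lambda>p. H j (fst p) (snd p)) \<in> borel_measurable (path_space \<Otimes>\<^sub>M borel)" for H
  proof -
    have [measurable]: "(\<lambda>\<omega>. H j (?h \<omega>) (capped_time s t \<omega>)) \<in> borel_measurable M" for j
      using measurable_compose[OF _ H[of j], of "\<lambda>\<omega>. (?h \<omega>, capped_time s t \<omega>)" M] by simp
    have "(\<lambda>\<omega>. \<Sum>j\<in>UNIV. indicator (target_event s t j) \<omega> *
      (if s \<le> \<sigma> (?h \<omega>) \<and> capped_time s t \<omega> \<le> \<sigma> (?h \<omega>) then H j (?h \<omega>) (capped_time s t \<omega>) else 0)) \<in> borel_measurable M"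
      by measurable
    also have "(\<lambda>\<omega>. \<Sum>j\<in>UNIV. indicator (target_event s t j) \<omega> *
      (if s \<le> \<sigma> (?h \<omega>) \<and> capped_time s t \<omega> \<le> \<sigma> (?h \<omega>) then H j (?h \<omega>) (capped_time s t \<omega>) else 0)) = jumped H"
      unfolding jumped_def
      by (intro ext sum.cong refl) (auto simp: indicator_def capped_time_def target_event_def)
    finally show ?thesis .
  qed
  define H1 where "H1 j x r = ?U r (redirect x r j)" for j x r
  define H2 where "H2 (j::'v) x (r::real) = ?U (min t (\<sigma> x)) x" for j x r
  have H1: "(\<lambda>p. H1 j (fst p) (snd p)) \<in> borel_measurable (path_space \<Otimes>\<^sub>M borel)" for j
    unfolding H1_def by (rule measurable_prediction_at[OF G]) measurable
  have H2: "(\<lambda>p. H2 j (fst p) (snd p)) \<in> borel_measurable (path_space \<Otimes>\<^sub>M borel)" for j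
    unfolding H2_def by (rule measurable_prediction_at[OF G]) measurable
  \<comment> \<open>The parts of \<open>one_jump\<close> without a jump before \<open>\<sigma>\<close>: still waiting, and stopped before \<open>s\<close>.\<close>
  define g2 where "g2 \<omega> = (if s \<le> \<sigma> (?h \<omega>) \<and> \<omega> \<notin> ?B then ?U (?b \<omega>) (?h \<omega>) else 0)" for \<omega>
  define g3 where "g3 \<omega> = (if \<sigma> (?h \<omega>) < s then ?U s (?h \<omega>) else 0)" for \<omega>
  have g2_meas[measurable]: "g2 \<in> borel_measurable M" unfolding g2_def using B by measurable
  have g3_meas[measurable]: "g3 \<in> borel_measurable M" unfolding g3_def by measurable
  note [measurable] = jumped_meas[OF H1] jumped_meas[OF H2]
  have g_eq: "one_jump G s t = (\<lambda>\<omega>. jumped H1 \<omega> + (g2 \<omega> + g3 \<omega>))"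
    unfolding one_jump_def jumped g2_def g3_def H1_def B_iff by (auto simp: fun_eq_iff)
  then show "one_jump G s t \<in> borel_measurable M" by simp
  \<comment> \<open>What the jumping part, the waiting value on the event of a jump, and the waiting part average to.\<close>
  define R1 where "R1 \<omega> = (if s \<le> \<sigma> (?h \<omega>) then \<integral>\<^sup>+r. jump_weight ?U s (?h \<omega>) r * indicator {s..?b \<omega>} r \<partial>lborel else 0)" for \<omega>
  define R2 where "R2 \<omega> = (if s \<le> \<sigma> (?h \<omega>) then ?U (?b \<omega>) (?h \<omega>) * ennreal (1 - ?e \<omega>) else 0)" for \<omega>
  define R3 where "R3 \<omega> = (if s \<le> \<sigma> (?h \<omega>) then ennreal (?e \<omega>) * ?U (?b \<omega>) (?h \<omega>) else 0)" for \<omega>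
  have R1_meas[measurable]: "R1 \<in> borel_measurable M"
  proof -
    have "(\<lambda>p. jump_weight ?U s (?h (fst p)) (snd p)) \<in> borel_measurable (M \<Otimes>\<^sub>M lborel)"
      by (rule measurable_jump_weight[OF measurable_prediction[OF G]]) measurable
    then have "(\<lambda>\<omega>. \<integral>\<^sup>+r. jump_weight ?U s (?h \<omega>) r * indicator {s..?b \<omega>} r \<partial>lborel) \<in> borel_measurable M"
      by (rule measurable_window_integral) measurable
    then show ?thesis unfolding R1_def by measurable
  qed
  have R2_meas[measurable]: "R2 \<in> borel_measurable M" unfolding R2_def by measurable
  have R3_meas[measurable]: "R3 \<in> borel_measurable M" unfolding R3_def by measurable
  have int1: "(\<integral>\<^sup>+\<omega>. jumped H1 \<omega> \<partial>M) = (\<integral>\<^sup>+\<omega>. R1 \<omega> \<partial>M)"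
    unfolding jumped_def R1_def jump_weight_def using first_jump_before_\<sigma>[OF s H1] by (simp only: H1_def)
  have int2: "(\<integral>\<^sup>+\<omega>. jumped H2 \<omega> \<partial>M) = (\<integral>\<^sup>+\<omega>. R2 \<omega> \<partial>M)"
  proof -
    have "R2 \<omega> = (if s \<le> \<sigma> (?h \<omega>) then
        (\<integral>\<^sup>+r. (\<Sum>j\<in>UNIV. ennreal (rate (?h \<omega>) s j * exp (- total s (?h \<omega>) * (r - s))) * H2 j (?h \<omega>) r) *
          indicator {s..?b \<omega>} r \<partial>lborel) else 0)" if "\<omega> \<in> space M" for \<omega>
      using jump_mass[OF history_in[OF s(1) that] s(1), of "?b \<omega>" "?U (?b \<omega>) (?h \<omega>)"] s
      unfolding R2_def jump_weight_def H2_def by simp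
    then show ?thesis
      unfolding jumped_def using first_jump_before_\<sigma>[OF s H2] by (simp cong: nn_integral_cong)
  qed
  have "g2 \<omega> + jumped H2 \<omega> = R3 \<omega> + R2 \<omega>" if "\<omega> \<in> space M" for \<omega>
  proof (cases "s \<le> \<sigma> (?h \<omega>)")
    case True
    then have "g2 \<omega> + jumped H2 \<omega> = ?U (?b \<omega>) (?h \<omega>)" by (simp add: g2_def jumped H2_def)
    also have "\<dots> = R3 \<omega> + R2 \<omega>"
      unfolding R3_def R2_def if_P[OF True]
      by (rule survival_split[OF history_in[OF s(1) that] s(1)]) (use True s in simp)
    finally show ?thesis .
  qed (simp add: g2_def jumped R3_def R2_def)
  then have "(\<integral>\<^sup>+\<omega>. g2 \<omega> + jumped H2 \<omega> \<partial>M) = (\<integral>\<^sup>+\<omega>. R3 \<omega> + R2 \<omega> \<partial>M)"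
    by (rule nn_integral_cong)
  then have "(\<integral>\<^sup>+\<omega>. g2 \<omega> \<partial>M) + (\<integral>\<^sup>+\<omega>. R2 \<omega> \<partial>M) = (\<integral>\<^sup>+\<omega>. R3 \<omega> \<partial>M) + (\<integral>\<^sup>+\<omega>. R2 \<omega> \<partial>M)"
    by (simp add: nn_integral_add int2)
  moreover have "(\<integral>\<^sup>+\<omega>. R2 \<omega> \<partial>M) \<noteq> \<top>"
  proof -
    have "R2 \<omega> \<le> ennreal K" if "\<omega> \<in> space M" for \<omega>
    proof (cases "s \<le> \<sigma> (?h \<omega>)")
      case True
      have b: "0 \<le> ?b \<omega>" "s \<le> ?b \<omega>" using True s by auto
      have "R2 \<omega> \<le> ?U (?b \<omega>) (?h \<omega>)"
        unfolding R2_def if_P[OF True]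
        by (subst (2) survival_split[OF history_in[OF s(1) that] s(1) b(2), of "?U (?b \<omega>) (?h \<omega>)"]) simp
      also have "\<dots> \<le> ennreal K"
        by (rule prediction_le[OF K b(1) history_in[OF s(1) that]])
      finally show ?thesis .
    qed (simp add: R2_def)
    then have "(\<integral>\<^sup>+\<omega>. R2 \<omega> \<partial>M) \<le> (\<integral>\<^sup>+\<omega>. ennreal K \<partial>M)" by (rule nn_integral_mono)
    also have "\<dots> < \<top>" by (simp add: emeasure_space_1)
    finally show ?thesis by simp
  qed
  ultimately have int3: "(\<integral>\<^sup>+\<omega>. g2 \<omega> \<partial>M) = (\<integral>\<^sup>+\<omega>. R3 \<omega> \<partial>M)"
    by (simp add: add.commute[of _ "\<integral>\<^sup>+\<omega>. R2 \<omega> \<partial>M"] ennreal_add_left_cancel)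
  have "(\<integral>\<^sup>+\<omega>. one_jump G s t \<omega> \<partial>M) = (\<integral>\<^sup>+\<omega>. R1 \<omega> + (R3 \<omega> + g3 \<omega>) \<partial>M)"
    unfolding g_eq by (simp add: nn_integral_add int1 int3)
  also have "\<dots> = (\<integral>\<^sup>+\<omega>. ?U s (?h \<omega>) \<partial>M)"
  proof (rule nn_integral_cong)
    fix \<omega> assume \<omega>: "\<omega> \<in> space M"
    show "R1 \<omega> + (R3 \<omega> + g3 \<omega>) = ?U s (?h \<omega>)"
    proof (cases "s \<le> \<sigma> (?h \<omega>)")
      case True
      then show ?thesis
        using prediction_flow[OF G history_in[OF s(1) \<omega>] history_frozen[OF s(1) order_refl] s(1), of "?b \<omega>"] s
        by (simp add: R1_def R3_def g3_def add.commute)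
    qed (simp add: R1_def R3_def g3_def)
  qed
  finally show "(\<integral>\<^sup>+\<omega>. one_jump G s t \<omega> \<partial>M) = (\<integral>\<^sup>+\<omega>. prediction G s (history s \<omega>) \<partial>M)" .
qed

text \<open>If the process stays put until \<open>t\<close> or until it is stopped, the two predictions agree. After a single jump the
  history at \<open>t\<close> is the redirected one, which has merely been waiting since the jump. A second jump costs at
  most \<open>K\<close>.\<close>

lemma one_jump_close:
  assumes G: "G \<in> borel_measurable path_space" and K: "\<And>x. x \<in> space path_space \<Longrightarrow> G x \<le> ennreal K" "0 \<le> K"
    and s: "0 \<le> s" "s \<le> t" and \<omega>: "\<omega> \<in> space M"
  defines "err \<equiv> ennreal (K * C * (t - s)) * indicator (jump_event s t) \<omega> + ennreal K * indicator (clustered s t) \<omega>"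
  shows "prediction G t (history t \<omega>) \<le> one_jump G s t \<omega> + err \<and>
    one_jump G s t \<omega> \<le> prediction G t (history t \<omega>) + err"
proof -
  let ?h = "history s \<omega>" and ?x = "history t \<omega>" and ?U = "prediction G" and ?\<tau> = "jump_time s \<omega>"
  have h: "?h \<in> space path_space" by (rule history_in[OF s(1) \<omega>])
  have t0: "0 \<le> t" using s by simp
  have x: "?x \<in> space path_space" by (rule history_in[OF t0 \<omega>])
  have agree: "?U t ?x = G (stopped ?h)" if "\<And>q. 0 \<le> q \<Longrightarrow> q \<le> \<sigma> ?h \<Longrightarrow> ?x q = ?h q" "\<sigma> ?h \<le> t"
    using stopped_agree[OF h x that(1)] that(2) prediction_after[OF G x, of t] by simp
  show ?thesis
  proof (cases "\<sigma> ?h < s")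
    case True
    have "?U t ?x = G (stopped ?h)"
    proof (rule agree)
      fix q assume "0 \<le> q" "q \<le> \<sigma> ?h"
      then show "?x q = ?h q" using True s by (simp add: history_at min_def)
    qed (use True s in simp)
    moreover have "one_jump G s t \<omega> = G (stopped ?h)"
      using True prediction_after[OF G h, of s] by (simp add: one_jump_def)
    ultimately show ?thesis by simp
  next
    case False
    then have s\<sigma>: "s \<le> \<sigma> ?h" by simp
    show ?thesis
    proof (cases "\<omega> \<in> jump_event s t \<and> ?\<tau> \<le> \<sigma> ?h")
      case no_jump: False
      then have g: "one_jump G s t \<omega> = ?U (min t (\<sigma> ?h)) ?h" using False by (auto simp: one_jump_def)
      have stays: "?x q = ?h q" if "0 \<le> q" "q \<le> \<sigma> ?h" for q
      proof -
        have "Y (min q t) \<omega> = Y (min q s) \<omega>"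
        proof (rule ccontr)
          assume *: "Y (min q t) \<omega> \<noteq> Y (min q s) \<omega>"
          then have "min q t \<noteq> min q s" by metis
          then have sq: "s < min q t" using s by (auto simp: min_def split: if_splits)
          with * have "Y (min q t) \<omega> \<noteq> Y s \<omega>" by simp
          then have J: "\<omega> \<in> jump_event s (min q t)"
            using sq \<omega> unfolding jump_event_def by blast
          then have Jt: "\<omega> \<in> jump_event s t"
            using sq unfolding jump_event_def by auto
          have "?\<tau> \<le> min q t" by (rule jump_timeD(2)[OF J s(1)])
          then show False using no_jump Jt that by auto
        qed
        then show ?thesis using that(1) by (simp add: history_at)
      qed
      have "?U t ?x = ?U (min t (\<sigma> ?h)) ?h"
      proof (cases "t \<le> \<sigma> ?h")
        case True
        have "?x = ?h"
        proof
          fix q show "?x q = ?h q"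
          proof (cases "0 \<le> q")
            case q: True
            show ?thesis
            proof (cases "q \<le> t")
              case False
              have "?x q = ?x t" using False q t0 by (simp add: history_at)
              also have "\<dots> = ?h t" using True t0 by (intro stays) auto
              also have "\<dots> = ?h q" using False q t0 s by (simp add: history_at min_def)
              finally show ?thesis .
            qed (use q True in \<open>auto intro: stays\<close>)
          qed (simp add: history_def stop_path_def)
        qed
        then show ?thesis using True by (simp add: min_def)
      next
        case False
        then show ?thesis using agree[OF stays] prediction_after[OF G h, of "\<sigma> ?h"] by (simp add: min_def)
      qed
      then show ?thesis using g by simp
    next
      case jump: True
      note J = conjunct1[OF jump]
      note \<tau> = jump_timeD(1-3)[OF J s(1)] and before = jump_timeD(4)[OF J s(1)]
      let ?z = "redirect ?h ?\<tau> (Y ?\<tau> \<omega>)"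
      have z: "?z \<in> space path_space" by (rule redirect_in_path_space[OF path_space_rc[OF h]])
      have \<tau>0: "0 \<le> ?\<tau>" using \<tau>(1) s by simp
      have g: "one_jump G s t \<omega> = ?U ?\<tau> ?z" using jump False by (simp add: one_jump_def)
      show ?thesis
      proof (cases "\<omega> \<in> jump_event ?\<tau> t")
        case True
        have "\<omega> \<in> clustered s t" by (rule two_jumps_clustered[OF s(1) J True])
        then have "ennreal K \<le> err" by (simp add: err_def)
        moreover have "?U t ?x \<le> ennreal K" by (rule prediction_le[OF K(1) t0 x])
        moreover have "?U ?\<tau> ?z \<le> ennreal K" by (rule prediction_le[OF K(1) \<tau>0 z])
        ultimately show ?thesis unfolding g by (meson add_increasing order_trans zero_le)
      next
        case single: False
        have "?x = ?z"
        proof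
          fix q show "?x q = ?z q"
          proof (cases "0 \<le> q")
            case q: True
            show ?thesis
            proof (cases "q < ?\<tau>")
              case True
              have "Y q \<omega> = Y (min q s) \<omega>"
              proof (cases "q \<le> s")
                case False
                then show ?thesis using before[of q] True by (simp add: min_def)
              qed simp
              then show ?thesis using True q \<tau>(2) by (simp add: history_at redirect_at min_def)
            next
              case False
              have "Y (min q t) \<omega> = Y ?\<tau> \<omega>"
              proof (rule ccontr)
                assume *: "Y (min q t) \<omega> \<noteq> Y ?\<tau> \<omega>"
                then have "?\<tau> \<noteq> min q t" by metis
                then have "?\<tau> < min q t" using False \<tau>(2) by (simp add: min_def split: if_splits)
                then have "\<omega> \<in> jump_event ?\<tau> t" using * \<omega> unfolding jump_event_def
                  by (intro CollectI conjI exI[of _ "min q t"]) simp_all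
                then show False using single by simp
              qed
              then show ?thesis using False q by (simp add: history_at redirect_at)
            qed
          qed (simp add: history_def stop_path_def redirect_def)
        qed
        have "K * C * (t - ?\<tau>) \<le> K * C * (t - s)"
          using \<tau>(1) K(2) C_nonneg by (intro mult_left_mono) auto
        then have "ennreal (K * C * (t - ?\<tau>)) \<le> err" unfolding err_def using J
          by (auto intro!: add_increasing2 ennreal_leI)
        moreover have "?U ?\<tau> ?z \<le> ?U t ?z + ennreal (K * C * (t - ?\<tau>))"
          "?U t ?z \<le> ?U ?\<tau> ?z + ennreal (K * C * (t - ?\<tau>))"
          using prediction_regular[OF G K z stop_path_redirect[OF \<tau>0 order_refl] \<tau>0 \<tau>(2)] by auto
        ultimately show ?thesis unfolding g \<open>?x = ?z\<close> by (meson add_left_mono order_trans)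
      qed
    qed
  qed
qed

lemma prediction_step:
  assumes G: "G \<in> borel_measurable path_space" and K: "\<And>x. x \<in> space path_space \<Longrightarrow> G x \<le> ennreal K" "0 \<le> K"
    and s: "0 \<le> s" "s \<le> t"
  shows "(\<integral>\<^sup>+\<omega>. prediction G t (history t \<omega>) \<partial>M) \<le>
      (\<integral>\<^sup>+\<omega>. prediction G s (history s \<omega>) \<partial>M) + ennreal (2 * K * (C * (t - s))\<^sup>2)"
    and "(\<integral>\<^sup>+\<omega>. prediction G s (history s \<omega>) \<partial>M) \<le>
      (\<integral>\<^sup>+\<omega>. prediction G t (history t \<omega>) \<partial>M) + ennreal (2 * K * (C * (t - s))\<^sup>2)"
proof -
  have t0: "0 \<le> t" using s by simp
  note [measurable] = measurable_history[OF s(1)] measurable_history[OF t0] jump_event_measurable[OF s(1)]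
    clustered_measurable[OF s]
  define err where "err \<omega> = ennreal (K * C * (t - s)) * indicator (jump_event s t) \<omega> + ennreal K * indicator (clustered s t) \<omega>" for \<omega>
  have err_meas[measurable]: "err \<in> borel_measurable M" unfolding err_def by measurable
  have U_meas[measurable]: "(\<lambda>\<omega>. prediction G t (history t \<omega>)) \<in> borel_measurable M"
    by (rule measurable_prediction_at[OF G]) measurable
  note [measurable] = expected_one_jump(2)[OF G K(1) s]
  have err: "(\<integral>\<^sup>+\<omega>. err \<omega> \<partial>M) \<le> ennreal (2 * K * (C * (t - s))\<^sup>2)"
  proof -
    have "(\<integral>\<^sup>+\<omega>. err \<omega> \<partial>M) = ennreal (K * C * (t - s)) * emeasure M (jump_event s t) + ennreal K * emeasure M (clustered s t)"
      unfolding err_def by (simp add: nn_integral_add nn_integral_cmult)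
    also have "\<dots> \<le> ennreal (K * C * (t - s)) * ennreal (C * (t - s)) + ennreal K * ennreal ((C * (t - s))\<^sup>2)"
      by (intro add_mono mult_left_mono jump_event_prob_le clustered_prob s) auto
    also have "\<dots> = ennreal (K * C * (t - s) * (C * (t - s)) + K * (C * (t - s))\<^sup>2)"
      using K(2) C_nonneg s by (simp add: ennreal_mult ennreal_plus)
    also have "K * C * (t - s) * (C * (t - s)) + K * (C * (t - s))\<^sup>2 = 2 * K * (C * (t - s))\<^sup>2"
      by (simp add: power2_eq_square algebra_simps)
    finally show ?thesis .
  qed
  note close = one_jump_close[OF G K s, folded err_def]
  have "(\<integral>\<^sup>+\<omega>. prediction G t (history t \<omega>) \<partial>M) \<le> (\<integral>\<^sup>+\<omega>. one_jump G s t \<omega> + err \<omega> \<partial>M)"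
    by (intro nn_integral_mono) (simp add: close)
  also have "\<dots> = (\<integral>\<^sup>+\<omega>. prediction G s (history s \<omega>) \<partial>M) + (\<integral>\<^sup>+\<omega>. err \<omega> \<partial>M)"
    by (simp add: nn_integral_add expected_one_jump(1)[OF G K(1) s])
  also have "\<dots> \<le> (\<integral>\<^sup>+\<omega>. prediction G s (history s \<omega>) \<partial>M) + ennreal (2 * K * (C * (t - s))\<^sup>2)"
    by (intro add_left_mono err)
  finally show "(\<integral>\<^sup>+\<omega>. prediction G t (history t \<omega>) \<partial>M) \<le>
      (\<integral>\<^sup>+\<omega>. prediction G s (history s \<omega>) \<partial>M) + ennreal (2 * K * (C * (t - s))\<^sup>2)" .
  have "(\<integral>\<^sup>+\<omega>. prediction G s (history s \<omega>) \<partial>M) = (\<integral>\<^sup>+\<omega>. one_jump G s t \<omega> \<partial>M)"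
    by (simp add: expected_one_jump(1)[OF G K(1) s])
  also have "\<dots> \<le> (\<integral>\<^sup>+\<omega>. prediction G t (history t \<omega>) + err \<omega> \<partial>M)"
    by (intro nn_integral_mono) (simp add: close)
  also have "\<dots> = (\<integral>\<^sup>+\<omega>. prediction G t (history t \<omega>) \<partial>M) + (\<integral>\<^sup>+\<omega>. err \<omega> \<partial>M)"
    by (simp add: nn_integral_add)
  also have "\<dots> \<le> (\<integral>\<^sup>+\<omega>. prediction G t (history t \<omega>) \<partial>M) + ennreal (2 * K * (C * (t - s))\<^sup>2)"
    by (intro add_left_mono err)
  finally show "(\<integral>\<^sup>+\<omega>. prediction G s (history s \<omega>) \<partial>M) \<le>
      (\<integral>\<^sup>+\<omega>. prediction G t (history t \<omega>) \<partial>M) + ennreal (2 * K * (C * (t - s))\<^sup>2)" .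
qed

text \<open>A function whose increments are at most of second order does not grow: \<open>n\<close> steps of length \<open>u / n\<close> produce
  an error of order \<open>1 / n\<close>.\<close>

lemma telescoping_le:
  fixes e :: "real \<Rightarrow> ennreal" and B u :: real
  assumes step: "\<And>s t. 0 \<le> s \<Longrightarrow> s \<le> t \<Longrightarrow> e t \<le> e s + ennreal (B * (t - s)\<^sup>2)" and B: "0 \<le> B" and u: "0 \<le> u"
  shows "e u \<le> e 0"
proof (rule ennreal_le_epsilon)
  fix \<epsilon> :: real assume \<epsilon>: "0 < \<epsilon>"
  obtain n :: nat where n: "B * u\<^sup>2 / \<epsilon> < real n" using reals_Archimedean2 by blast
  then have n0: "0 < real n" using B \<epsilon> by (meson divide_nonneg_pos le_less_trans mult_nonneg_nonneg zero_le_power2)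
  define h where "h = u / real n"
  have h: "0 \<le> h" using u by (simp add: h_def)
  have "e (real k * h) \<le> e 0 + ennreal (real k * (B * h\<^sup>2))" for k
  proof (induction k)
    case (Suc k)
    have "e (real (Suc k) * h) \<le> e (real k * h) + ennreal (B * (real (Suc k) * h - real k * h)\<^sup>2)"
      using h by (intro step mult_right_mono) auto
    also have "real (Suc k) * h - real k * h = h" by (simp add: algebra_simps)
    also have "e (real k * h) + ennreal (B * h\<^sup>2) \<le> (e 0 + ennreal (real k * (B * h\<^sup>2))) + ennreal (B * h\<^sup>2)"
      by (intro add_right_mono Suc.IH)
    also have "\<dots> = e 0 + ennreal (real (Suc k) * (B * h\<^sup>2))"
      using B by (simp add: add.assoc ennreal_plus[symmetric] algebra_simps del: ennreal_plus)
    finally show ?case .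
  qed simp
  from this[of n] have "e u \<le> e 0 + ennreal (real n * (B * h\<^sup>2))" using n0 by (simp add: h_def)
  moreover have "real n * (B * h\<^sup>2) = B * u\<^sup>2 / real n" using n0 by (simp add: h_def power2_eq_square)
  moreover have "B * u\<^sup>2 / real n \<le> \<epsilon>" using n n0 \<epsilon> by (simp add: field_simps)
  ultimately show "e u \<le> e 0 + ennreal \<epsilon>" by (metis add_left_mono ennreal_leI order_trans)
qed

end


context rate_functional
begin

lemma picard_mono: "G \<le> G' \<Longrightarrow> picard G n \<le> picard G' n"
  by (induction n) (simp_all add: picard_Suc first_step_mono)

text \<open>The iterates depend on \<open>G\<close> continuously from below. This extends the formula for the stopped law from
  bounded to arbitrary \<open>G\<close>, as needed for the density, which is unbounded.\<close>

lemma picard_truncation_tendsto: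
  assumes G: "G \<in> borel_measurable path_space" and x: "x \<in> space path_space"
  shows "(\<lambda>k. picard (\<lambda>y. min (G y) (of_nat k)) n s x) \<longlonglongrightarrow> picard G n s x"
  using x
proof (induction n arbitrary: s x)
  case (Suc n)
  let ?G = "\<lambda>k y. min (G y) (of_nat k)"
  have trunc: "(\<lambda>k. ?G k y) \<longlonglongrightarrow> G y" for y
    using tendsto_min[OF tendsto_const[of "G y"] of_nat_tendsto_top_ennreal] by simp
  have mono: "incseq (\<lambda>k. picard (?G k) n)"
    by (rule incseq_SucI) (intro picard_mono le_funI min.mono order_refl of_nat_mono, simp)
  have [measurable]: "?G k \<in> borel_measurable path_space" for k using G by measurable
  \<comment> \<open>Convergence is known on the path space only, so that the iterates are cut off outside of it.\<close>
  define S where "S k r y = (if y \<in> space path_space then picard (?G k) n r y else 0)" for k r y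
  define S' where "S' r y = (if y \<in> space path_space then picard G n r y else 0)" for r y
  have S: "(\<lambda>p. S k (fst p) (snd p)) \<in> borel_measurable (borel \<Otimes>\<^sub>M path_space)" for k
  proof -
    have "(\<lambda>p. picard (?G k) n (fst p) (snd p)) \<in> borel_measurable (borel \<Otimes>\<^sub>M path_space)"
      by (rule measurable_picard) measurable
    then show ?thesis
      by (rule measurable_cong[THEN iffD1, rotated]) (auto simp: S_def space_pair_measure)
  qed
  have eq: "first_step H (picard H' n) s x = first_step H (\<lambda>r y. if y \<in> space path_space then picard H' n r y else 0) s x" for H H'
    unfolding first_step_def jump_weight_def
    using redirect_in_path_space[OF path_space_rc[OF Suc.prems]] by simp
  have "(\<lambda>k. first_step (?G k) (S k) s x) \<longlonglongrightarrow> first_step G S' s x"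
  proof (rule first_step_tendsto[OF Suc.prems S])
    show "incseq S" using mono by (auto simp: incseq_def le_fun_def S_def)
    show "(\<lambda>k. S k r y) \<longlonglongrightarrow> S' r y" for r y using Suc.IH[of y r] by (simp add: S_def S'_def)
  qed (rule trunc)
  then show ?case unfolding picard_Suc eq S_def S'_def .
qed simp

end

context rate_process
begin

abbreviation start :: "real \<Rightarrow> 'v" where
  "start \<equiv> restrict (\<lambda>_. x0) {0..}"

lemma stopped_expectation_bounded:
  assumes G: "G \<in> borel_measurable path_space" and K: "\<And>x. x \<in> space path_space \<Longrightarrow> G x \<le> ennreal K" "0 \<le> K"
  shows "(\<integral>\<^sup>+\<omega>. G (stopped (trajectory \<omega>)) \<partial>M) = prediction G 0 start"
proof -
  define e where "e t = (\<integral>\<^sup>+\<omega>. prediction G t (history t \<omega>) \<partial>M)" for t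
  let ?B = "2 * K * C\<^sup>2"
  have B: "0 \<le> ?B" using K(2) by simp
  have step: "e t \<le> e s + ennreal (?B * (t - s)\<^sup>2)" "e s \<le> e t + ennreal (?B * (t - s)\<^sup>2)" if "0 \<le> s" "s \<le> t" for s t
    using prediction_step[OF G K that] by (simp_all add: e_def power_mult_distrib mult.assoc)
  obtain \<omega>0 where "\<omega>0 \<in> space M" using not_empty by blast
  then have v: "0 \<le> v" using \<sigma>_nonneg[OF trajectory_in] \<sigma>_le[OF trajectory_in] by (meson order_trans)
  have "e v \<le> e 0" by (rule telescoping_le[OF step(1) B v])
  moreover have "e 0 \<le> e v"
  proof -
    \<comment> \<open>The lower bound is the upper bound for the time-reversed function.\<close>
    have "e (max 0 (v - t)) \<le> e (max 0 (v - s)) + ennreal (?B * (t - s)\<^sup>2)" if "0 \<le> s" "s \<le> t" for s t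
    proof -
      have le: "0 \<le> max 0 (v - t)" "max 0 (v - t) \<le> max 0 (v - s)" "max 0 (v - s) - max 0 (v - t) \<le> t - s"
        using that by (auto simp: max_def)
      have "?B * (max 0 (v - s) - max 0 (v - t))\<^sup>2 \<le> ?B * (t - s)\<^sup>2"
        using le by (intro mult_left_mono[OF _ B] power_mono) auto
      then show ?thesis using step(2)[OF le(1,2)] by (meson add_left_mono ennreal_leI order_trans)
    qed
    from telescoping_le[OF this B v] show ?thesis using v by simp
  qed
  ultimately have "e v = e 0" by (rule antisym)
  moreover have "e v = (\<integral>\<^sup>+\<omega>. G (stopped (trajectory \<omega>)) \<partial>M)"
    unfolding e_def
  proof (rule nn_integral_cong)
    fix \<omega> assume \<omega>: "\<omega> \<in> space M"
    note x = trajectory_in[OF \<omega>] and h = history_in[OF v \<omega>]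
    have "history v \<omega> q = trajectory \<omega> q" if "0 \<le> q" "q \<le> \<sigma> (trajectory \<omega>)" for q
      using that \<sigma>_le[OF x] by (simp add: history_at trajectory_at min_absorb1)
    then have "stopped (history v \<omega>) = stopped (trajectory \<omega>)" by (rule stopped_agree(2)[OF x h])
    then show "prediction G v (history v \<omega>) = G (stopped (trajectory \<omega>))"
      using prediction_after[OF G h \<sigma>_le[OF h]] by simp
  qed
  moreover have "e 0 = prediction G 0 start"
  proof -
    have "AE \<omega> in M. Y 0 \<omega> = x0" using process by (simp add: jump_process_def)
    then have "e 0 = (\<integral>\<^sup>+\<omega>. prediction G 0 start \<partial>M)"
      unfolding e_def
    proof (intro nn_integral_cong_AE, eventually_elim)
      fix \<omega> assume "Y 0 \<omega> = x0"
      then have "history 0 \<omega> = start" by (auto simp: history_def stop_path_def fun_eq_iff min_def)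
      then show "prediction G 0 (history 0 \<omega>) = prediction G 0 start" by simp
    qed
    then show ?thesis by (simp add: emeasure_space_1)
  qed
  ultimately show ?thesis by simp
qed

text \<open>The law of the stopped trajectory is determined by the rates.\<close>

theorem stopped_expectation:
  assumes G: "G \<in> borel_measurable path_space"
  shows "(\<integral>\<^sup>+\<omega>. G (stopped (trajectory \<omega>)) \<partial>M) = (SUP n. picard G n 0 start)"
proof -
  let ?G = "\<lambda>k y. min (G y) (of_nat k :: ennreal)"
  have G_k[measurable]: "?G k \<in> borel_measurable path_space" for k using G by measurable
  have c: "start \<in> space path_space" by (rule restrict_in_path_space) (simp add: right_continuous_path_def)
  have mono: "?G k \<le> ?G l" if "k \<le> l" for k l
    using that by (intro le_funI min.mono order_refl of_nat_mono)
  have bounded: "(\<integral>\<^sup>+\<omega>. ?G k (stopped (trajectory \<omega>)) \<partial>M) = (SUP n. picard (?G k) n 0 start)" for k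
    using stopped_expectation_bounded[OF G_k, of k "real k"]
    by (simp add: prediction_def ennreal_of_nat_eq_real_of_nat)
  have "(\<lambda>k. \<integral>\<^sup>+\<omega>. ?G k (stopped (trajectory \<omega>)) \<partial>M) \<longlonglongrightarrow> (\<integral>\<^sup>+\<omega>. G (stopped (trajectory \<omega>)) \<partial>M)"
  proof (rule nn_integral_LIMSEQ)
    show "incseq (\<lambda>k \<omega>. ?G k (stopped (trajectory \<omega>)))"
      using mono by (auto simp: incseq_def le_fun_def)
    show "(\<lambda>\<omega>. ?G k (stopped (trajectory \<omega>))) \<in> borel_measurable M" for k
      using measurable_compose[OF measurable_trajectory measurable_compose[OF measurable_stopped G_k]] by simp
    show "(\<lambda>k. ?G k y) \<longlonglongrightarrow> G y" for y
      using tendsto_min[OF tendsto_const[of "G y"] of_nat_tendsto_top_ennreal] by simp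
  qed
  moreover have "(\<lambda>k. SUP n. picard (?G k) n 0 start) \<longlonglongrightarrow> (SUP k. SUP n. picard (?G k) n 0 start)"
  proof (rule LIMSEQ_SUP, rule incseq_SucI, rule SUP_mono)
    fix k n
    show "\<exists>m\<in>UNIV. picard (?G k) n 0 start \<le> picard (?G (Suc k)) m 0 start"
      using picard_mono[OF mono[of k "Suc k"], of n] by (auto simp: le_fun_def)
  qed
  ultimately have "(\<integral>\<^sup>+\<omega>. G (stopped (trajectory \<omega>)) \<partial>M) = (SUP k. SUP n. picard (?G k) n 0 start)"
    unfolding bounded by (rule LIMSEQ_unique)
  also have "\<dots> = (SUP n. SUP k. picard (?G k) n 0 start)" by (rule SUP_commute)
  also have "\<dots> = (SUP n. picard G n 0 start)"
  proof (intro SUP_cong refl)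
    fix n
    have "incseq (\<lambda>k. picard (?G k) n 0 start)"
      using picard_mono[OF mono] by (auto simp: incseq_def le_fun_def)
    from LIMSEQ_SUP[OF this] show "(SUP k. picard (?G k) n 0 start) = picard G n 0 start"
      by (rule LIMSEQ_unique) (rule picard_truncation_tendsto[OF G c])
  qed
  finally show ?thesis .
qed

end


section \<open>The time change\<close>

lemma frozen_at:
  assumes "stop_path s x = x" "0 \<le> s" "s \<le> r"
  shows "x r = x s"
proof -
  have "x r = stop_path s x r" by (simp only: assms(1))
  also have "\<dots> = x (min r s)" by (rule stop_path_at) (use assms in simp)
  finally show ?thesis using assms(3) by (simp only: min_absorb2)
qed

lemma frozen_later:
  assumes "stop_path s x = x" "0 \<le> s" "s \<le> r"
  shows "stop_path r x = x"
proof -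
  have "stop_path r (stop_path s x) = stop_path s x"
    using assms(2,3) by (simp add: stop_path_stop_path min_absorb2)
  then show ?thesis by (simp only: assms(1))
qed

lemma frozen_local_time:
  fixes x :: "real \<Rightarrow> 'v::finite"
  assumes "right_continuous_path x" "stop_path s x = x" "0 \<le> s" "s \<le> r"
  shows "local_time x j r = local_time x j s + (if j = x s then r - s else 0)"
proof (rule local_time_frozen[OF assms(1,3,4)])
  fix q assume "s < q"
  then show "x q = x s" by (intro frozen_at[OF assms(2,3)]) simp
qed

lemma local_time_restrict: "local_time (restrict x {0..}) = local_time x"
  by (intro ext local_time_cong) simp

lemma stop_path_restrict: "0 \<le> a \<Longrightarrow> stop_path a (restrict x {0..}) = stop_path a x"
  by (auto simp: stop_path_def fun_eq_iff)

lemma exhaustion_time_eq: "exhaustion_time \<Phi> = first_hit (\<lambda>i. (1/2) * (\<Phi> i)\<^sup>2)"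
  unfolding exhaustion_time_def[abs_def] first_hit_def[abs_def] ..

lemma rvrjp_end_eq: "rvrjp_end \<Phi> = first_hit \<Phi>"
proof -
  have "remaining \<Phi> y j s = 0 \<longleftrightarrow> local_time y j s = \<Phi> j" for y j s
    by (auto simp: remaining_def)
  then show ?thesis unfolding rvrjp_end_def[abs_def] first_hit_def[abs_def] by (simp only:)
qed

locale weighted_graph =
  fixes w :: "'v::finite \<Rightarrow> 'v \<Rightarrow> real" and \<Phi> :: "'v \<Rightarrow> real" and t :: real
  assumes w_nonneg: "0 \<le> w i j" and w_sym: "w i j = w j i" and w_loop: "w i i = 0"
    and \<Phi>_pos: "0 < \<Phi> i" and t_nonneg: "0 \<le> t"
begin

lemma half_pos: "0 < (1/2) * (\<Phi> i)\<^sup>2"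
  using \<Phi>_pos[of i] by simp

lemmas end_bounds = first_hit_bounds[of \<Phi>, OF \<Phi>_pos, folded rvrjp_end_eq]
lemmas exhaustion_bounds = first_hit_bounds[of "\<lambda>i. (1/2) * (\<Phi> i)\<^sup>2", OF half_pos, folded exhaustion_time_eq]
lemmas end_cong = first_hit_cong[of \<Phi>, OF \<Phi>_pos, folded rvrjp_end_eq]
lemmas exhaustion_cong = first_hit_cong[of "\<lambda>i. (1/2) * (\<Phi> i)\<^sup>2", OF half_pos, folded exhaustion_time_eq]

lemma measurable_end [measurable]: "rvrjp_end \<Phi> \<in> borel_measurable path_space"
  unfolding rvrjp_end_eq by (rule measurable_first_hit) (rule \<Phi>_pos)

lemma measurable_exhaustion [measurable]: "exhaustion_time \<Phi> \<in> borel_measurable path_space"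
  unfolding exhaustion_time_eq by (rule measurable_first_hit) (rule half_pos)

lemma less_end_iff:
  assumes "right_continuous_path y" "0 \<le> s"
  shows "s < rvrjp_end \<Phi> y \<longleftrightarrow> (\<forall>i. 0 < remaining \<Phi> y i s)"
  unfolding rvrjp_end_eq less_first_hit_iff[OF \<Phi>_pos assms] by (simp add: remaining_def)

lemma remaining_nonneg:
  assumes "right_continuous_path y" "0 \<le> s" "s \<le> rvrjp_end \<Phi> y"
  shows "0 \<le> remaining \<Phi> y i s"
  using local_time_le_first_hit[of \<Phi>, OF \<Phi>_pos assms(1,2), of i] assms(3) by (simp add: remaining_def rvrjp_end_eq)

lemma remaining_le: "remaining \<Phi> y i s \<le> \<Phi> i"
  by (simp add: remaining_def local_time_nonneg)

lemma remaining_antimono: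
  fixes y :: "real \<Rightarrow> 'v"
  assumes "right_continuous_path y" "0 \<le> r" "r \<le> s"
  shows "remaining \<Phi> y i s \<le> remaining \<Phi> y i r"
  using local_time_mono(1)[OF assms, of i] by (simp add: remaining_def)

lemma clock_0 [simp]: "clock \<Phi> y 0 = 0"
  by (simp add: clock_def remaining_def)

text \<open>Until the end of the process the remaining local times are nonnegative and nonincreasing, and their
  sum decreases at unit speed. So one of them, and its square, decreases strictly.\<close>

lemma clock_strict_mono:
  assumes y: "right_continuous_path y" and r: "0 \<le> r" "r < s" "s \<le> rvrjp_end \<Phi> y"
  shows "clock \<Phi> y r < clock \<Phi> y s"
proof -
  have le: "(remaining \<Phi> y i s)\<^sup>2 \<le> (remaining \<Phi> y i r)\<^sup>2" for i
    by (rule power_mono) (use r in \<open>simp_all add: remaining_antimono[OF y r(1)] remaining_nonneg[OF y _ r(3)]\<close>)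
  have "\<exists>i. local_time y i r < local_time y i s"
  proof (rule ccontr)
    assume "\<not> ?thesis"
    then have "(\<Sum>i\<in>UNIV. local_time y i s) \<le> (\<Sum>i\<in>UNIV. local_time y i r)"
      by (intro sum_mono) (simp add: not_less)
    then show False using sum_local_time[OF y, of r] sum_local_time[OF y, of s] r by simp
  qed
  then obtain i where i: "remaining \<Phi> y i s < remaining \<Phi> y i r" by (auto simp: remaining_def)
  then have "(remaining \<Phi> y i s)\<^sup>2 < (remaining \<Phi> y i r)\<^sup>2"
    using remaining_nonneg[OF y _ r(3), of i] r by (intro power_strict_mono) auto
  then have "(\<Sum>i\<in>UNIV. (\<Phi> i)\<^sup>2 - (remaining \<Phi> y i r)\<^sup>2) < (\<Sum>i\<in>UNIV. (\<Phi> i)\<^sup>2 - (remaining \<Phi> y i s)\<^sup>2)"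
    using le by (intro sum_strict_mono_ex1) (auto intro!: exI[of _ i])
  then show ?thesis by (simp add: clock_def)
qed

lemma clock_mono:
  assumes y: "right_continuous_path y" and r: "0 \<le> r" "r \<le> s" "s \<le> rvrjp_end \<Phi> y"
  shows "clock \<Phi> y r \<le> clock \<Phi> y s"
  using clock_strict_mono[OF y r(1) _ r(3)] r(2) by (cases "r = s") auto

lemma continuous_on_clock:
  assumes "right_continuous_path y"
  shows "continuous_on {0..} (clock \<Phi> y)"
  unfolding clock_def remaining_def
  by (intro continuous_intros continuous_on_local_time[OF assms])

text \<open>The time up to which the time-changed process is observed. The corresponding time of the
  reinforced process, at which its clock shows the horizon, is \<open>\<sigma>Y\<close>.\<close>

definition horizon :: "(real \<Rightarrow> 'v) \<Rightarrow> real" where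
  "horizon y = min t (time_changed_end \<Phi> y)"

definition inverse_clock :: "(real \<Rightarrow> 'v) \<Rightarrow> real \<Rightarrow> real" where
  "inverse_clock y = the_inv_into {0..rvrjp_end \<Phi> y} (clock \<Phi> y)"

definition \<sigma>Y :: "(real \<Rightarrow> 'v) \<Rightarrow> real" where
  "\<sigma>Y y = inverse_clock y (horizon y)"

lemma clock_inj: "right_continuous_path y \<Longrightarrow> inj_on (clock \<Phi> y) {0..rvrjp_end \<Phi> y}"
  by (rule linorder_inj_onI) (auto dest!: clock_strict_mono)

lemma inverse_clock_clock:
  "right_continuous_path y \<Longrightarrow> 0 \<le> s \<Longrightarrow> s \<le> rvrjp_end \<Phi> y \<Longrightarrow> inverse_clock y (clock \<Phi> y s) = s"
  unfolding inverse_clock_def by (rule the_inv_into_f_f[OF clock_inj]) auto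

lemma inverse_clock:
  assumes y: "right_continuous_path y" and u: "0 \<le> u" "u \<le> time_changed_end \<Phi> y"
  shows "0 \<le> inverse_clock y u" "inverse_clock y u \<le> rvrjp_end \<Phi> y" "clock \<Phi> y (inverse_clock y u) = u"
proof -
  have "\<exists>s. 0 \<le> s \<and> s \<le> rvrjp_end \<Phi> y \<and> clock \<Phi> y s = u"
  proof -
    have "continuous_on {0..rvrjp_end \<Phi> y} (clock \<Phi> y)"
      by (rule continuous_on_subset[OF continuous_on_clock[OF y]]) auto
    moreover have "clock \<Phi> y 0 \<le> u" "u \<le> clock \<Phi> y (rvrjp_end \<Phi> y)" "0 \<le> rvrjp_end \<Phi> y"
      using u end_bounds(1)[OF y] by (simp_all add: time_changed_end_def)
    ultimately show ?thesis using IVT'[of "clock \<Phi> y" 0 u "rvrjp_end \<Phi> y"] by blast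
  qed
  then obtain s where s: "0 \<le> s" "s \<le> rvrjp_end \<Phi> y" "clock \<Phi> y s = u" by blast
  then have "inverse_clock y u = s" using inverse_clock_clock[OF y s(1,2)] by simp
  with s show "0 \<le> inverse_clock y u" "inverse_clock y u \<le> rvrjp_end \<Phi> y" "clock \<Phi> y (inverse_clock y u) = u"
    by auto
qed

lemma time_changed_end_pos: "right_continuous_path y \<Longrightarrow> 0 < time_changed_end \<Phi> y"
  unfolding time_changed_end_def using clock_strict_mono[of y 0 "rvrjp_end \<Phi> y"] end_bounds(1)[of y] by simp

lemma horizon_bounds:
  assumes "right_continuous_path y"
  shows "0 \<le> horizon y" "horizon y \<le> time_changed_end \<Phi> y" "horizon y \<le> t"
  using time_changed_end_pos[OF assms] t_nonneg by (auto simp: horizon_def)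

lemma inverse_clock_le_iff:
  assumes y: "right_continuous_path y" and u: "0 \<le> u" "u \<le> time_changed_end \<Phi> y"
    and a: "0 \<le> a" "a \<le> rvrjp_end \<Phi> y"
  shows "inverse_clock y u \<le> a \<longleftrightarrow> u \<le> clock \<Phi> y a"
proof
  assume "inverse_clock y u \<le> a"
  from clock_mono[OF y inverse_clock(1)[OF y u] this a(2)] show "u \<le> clock \<Phi> y a"
    using inverse_clock(3)[OF y u] by simp
next
  assume *: "u \<le> clock \<Phi> y a"
  show "inverse_clock y u \<le> a"
  proof (rule ccontr)
    assume "\<not> ?thesis"
    then have "clock \<Phi> y a < u"
      using clock_strict_mono[OF y a(1) _ inverse_clock(2)[OF y u]] inverse_clock(3)[OF y u] by simp
    with * show False by simp
  qed
qed

lemma \<sigma>Y: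
  assumes "right_continuous_path y"
  shows "0 \<le> \<sigma>Y y" "\<sigma>Y y \<le> rvrjp_end \<Phi> y" "clock \<Phi> y (\<sigma>Y y) = horizon y"
  using inverse_clock[OF assms horizon_bounds(1,2)[OF assms]] by (auto simp: \<sigma>Y_def)

lemma \<sigma>Y_eqI:
  "right_continuous_path y \<Longrightarrow> 0 \<le> s \<Longrightarrow> s \<le> rvrjp_end \<Phi> y \<Longrightarrow> clock \<Phi> y s = horizon y \<Longrightarrow> \<sigma>Y y = s"
  using inverse_clock_clock[of y s] by (simp add: \<sigma>Y_def)

lemma clock_cong:
  assumes "\<And>q. 0 \<le> q \<Longrightarrow> q < s \<Longrightarrow> x q = y q"
  shows "clock \<Phi> x s = clock \<Phi> y s" "remaining \<Phi> x i s = remaining \<Phi> y i s"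
  using local_time_cong[OF assms] by (simp_all add: clock_def remaining_def)

text \<open>Either \<open>\<sigma>Y x\<close> is the end of the process, which is predictable, or some local time remains at every
  vertex and the clock shows \<open>t\<close>; both are visible in the path strictly before \<open>\<sigma>Y x\<close>.\<close>

lemma \<sigma>Y_agree:
  assumes x: "right_continuous_path x" and y: "right_continuous_path y"
    and eq: "\<And>q. 0 \<le> q \<Longrightarrow> q < \<sigma>Y x \<Longrightarrow> y q = x q"
  shows "\<sigma>Y y = \<sigma>Y x" "horizon y = horizon x" "\<sigma>Y x \<le> rvrjp_end \<Phi> y"
proof -
  have clock: "clock \<Phi> y s = clock \<Phi> x s" "remaining \<Phi> y i s = remaining \<Phi> x i s" if "s \<le> \<sigma>Y x" for s i
  proof -
    have *: "y q = x q" if "0 \<le> q" "q < s" for q by (rule eq) (use that \<open>s \<le> \<sigma>Y x\<close> in simp_all)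
    show "clock \<Phi> y s = clock \<Phi> x s" by (rule clock_cong(1)[OF *])
    show "remaining \<Phi> y i s = remaining \<Phi> x i s" by (rule clock_cong(2)[OF *])
  qed
  have "\<sigma>Y x \<le> rvrjp_end \<Phi> y \<and> horizon y = horizon x"
  proof (cases "\<sigma>Y x = rvrjp_end \<Phi> x")
    case True
    then have "rvrjp_end \<Phi> y = rvrjp_end \<Phi> x" by (intro end_cong x y eq) simp_all
    then show ?thesis using clock(1)[of "\<sigma>Y x"] True by (simp add: horizon_def time_changed_end_def)
  next
    case False
    then have lt: "\<sigma>Y x < rvrjp_end \<Phi> x" using \<sigma>Y(2)[OF x] by simp
    then have "horizon x < time_changed_end \<Phi> x"
      using clock_strict_mono[OF x \<sigma>Y(1)[OF x] lt] \<sigma>Y(3)[OF x] by (simp add: time_changed_end_def)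
    then have hx: "horizon x = t" by (simp add: horizon_def min_def split: if_splits)
    have lt': "\<sigma>Y x < rvrjp_end \<Phi> y"
      using lt clock(2)[of "\<sigma>Y x"] \<sigma>Y(1)[OF x] by (simp add: less_end_iff x y)
    have "clock \<Phi> y (\<sigma>Y x) = t" using clock(1)[of "\<sigma>Y x"] \<sigma>Y(3)[OF x] hx by simp
    then have "t \<le> time_changed_end \<Phi> y"
      using clock_mono[OF y \<sigma>Y(1)[OF x] less_imp_le[OF lt']] by (simp add: time_changed_end_def)
    then show ?thesis using hx lt' by (simp add: horizon_def)
  qed
  then show "horizon y = horizon x" and le: "\<sigma>Y x \<le> rvrjp_end \<Phi> y" by auto
  then show "\<sigma>Y y = \<sigma>Y x"
    using clock(1)[of "\<sigma>Y x"] \<sigma>Y[OF x] by (intro \<sigma>Y_eqI[OF y]) auto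
qed

lemma measurable_clock:
  assumes [measurable]: "f \<in> borel_measurable M" "g \<in> measurable M path_space"
  shows "(\<lambda>\<omega>. clock \<Phi> (g \<omega>) (f \<omega>)) \<in> borel_measurable M"
  unfolding clock_def remaining_def by measurable

lemma measurable_horizon [measurable]: "horizon \<in> borel_measurable path_space"
  unfolding horizon_def[abs_def] time_changed_end_def
  by (intro borel_measurable_min measurable_clock measurable_end measurable_ident_sets) simp_all

lemma measurable_inverse_clock:
  assumes f: "f \<in> borel_measurable path_space"
    and "\<And>y. y \<in> space path_space \<Longrightarrow> 0 \<le> f y" "\<And>y. y \<in> space path_space \<Longrightarrow> f y \<le> time_changed_end \<Phi> y"
  shows "(\<lambda>y. inverse_clock y (f y)) \<in> borel_measurable path_space"
  unfolding borel_measurable_iff_le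
proof
  fix a
  have "inverse_clock y (f y) \<le> a \<longleftrightarrow> 0 \<le> a \<and> f y \<le> clock \<Phi> y (min a (rvrjp_end \<Phi> y))"
    if "y \<in> space path_space" for y
  proof (cases "0 \<le> a")
    case True
    note rc = path_space_rc[OF that]
    have "inverse_clock y (f y) \<le> a \<longleftrightarrow> inverse_clock y (f y) \<le> min a (rvrjp_end \<Phi> y)"
      using inverse_clock(2)[OF rc assms(2,3)[OF that]] by auto
    also have "\<dots> \<longleftrightarrow> f y \<le> clock \<Phi> y (min a (rvrjp_end \<Phi> y))"
      using True end_bounds(1)[OF rc] by (intro inverse_clock_le_iff rc assms that) auto
    finally show ?thesis using True by simp
  next
    case False
    then show ?thesis using inverse_clock(1)[OF path_space_rc[OF that] assms(2,3)[OF that]] by auto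
  qed
  then have "{y \<in> space path_space. inverse_clock y (f y) \<le> a} =
      {y \<in> space path_space. 0 \<le> a \<and> f y \<le> clock \<Phi> y (min a (rvrjp_end \<Phi> y))}" by blast
  also have "\<dots> \<in> sets path_space"
  proof -
    have "(\<lambda>y. clock \<Phi> y (min a (rvrjp_end \<Phi> y))) \<in> borel_measurable path_space"
      by (intro borel_measurable_min measurable_clock measurable_end measurable_ident_sets) simp_all
    from borel_measurable_le[OF f this] show ?thesis by (cases "0 \<le> a") simp_all
  qed
  finally show "{y \<in> space path_space. inverse_clock y (f y) \<le> a} \<in> sets path_space" .
qed

lemma measurable_\<sigma>Y: "\<sigma>Y \<in> borel_measurable path_space"
proof -
  have "(\<lambda>y. inverse_clock y (horizon y)) \<in> borel_measurable path_space"
    by (rule measurable_inverse_clock) (auto intro: horizon_bounds path_space_rc)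
  then show ?thesis by (simp add: \<sigma>Y_def[abs_def])
qed

text \<open>The observed time-changed trajectory: the theorem is about the law of this path.\<close>

definition changed :: "(real \<Rightarrow> 'v) \<Rightarrow> real \<Rightarrow> 'v" where
  "changed y = stop_path (horizon y) (time_changed \<Phi> y)"

lemma changed_at:
  "0 \<le> u \<Longrightarrow> changed y u = y (inverse_clock y (min u (horizon y)))"
  by (simp only: changed_def stop_path_at time_changed_def inverse_clock_def)

text \<open>The inverse clock is increasing and continuous, so it turns right neighbourhoods into right
  neighbourhoods.\<close>

lemma changed_in:
  assumes y: "right_continuous_path y"
  shows "changed y \<in> space path_space"
proof -
  have "right_continuous_path (changed y)"
  proof (rule right_continuous_pathI)
    fix u :: real assume u: "0 \<le> u"
    note m = horizon_bounds[OF y]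
    let ?T = "\<lambda>u. inverse_clock y (min u (horizon y))"
    show "\<exists>b>u. \<forall>r. u < r \<longrightarrow> r < b \<longrightarrow> changed y r = changed y u"
    proof (cases "u < horizon y")
      case False
      have "changed y r = changed y u" if "u < r" for r
      proof -
        have "min u (horizon y) = horizon y" "min r (horizon y) = horizon y" using False that by auto
        then show ?thesis using u that by (simp add: changed_at)
      qed
      then show ?thesis by (intro exI[of _ "u + 1"]) simp
    next
      case True
      have bounds: "0 \<le> min r (horizon y)" "min r (horizon y) \<le> time_changed_end \<Phi> y" if "u \<le> r" for r
        using u that m by auto
      note inv = inverse_clock[OF y bounds]
      obtain b where b: "?T u < b" "\<forall>q. ?T u \<le> q \<longrightarrow> q < b \<longrightarrow> y q = y (?T u)"
        using right_continuous_pathD[OF y inv(1)[OF order_refl]] by blast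
      have Tu: "?T u < rvrjp_end \<Phi> y"
      proof (rule ccontr)
        assume "\<not> ?thesis"
        then have "?T u = rvrjp_end \<Phi> y" using inv(2)[OF order_refl] by simp
        then have "time_changed_end \<Phi> y = min u (horizon y)"
          using inv(3)[OF order_refl] by (simp add: time_changed_end_def)
        then show False using True m by auto
      qed
      define b' where "b' = min b (rvrjp_end \<Phi> y)"
      have b': "?T u < b'" "b' \<le> rvrjp_end \<Phi> y" using b(1) Tu by (auto simp: b'_def)
      have b'0: "0 \<le> b'" using inv(1)[OF order_refl] b'(1) by simp
      have "u < clock \<Phi> y b'"
        using clock_strict_mono[OF y inv(1)[OF order_refl] b'] inv(3)[OF order_refl] True by simp
      moreover have "changed y r = changed y u" if r: "u < r" "r < clock \<Phi> y b'" for r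
      proof -
        have "?T u \<le> ?T r"
          using inverse_clock_le_iff[OF y bounds[OF order_refl] inv(1,2)[of r]] inv(3)[of r] r by auto
        moreover have "?T r < b'"
        proof (rule ccontr)
          assume "\<not> ?thesis"
          then have "clock \<Phi> y b' \<le> min r (horizon y)"
            using clock_mono[OF y b'0 _ inv(2)[of r]] inv(3)[of r] r by simp
          with r show False by simp
        qed
        ultimately have "y (?T r) = y (?T u)"
          using spec[OF b(2), of "?T r"] unfolding b'_def by linarith
        then show ?thesis using u r by (simp add: changed_at)
      qed
      ultimately show ?thesis by blast
    qed
  qed
  then show ?thesis by (simp add: space_path_space changed_def stop_path_def)
qed

lemma measurable_changed [measurable]: "changed \<in> measurable path_space path_space"
proof (rule measurable_path_spaceI)
  fix u :: real assume u: "0 \<le> u"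
  have "(\<lambda>y. inverse_clock y (min u (horizon y))) \<in> borel_measurable path_space"
  proof (rule measurable_inverse_clock)
    fix y :: "real \<Rightarrow> 'v" assume "y \<in> space path_space"
    note m = horizon_bounds[OF path_space_rc[OF this]]
    show "0 \<le> min u (horizon y)" using m(1) u by simp
    show "min u (horizon y) \<le> time_changed_end \<Phi> y" using m(2) by (rule min.coboundedI2)
  qed (intro borel_measurable_min borel_measurable_const measurable_horizon)
  then have "(\<lambda>y. y (inverse_clock y (min u (horizon y)))) \<in> measurable path_space (count_space (UNIV :: 'v set))"
    by (rule measurable_path_at) (rule measurable_ident_sets[OF refl])
  then show "(\<lambda>y. changed y u) \<in> measurable path_space (count_space UNIV)"
    by (simp only: changed_at[OF u])
qed (intro changed_in path_space_rc)

lemma changed_agree: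
  assumes x: "right_continuous_path x" and y: "right_continuous_path y"
    and eq: "\<And>q. 0 \<le> q \<Longrightarrow> q \<le> \<sigma>Y x \<Longrightarrow> y q = x q"
  shows "changed y = changed x"
proof
  have eq': "y q = x q" if "0 \<le> q" "q < \<sigma>Y x" for q by (rule eq[OF that(1) less_imp_le[OF that(2)]])
  note agree = \<sigma>Y_agree[OF x y eq']
  fix u
  show "changed y u = changed x u"
  proof (cases "0 \<le> u")
    case False then show ?thesis by (simp add: changed_def stop_path_def)
  next
    case True
    let ?u = "min u (horizon x)" and ?q = "inverse_clock x (min u (horizon x))"
    have u: "0 \<le> ?u" "?u \<le> time_changed_end \<Phi> x" using True horizon_bounds[OF x] by auto
    note q = inverse_clock[OF x u]
    have "?q \<le> \<sigma>Y x"
      unfolding inverse_clock_le_iff[OF x u \<sigma>Y(1,2)[OF x]] by (simp add: \<sigma>Y(3)[OF x])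
    then have "clock \<Phi> y ?q = clock \<Phi> x ?q"
      by (intro clock_cong(1) eq) simp_all
    then have "clock \<Phi> y ?q = ?u" by (simp only: q(3))
    then have "inverse_clock y ?u = ?q"
      using inverse_clock_clock[OF y q(1)] \<open>?q \<le> \<sigma>Y x\<close> agree(3) by simp
    then show ?thesis using True agree(2) eq[OF q(1) \<open>?q \<le> \<sigma>Y x\<close>] by (simp add: changed_at)
  qed
qed

end


section \<open>The density along a trajectory\<close>

context weighted_graph
begin

lemma square_sum_update:
  fixes L :: "'v \<Rightarrow> real"
  shows "(\<Sum>j\<in>UNIV. ((L(i := a)) j)\<^sup>2) = (\<Sum>j\<in>UNIV. (L j)\<^sup>2) - (L i)\<^sup>2 + a\<^sup>2"
proof -
  have "(\<Sum>j\<in>UNIV. ((L(i := a)) j)\<^sup>2) = ((L(i := a)) i)\<^sup>2 + (\<Sum>j\<in>UNIV - {i}. ((L(i := a)) j)\<^sup>2)"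
    by (rule sum.remove) auto
  also have "(\<Sum>j\<in>UNIV - {i}. ((L(i := a)) j)\<^sup>2) = (\<Sum>j\<in>UNIV - {i}. (L j)\<^sup>2)"
    by (intro sum.cong) auto
  also have "\<dots> = (\<Sum>j\<in>UNIV. (L j)\<^sup>2) - (L i)\<^sup>2"
    using sum.remove[of UNIV i "\<lambda>j. (L j)\<^sup>2"] by simp
  finally show ?thesis by simp
qed

text \<open>Only the edges at \<open>i\<close> contribute. The part that is quadratic in the value at \<open>i\<close> has the total
  conductance as its coefficient, the linear part the total jump rate of the reinforced process.\<close>

lemma dirichlet_update:
  "dirichlet w (L(i := a)) - dirichlet w L =
    (\<Sum>j\<in>UNIV. w i j) * (a\<^sup>2 - (L i)\<^sup>2) - 2 * (\<Sum>j\<in>UNIV. w i j * L j) * (a - L i)"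
proof -
  let ?L = "L(i := a)"
  define d where "d x y = w x y * ((?L x - ?L y)\<^sup>2 - (L x - L y)\<^sup>2)" for x y
  have d: "d x y = (if x = i then d i y else 0) + (if y = i then d i x else 0)" for x y
    using w_loop[of i] w_sym[of x i] by (auto simp: d_def power2_commute)
  have "dirichlet w ?L - dirichlet w L = (1/2) * (\<Sum>x\<in>UNIV. \<Sum>y\<in>UNIV. d x y)"
    unfolding dirichlet_def d_def
    by (simp add: right_diff_distrib sum_subtractf)
  also have "(\<Sum>x\<in>UNIV. \<Sum>y\<in>UNIV. d x y) =
      (\<Sum>x\<in>UNIV. \<Sum>y\<in>UNIV. (if x = i then d i y else 0) + (if y = i then d i x else 0))"
    by (intro sum.cong refl) (rule d)
  also have "\<dots> = 2 * (\<Sum>y\<in>UNIV. d i y)"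
  proof -
    have "(\<Sum>x\<in>UNIV. \<Sum>y\<in>UNIV. (if x = i then d i y else 0)) = (\<Sum>y\<in>UNIV. d i y)"
      by (subst sum.swap) simp
    then show ?thesis by (simp add: sum.distrib)
  qed
  also have "(1/2) * (2 * (\<Sum>y\<in>UNIV. d i y)) = (\<Sum>y\<in>UNIV. w i y * (a\<^sup>2 - (L i)\<^sup>2) - 2 * (w i y * L y) * (a - L i))"
  proof -
    have "d i y = w i y * (a\<^sup>2 - (L i)\<^sup>2) - 2 * (w i y * L y) * (a - L i)" for y
      using w_loop[of i] by (cases "y = i") (simp_all add: d_def power2_eq_square algebra_simps)
    then show ?thesis by simp
  qed
  also have "\<dots> = (\<Sum>j\<in>UNIV. w i j) * (a\<^sup>2 - (L i)\<^sup>2) - 2 * (\<Sum>j\<in>UNIV. w i j * L j) * (a - L i)"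
    by (simp add: sum_subtractf sum_distrib_right sum_distrib_left)
  finally show ?thesis .
qed

text \<open>The density as a function of the remaining local times and of the current vertex.\<close>

definition weight :: "'v \<Rightarrow> ('v \<Rightarrow> real) \<Rightarrow> 'v \<Rightarrow> real" where
  "weight x0 L i = exp (- (1/2) * (dirichlet w L - dirichlet w \<Phi>)) *
     ((\<Prod>j\<in>UNIV - {x0}. \<Phi> j) / (\<Prod>j\<in>UNIV - {i}. L j))"

lemma weight_start: "weight x0 \<Phi> x0 = 1"
proof -
  have "\<Phi> j \<noteq> 0" for j using \<Phi>_pos[of j] by simp
  then show ?thesis by (simp add: weight_def)
qed

lemma weight_nonneg: "(\<And>j. 0 < L j) \<Longrightarrow> 0 \<le> weight x0 L i"
  unfolding weight_def by (intro mult_nonneg_nonneg divide_nonneg_nonneg prod_nonneg) (auto intro: less_imp_le \<Phi>_pos)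

text \<open>Waiting at \<open>i\<close> while its remaining local time decreases to \<open>a\<close> takes the time \<open>L i - a\<close> for the reinforced
  process and \<open>(L i\<^sup>2 - a\<^sup>2) / 2\<close> after the time change. The factor is the quotient of the probabilities of
  not jumping meanwhile. The product in \<open>weight\<close> leaves out \<open>i\<close> and therefore stays the same.\<close>

lemma weight_move:
  "weight x0 (L(i := a)) i = weight x0 L i *
    exp ((\<Sum>j\<in>UNIV. w i j) * (((L i)\<^sup>2 - a\<^sup>2) / 2) - (\<Sum>j\<in>UNIV. w i j * L j) * (L i - a))"
proof -
  let ?W = "\<Sum>j\<in>UNIV. w i j" and ?c = "\<Sum>j\<in>UNIV. w i j * L j"
  have "(\<Prod>j\<in>UNIV - {i}. (L(i := a)) j) = (\<Prod>j\<in>UNIV - {i}. L j)"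
    by (intro prod.cong) auto
  moreover have "- (1/2) * (dirichlet w (L(i := a)) - dirichlet w \<Phi>) =
      - (1/2) * (dirichlet w L - dirichlet w \<Phi>) + (?W * (((L i)\<^sup>2 - a\<^sup>2) / 2) - ?c * (L i - a))"
  proof -
    have "dirichlet w (L(i := a)) = dirichlet w L + (?W * (a\<^sup>2 - (L i)\<^sup>2) - 2 * ?c * (a - L i))"
      using dirichlet_update[of L i a] by linarith
    then show ?thesis by (simp add: algebra_simps diff_divide_distrib)
  qed
  ultimately show ?thesis unfolding weight_def by (simp only: exp_add) (simp add: ac_simps)
qed

text \<open>A jump from \<open>i\<close> to \<open>j\<close> exchanges the vertex left out of the product.\<close>

lemma weight_switch:
  assumes "\<And>j. 0 < L j"
  shows "weight x0 L j * L i = weight x0 L i * L j"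
proof -
  have nz: "L k \<noteq> 0" "(\<Prod>j\<in>UNIV - {k}. L j) \<noteq> 0" for k
    using assms by (auto simp: less_imp_neq[symmetric])
  have all: "(\<Prod>j\<in>UNIV. L j) = L k * (\<Prod>j\<in>UNIV - {k}. L j)" for k
    by (rule prod.remove) auto
  have "L i / (\<Prod>k\<in>UNIV - {j}. L k) = L j / (\<Prod>k\<in>UNIV - {i}. L k)"
    using nz all[of i] all[of j] by (simp add: frac_eq_eq ac_simps)
  then have "P / (\<Prod>k\<in>UNIV - {j}. L k) * L i = P / (\<Prod>k\<in>UNIV - {i}. L k) * L j" for P
    by (metis mult.commute times_divide_eq_left times_divide_eq_right)
  then show ?thesis unfolding weight_def mult.assoc by (simp only:)
qed

definition rateY :: "(real \<Rightarrow> 'v) \<Rightarrow> real \<Rightarrow> 'v \<Rightarrow> real" where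
  "rateY y s j = (if s < rvrjp_end \<Phi> y then w (y s) j * remaining \<Phi> y j s else 0)"

definition \<sigma>X :: "(real \<Rightarrow> 'v) \<Rightarrow> real" where
  "\<sigma>X x = min t (exhaustion_time \<Phi> x)"

lemma measurable_weight_at:
  "(\<lambda>p. w (snd p (fst p)) j) \<in> borel_measurable (borel \<Otimes>\<^sub>M path_space)"
proof -
  have "(\<lambda>p. snd p (fst p)) \<in> measurable (borel \<Otimes>\<^sub>M path_space) (count_space (UNIV :: 'v set))"
    by (rule measurable_path_at[OF measurable_fst measurable_snd])
  then show ?thesis by (rule measurable_compose) simp
qed

sublocale X: rate_functional "\<lambda>x r j. w (x r) j" \<sigma>X "\<Sum>i\<in>UNIV. \<Sum>j\<in>UNIV. w i j" t
proof
  show "(\<Sum>j\<in>UNIV. w (x r) j) \<le> (\<Sum>i\<in>UNIV. \<Sum>j\<in>UNIV. w i j)" for x r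
    by (rule member_le_sum) (auto intro: sum_nonneg w_nonneg)
  show "\<sigma>X \<in> borel_measurable path_space"
    unfolding \<sigma>X_def[abs_def] by (intro borel_measurable_min borel_measurable_const measurable_exhaustion)
  fix x y :: "real \<Rightarrow> 'v" assume x: "x \<in> space path_space"
  show "w (x r) j = w (x s) j" if "stop_path s x = x" "0 \<le> s" "s \<le> r" for s r j
    by (simp only: frozen_at[OF that])
  show "0 \<le> \<sigma>X x" using exhaustion_bounds(1)[OF path_space_rc[OF x]] t_nonneg by (simp add: \<sigma>X_def)
  show "\<sigma>X x \<le> t" by (simp add: \<sigma>X_def)
  assume y: "y \<in> space path_space" and eq: "\<And>q. 0 \<le> q \<Longrightarrow> q < \<sigma>X x \<Longrightarrow> y q = x q"
  note rc = path_space_rc[OF x] path_space_rc[OF y]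
  show "\<sigma>X y = \<sigma>X x"
  proof (cases "exhaustion_time \<Phi> x \<le> t")
    case True
    then have "\<sigma>X x = exhaustion_time \<Phi> x" by (simp add: \<sigma>X_def)
    then have "exhaustion_time \<Phi> y = exhaustion_time \<Phi> x"
      by (intro exhaustion_cong rc eq) simp_all
    then show ?thesis by (simp add: \<sigma>X_def)
  next
    case False
    have eq_t: "local_time y i t = local_time x i t" for i
    proof (rule local_time_cong)
      fix q assume "0 \<le> q" "q < t"
      then show "y q = x q" using False by (intro eq) (simp_all add: \<sigma>X_def)
    qed
    note hit = less_first_hit_iff[of "\<lambda>i. (1/2) * (\<Phi> i)\<^sup>2", OF half_pos _ t_nonneg, folded exhaustion_time_eq]
    have "\<forall>i. local_time x i t < (1/2) * (\<Phi> i)\<^sup>2"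
      using False unfolding hit[OF rc(1), symmetric] by simp
    then have "t < exhaustion_time \<Phi> y"
      unfolding hit[OF rc(2)] eq_t .
    then show ?thesis using False by (simp add: \<sigma>X_def)
  qed
qed (simp_all add: w_nonneg measurable_weight_at)

lemma rateY_frozen:
  assumes y: "y \<in> space path_space" "stop_path s y = y" and s: "0 \<le> s" "s \<le> r" "r < rvrjp_end \<Phi> y"
  shows "rateY y r j = rateY y s j"
proof (cases "j = y s")
  case False
  then have "remaining \<Phi> y j r = remaining \<Phi> y j s"
    using frozen_local_time[OF path_space_rc[OF y(1)] y(2) s(1,2), of j] by (simp add: remaining_def)
  then show ?thesis using s frozen_at[OF y(2) s(1,2)] by (simp add: rateY_def)
qed (use frozen_at[OF y(2) s(1,2)] s in \<open>simp add: rateY_def w_loop\<close>)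

lemma rateY_bounds:
  assumes y: "y \<in> space path_space" and r: "0 \<le> r"
  shows "0 \<le> rateY y r j" "rateY y r j \<le> w (y r) j * \<Phi> j"
proof -
  have "r < rvrjp_end \<Phi> y \<Longrightarrow> 0 \<le> remaining \<Phi> y j r"
    using remaining_nonneg[OF path_space_rc[OF y] r] by simp
  then show "0 \<le> rateY y r j" "rateY y r j \<le> w (y r) j * \<Phi> j"
    using \<Phi>_pos[of j] w_nonneg[of "y r" j] remaining_le[of y j r]
    by (auto simp: rateY_def intro: mult_left_mono)
qed

sublocale Y: rate_functional rateY \<sigma>Y "\<Sum>i\<in>UNIV. \<Sum>j\<in>UNIV. w i j * \<Phi> j" "\<Sum>i\<in>UNIV. \<Phi> i"
proof
  show "(\<lambda>p. rateY (snd p) (fst p) j) \<in> borel_measurable (borel \<Otimes>\<^sub>M path_space)" for j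
  proof -
    have [measurable]: "(\<lambda>p. rvrjp_end \<Phi> (snd p)) \<in> borel_measurable (borel \<Otimes>\<^sub>M path_space)"
      by (rule measurable_compose[OF measurable_snd measurable_end])
    note [measurable] = measurable_weight_at
    have [measurable]: "(\<lambda>p. remaining \<Phi> (snd p) j (fst p)) \<in> borel_measurable (borel \<Otimes>\<^sub>M path_space)"
      unfolding remaining_def by measurable
    show ?thesis unfolding rateY_def by measurable
  qed
  show "rateY (restrict x {0..}) r = rateY x r" if r: "0 \<le> r" for x :: "real \<Rightarrow> 'v" and r
  proof -
    have "remaining \<Phi> (restrict x {0..}) = remaining \<Phi> x" "rvrjp_end \<Phi> (restrict x {0..}) = rvrjp_end \<Phi> x"
      by (simp_all add: fun_eq_iff remaining_def rvrjp_end_def local_time_restrict)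
    then show ?thesis using r by (simp add: rateY_def fun_eq_iff)
  qed
  show "\<sigma>Y \<in> borel_measurable path_space" by (rule measurable_\<sigma>Y)
  fix x :: "real \<Rightarrow> 'v" assume x: "x \<in> space path_space"
  note rc = path_space_rc[OF x]
  show "0 \<le> \<sigma>Y x" "\<sigma>Y x \<le> (\<Sum>i\<in>UNIV. \<Phi> i)"
    using \<sigma>Y[OF rc] end_bounds(2)[OF rc] by auto
  show "0 \<le> rateY x r j" if "0 \<le> r" for r j using rateY_bounds(1)[OF x that] .
  show "(\<Sum>j\<in>UNIV. rateY x r j) \<le> (\<Sum>i\<in>UNIV. \<Sum>j\<in>UNIV. w i j * \<Phi> j)" if "0 \<le> r" for r
  proof -
    have "(\<Sum>j\<in>UNIV. rateY x r j) \<le> (\<Sum>j\<in>UNIV. w (x r) j * \<Phi> j)"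
      by (intro sum_mono rateY_bounds(2)[OF x that])
    also have "\<dots> \<le> (\<Sum>i\<in>UNIV. \<Sum>j\<in>UNIV. w i j * \<Phi> j)"
      by (rule member_le_sum) (auto intro!: sum_nonneg mult_nonneg_nonneg w_nonneg less_imp_le[OF \<Phi>_pos])
    finally show ?thesis .
  qed
  show "rateY x r j = rateY x s j" if "stop_path s x = x" "0 \<le> s" "s \<le> r" "r < \<sigma>Y x" for r s j
    using that \<sigma>Y(2)[OF rc] by (intro rateY_frozen x) auto
  show "\<sigma>Y y = \<sigma>Y x" if "y \<in> space path_space" "\<And>q. 0 \<le> q \<Longrightarrow> q < \<sigma>Y x \<Longrightarrow> y q = x q" for y
    by (rule \<sigma>Y_agree(1)[OF rc path_space_rc[OF that(1)] that(2)])
qed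

text \<open>The history \<open>z\<close> of the Markov process up to time \<open>u\<close> is the time change of the history \<open>y\<close> of the
  reinforced process up to \<open>s\<close>, and at every vertex some local time is left. The relation between local times is
  carried along explicitly: it is only ever needed for trajectories with finitely many jumps, where it
  is maintained from jump to jump, without a change of variables in the local times.\<close>

definition matched :: "(real \<Rightarrow> 'v) \<Rightarrow> real \<Rightarrow> (real \<Rightarrow> 'v) \<Rightarrow> real \<Rightarrow> bool" where
  "matched y s z u \<longleftrightarrow> y \<in> space path_space \<and> z \<in> space path_space \<and>
    stop_path s y = y \<and> stop_path u z = z \<and> 0 \<le> s \<and> 0 \<le> u \<and> u \<le> t \<and> y s = z u \<and> clock \<Phi> y s = u \<and>
    (\<forall>j. 0 < remaining \<Phi> y j s \<and> (\<Phi> j)\<^sup>2 - 2 * local_time z j u = (remaining \<Phi> y j s)\<^sup>2) \<and>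
    (\<forall>q. 0 \<le> q \<longrightarrow> q \<le> s \<longrightarrow> y q = z (clock \<Phi> y q))"

lemma matched_start: "matched (restrict (\<lambda>_. x0) {0..}) 0 (restrict (\<lambda>_. x0) {0..}) 0"
proof -
  have "restrict (\<lambda>_. x0) {0..} \<in> space path_space"
    by (rule restrict_in_path_space) (simp add: right_continuous_path_def)
  moreover have "stop_path 0 (restrict (\<lambda>_. x0) {0..}) = restrict (\<lambda>_. x0) {0..}"
    by (auto simp: stop_path_def fun_eq_iff)
  moreover have "q = 0" if "0 \<le> q" "q \<le> 0" for q :: real using that by simp
  ultimately show ?thesis
    unfolding matched_def using \<Phi>_pos t_nonneg by (auto simp: remaining_def)
qed

context
  fixes y z s u assumes m: "matched y s z u"
begin

abbreviation (input) "here \<equiv> y s"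
abbreviation (input) "left \<equiv> \<lambda>j. remaining \<Phi> y j s"

lemma matchedD: "y \<in> space path_space" "z \<in> space path_space" "stop_path s y = y" "stop_path u z = z"
    "0 \<le> s" "0 \<le> u" "u \<le> t" "z u = here" "clock \<Phi> y s = u" "0 < left j"
    "(\<Phi> j)\<^sup>2 - 2 * local_time z j u = (left j)\<^sup>2"
    "0 \<le> q \<Longrightarrow> q \<le> s \<Longrightarrow> y q = z (clock \<Phi> y q)"
  using m unfolding matched_def by auto

lemma y_rc: "right_continuous_path y" and z_rc: "right_continuous_path z"
  using matchedD(1,2) by (simp_all add: path_space_rc)

lemma remaining_after: "s \<le> r \<Longrightarrow> (\<lambda>j. remaining \<Phi> y j r) = left(here := left here - (r - s))"
  using frozen_local_time[OF y_rc matchedD(3,5), of r] by (auto simp: fun_eq_iff remaining_def)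

lemma clock_after: "s \<le> r \<Longrightarrow> clock \<Phi> y r = u + ((left here)\<^sup>2 - (left here - (r - s))\<^sup>2) / 2"
proof -
  assume r: "s \<le> r"
  have "(\<Sum>j\<in>UNIV. (remaining \<Phi> y j r)\<^sup>2) = (\<Sum>j\<in>UNIV. ((left(here := left here - (r - s))) j)\<^sup>2)"
    by (intro sum.cong refl) (simp only: fun_cong[OF remaining_after[OF r]])
  also have "\<dots> = (\<Sum>j\<in>UNIV. (left j)\<^sup>2) - (left here)\<^sup>2 + (left here - (r - s))\<^sup>2"
    by (rule square_sum_update)
  finally have "clock \<Phi> y r = clock \<Phi> y s + ((left here)\<^sup>2 - (left here - (r - s))\<^sup>2) / 2"
    unfolding clock_def sum_subtractf by argo
  then show ?thesis using matchedD(9) by simp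
qed

lemma end_after: "rvrjp_end \<Phi> y = s + left here"
proof (rule antisym)
  have less: "r < rvrjp_end \<Phi> y \<longleftrightarrow> r < s + left here" if r: "s \<le> r" for r
  proof -
    have "remaining \<Phi> y j r = (left(here := left here - (r - s))) j" for j
      using fun_cong[OF remaining_after[OF r], of j] .
    then have "r < rvrjp_end \<Phi> y \<longleftrightarrow> (\<forall>j. 0 < (left(here := left here - (r - s))) j)"
      using less_end_iff[OF y_rc, of r] matchedD(5) r by simp
    also have "\<dots> \<longleftrightarrow> r < s + left here" using matchedD(10) by (auto simp: all_conj_distrib)
    finally show ?thesis .
  qed
  have "s < rvrjp_end \<Phi> y" using less[OF order_refl] matchedD(10) by simp
  then show "s + left here \<le> rvrjp_end \<Phi> y" using less[of "rvrjp_end \<Phi> y"] by simp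
  show "rvrjp_end \<Phi> y \<le> s + left here" using less[of "s + left here"] matchedD(10)[of here] by simp
qed

lemma local_time_after:
  assumes "u \<le> r"
  shows "(\<Phi> j)\<^sup>2 - 2 * local_time z j r = (left j)\<^sup>2 - (if j = here then 2 * (r - u) else 0)"
  using frozen_local_time[OF z_rc matchedD(4,6) assms, of j] matchedD(11)[of j] matchedD(8) by (auto simp: algebra_simps)

lemma exhaustion_after: "exhaustion_time \<Phi> z = u + (left here)\<^sup>2 / 2"
proof (rule antisym)
  have less: "r < exhaustion_time \<Phi> z \<longleftrightarrow> r < u + (left here)\<^sup>2 / 2" if r: "u \<le> r" for r
  proof -
    have "r < exhaustion_time \<Phi> z \<longleftrightarrow> (\<forall>j. 0 < (\<Phi> j)\<^sup>2 - 2 * local_time z j r)"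
    proof -
      have "local_time z j r < (1/2) * (\<Phi> j)\<^sup>2 \<longleftrightarrow> 0 < (\<Phi> j)\<^sup>2 - 2 * local_time z j r" for j by linarith
      then show ?thesis
        unfolding exhaustion_time_eq
          less_first_hit_iff[of "\<lambda>i. (1/2) * (\<Phi> i)\<^sup>2", OF half_pos z_rc order_trans[OF matchedD(6) r]]
        by (simp only:)
    qed
    also have "\<dots> \<longleftrightarrow> (\<forall>j. 0 < (left j)\<^sup>2 - (if j = here then 2 * (r - u) else 0))"
      by (simp only: local_time_after[OF r])
    also have "\<dots> \<longleftrightarrow> r < u + (left here)\<^sup>2 / 2"
    proof
      assume "\<forall>j. 0 < (left j)\<^sup>2 - (if j = here then 2 * (r - u) else 0)"
      from spec[OF this, of here] show "r < u + (left here)\<^sup>2 / 2" by simp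
    next
      assume *: "r < u + (left here)\<^sup>2 / 2"
      show "\<forall>j. 0 < (left j)\<^sup>2 - (if j = here then 2 * (r - u) else 0)"
      proof
        fix j
        have "0 < (left j)\<^sup>2" using matchedD(10)[of j] by simp
        then show "0 < (left j)\<^sup>2 - (if j = here then 2 * (r - u) else 0)"
          using * by (cases "j = here") simp_all
      qed
    qed
    finally show ?thesis .
  qed
  have pos: "0 < (left here)\<^sup>2" using matchedD(10)[of here] by simp
  then have "u < exhaustion_time \<Phi> z" using less[OF order_refl] by simp
  then show "u + (left here)\<^sup>2 / 2 \<le> exhaustion_time \<Phi> z" using less[of "exhaustion_time \<Phi> z"] by simp
  show "exhaustion_time \<Phi> z \<le> u + (left here)\<^sup>2 / 2" using less[of "u + (left here)\<^sup>2 / 2"] pos by simp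
qed

text \<open>While both processes wait at the same vertex, they are going to be stopped simultaneously: both stop
  at clock time \<open>t\<close> or when the remaining local time of this vertex is used up.\<close>

lemma horizon_after: "\<sigma>X z = horizon y"
  using clock_after[of "s + left here"] matchedD(10)[of here]
  by (simp add: \<sigma>X_def horizon_def time_changed_end_def exhaustion_after end_after)

lemma u_le: "u \<le> horizon y"
  using matchedD(7) matchedD(10)[of here] by (simp add: horizon_after[symmetric] \<sigma>X_def exhaustion_after)

lemma s_le: "s \<le> \<sigma>Y y"
proof (rule ccontr)
  assume "\<not> ?thesis"
  then have "clock \<Phi> y (\<sigma>Y y) < clock \<Phi> y s"
    using end_after matchedD(10)[of here] by (intro clock_strict_mono y_rc \<sigma>Y(1)) auto
  then show False using u_le matchedD(9) \<sigma>Y(3)[OF y_rc] by simp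
qed

lemma changed_after: "changed y = z"
proof
  fix q
  show "changed y q = z q"
  proof (cases "0 \<le> q")
    case False
    then show ?thesis using matchedD(2) by (simp add: changed_def stop_path_def space_path_space extensional_def)
  next
    case True
    let ?u = "min q (horizon y)"
    have "0 \<le> ?u" "?u \<le> time_changed_end \<Phi> y" using True horizon_bounds[OF y_rc] by auto
    note r = inverse_clock[OF y_rc this]
    let ?r = "inverse_clock y ?u"
    have "y ?r = z (clock \<Phi> y ?r)"
    proof (cases "?r \<le> s")
      case True then show ?thesis by (rule matchedD(12)[OF r(1)])
    next
      case False
      then have "u \<le> clock \<Phi> y ?r"
        using clock_mono[OF y_rc matchedD(5) _ r(2)] matchedD(9) by simp
      then have "z (clock \<Phi> y ?r) = z u" by (rule frozen_at[OF matchedD(4,6)])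
      moreover have "y ?r = y s" using False by (intro frozen_at[OF matchedD(3,5)]) simp
      ultimately show ?thesis using matchedD(8) by simp
    qed
    also have "\<dots> = z ?u" by (simp only: r(3))
    also have "\<dots> = z q"
    proof (cases "q \<le> horizon y")
      case False
      then have "z q = z u" "z (horizon y) = z u"
        using u_le by (auto intro!: frozen_at[OF matchedD(4,6)])
      then show ?thesis using False by simp
    qed simp
    finally show ?thesis using True by (simp only: changed_at)
  qed
qed

lemma matched_redirect:
  assumes r: "s \<le> r" "r < \<sigma>Y y"
  shows "matched (redirect y r j) r (redirect z (clock \<Phi> y r) j) (clock \<Phi> y r)"
proof -
  let ?v = "clock \<Phi> y r" and ?y = "redirect y r j"
  have r0: "0 \<le> r" using matchedD(5) r by simp
  have r_end: "r < rvrjp_end \<Phi> y" using r \<sigma>Y(2)[OF y_rc] by simp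
  let ?z = "redirect z ?v j"
  have uv: "u \<le> ?v" using clock_mono[OF y_rc matchedD(5) r(1) less_imp_le[OF r_end]] matchedD(9) by simp
  have v0: "0 \<le> ?v" using uv matchedD(6) by simp
  have vt: "?v \<le> t"
    using clock_mono[OF y_rc r0 less_imp_le[OF r(2)] \<sigma>Y(2)[OF y_rc]] \<sigma>Y(3)[OF y_rc] horizon_bounds(3)[OF y_rc]
    by simp
  have agree: "?y q = y q" if "0 \<le> q" "q < r" for q using that by (simp add: redirect_at)
  have clk: "clock \<Phi> ?y q = clock \<Phi> y q" if "q \<le> r" for q
    by (rule clock_cong(1)) (use that in \<open>simp add: redirect_at\<close>)
  have rem: "remaining \<Phi> ?y k r = remaining \<Phi> y k r" for k
    by (rule clock_cong(2)[OF agree])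
  have lt: "local_time ?z k ?v = local_time z k ?v" for k
    by (rule local_time_cong) (simp add: redirect_at)
  have pos: "0 < remaining \<Phi> y k r" for k using r_end less_end_iff[OF y_rc r0] by simp
  have sq: "(\<Phi> k)\<^sup>2 - 2 * local_time z k ?v = (remaining \<Phi> y k r)\<^sup>2" for k
    unfolding local_time_after[OF uv] fun_cong[OF remaining_after[OF r(1)], of k]
    using clock_after[OF r(1)] by (cases "k = here") (simp_all add: field_simps)
  have path: "?y q = ?z (clock \<Phi> ?y q)" if "0 \<le> q" "q \<le> r" for q
  proof (cases "q = r")
    case True then show ?thesis using r0 v0 by (simp add: clk redirect_at)
  next
    case False
    then have q: "q < r" using that by simp
    have "clock \<Phi> y q < ?v" by (rule clock_strict_mono[OF y_rc that(1) q less_imp_le[OF r_end]])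
    moreover have "0 \<le> clock \<Phi> y q"
      using clock_mono[OF y_rc order_refl that(1)] q r_end by simp
    moreover have "y q = z (clock \<Phi> y q)"
    proof (cases "q \<le> s")
      case True then show ?thesis by (rule matchedD(12)[OF that(1)])
    next
      case False
      then have "u \<le> clock \<Phi> y q"
        using clock_mono[OF y_rc matchedD(5), of q] matchedD(9) q r_end by simp
      then have "z (clock \<Phi> y q) = z u" by (rule frozen_at[OF matchedD(4,6)])
      moreover have "y q = y s" using False by (intro frozen_at[OF matchedD(3,5)]) simp
      ultimately show ?thesis using matchedD(8) by simp
    qed
    ultimately show ?thesis using q that by (simp add: clk redirect_at)
  qed
  show ?thesis
    unfolding matched_def rem lt sq clk[OF order_refl]
    using r0 v0 vt pos path
    by (simp add: redirect_in_path_space y_rc z_rc stop_path_redirect redirect_at)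
qed

end

end


context weighted_graph
begin

lemma rvrjp_density_eq:
  "rvrjp_density w \<Phi> x0 t z =
    weight x0 (\<lambda>j. sqrt ((\<Phi> j)\<^sup>2 - 2 * local_time z j (\<sigma>X z))) (z (\<sigma>X z))"
  by (simp only: rvrjp_density_def weight_def \<sigma>X_def Let_def)

lemma measurable_rvrjp_density: "rvrjp_density w \<Phi> x0 t \<in> borel_measurable path_space"
proof -
  have [measurable]: "(\<lambda>z. sqrt ((\<Phi> j)\<^sup>2 - 2 * local_time z j (\<sigma>X z))) \<in> borel_measurable path_space" for j
    using measurable_local_time[OF X.\<sigma>_measurable measurable_ident_sets[OF refl], of j] by measurable
  have pos: "(\<lambda>z. z (\<sigma>X z)) \<in> measurable path_space (count_space (UNIV :: 'v set))"
    by (rule measurable_path_at[OF X.\<sigma>_measurable measurable_ident_sets[OF refl]])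
  have "(\<lambda>z. weight x0 (\<lambda>j. sqrt ((\<Phi> j)\<^sup>2 - 2 * local_time z j (\<sigma>X z))) (z (\<sigma>X z))) \<in> borel_measurable path_space"
  proof (rule measurable_compose_countable[OF _ pos, where f = "\<lambda>i z. weight x0 (\<lambda>j. sqrt ((\<Phi> j)\<^sup>2 - 2 * local_time z j (\<sigma>X z))) i"])
    fix i
    show "(\<lambda>z. weight x0 (\<lambda>j. sqrt ((\<Phi> j)\<^sup>2 - 2 * local_time z j (\<sigma>X z))) i) \<in> borel_measurable path_space"
      unfolding weight_def dirichlet_def by measurable
  qed
  then show ?thesis by (simp only: rvrjp_density_eq[abs_def])
qed

section \<open>The law of the time-changed process\<close>

text \<open>By induction on the number of jumps. The terms without a further jump agree by \<open>weight_move\<close>. In the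
  other term the substitution \<open>v = g r\<close>, which is the clock while waiting, turns the jump time of the Markov
  process into the one of the reinforced process; after the jump the histories are matched again.\<close>

lemma picard_matched:
  assumes F: "F \<in> borel_measurable path_space" and m: "matched y s z u"
  shows "ennreal (weight x0 (\<lambda>j. remaining \<Phi> y j s) (y s)) * Y.picard (\<lambda>y. F (changed y)) n s y =
    X.picard (\<lambda>z. ennreal (rvrjp_density w \<Phi> x0 t z) * F z) n u z"
  using m
proof (induction n arbitrary: y s z u)
  case (Suc n)
  note m = Suc.prems
  let ?GY = "\<lambda>y. F (changed y)" and ?GX = "\<lambda>z. ennreal (rvrjp_density w \<Phi> x0 t z) * F z"
  have GY: "?GY \<in> borel_measurable path_space"
    by (rule measurable_compose[OF measurable_changed F])
  have GX: "?GX \<in> borel_measurable path_space"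
    using measurable_rvrjp_density F by measurable
  define i where "i = y s"
  define L where "L = (\<lambda>j. remaining \<Phi> y j s)"
  define W where "W = (\<Sum>j\<in>UNIV. w i j)"
  define c where "c = (\<Sum>j\<in>UNIV. w i j * L j)"
  define a where "a r = L i - (r - s)" for r
  define g where "g r = u + ((L i)\<^sup>2 - (a r)\<^sup>2) / 2" for r
  define \<rho> where "\<rho> = weight x0 L i"
  let ?\<sigma> = "\<sigma>Y y" and ?h = "horizon y"
  note rc = y_rc[OF m]
  have L_pos: "0 < L j" for j using matchedD(10)[OF m] by (simp add: L_def)
  have \<rho>0: "0 \<le> \<rho>" unfolding \<rho>_def by (rule weight_nonneg[OF L_pos])
  have zu: "z u = i" and s0: "0 \<le> s" using matchedD[OF m] by (simp_all add: i_def)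
  have s\<sigma>: "s \<le> ?\<sigma>" and uh: "u \<le> ?h" using s_le[OF m] u_le[OF m] .
  have \<sigma>_end: "?\<sigma> \<le> s + L i" using \<sigma>Y(2)[OF rc] end_after[OF m] by (simp add: L_def i_def)
  have remaining_r: "(\<lambda>j. remaining \<Phi> y j r) = L(i := a r)" if "s \<le> r" for r
    using remaining_after[OF m that] by (simp add: L_def i_def a_def)
  have clock_r: "clock \<Phi> y r = g r" if "s \<le> r" for r
    using clock_after[OF m that] by (simp add: g_def L_def i_def a_def)
  have g_ends: "g s = u" "g ?\<sigma> = ?h"
    using clock_r[OF s\<sigma>] \<sigma>Y(3)[OF rc] by (simp_all add: g_def a_def)
  have rate_s: "rateY y s j = w i j * L j" for j
    using end_after[OF m] L_pos[of i] by (simp add: rateY_def L_def i_def)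
  have totals: "(\<Sum>j\<in>UNIV. rateY y s j) = c" "(\<Sum>j\<in>UNIV. w (z u) j) = W"
    by (simp_all add: rate_s c_def zu W_def)
  have weight_r: "weight x0 (L(i := a r)) i = \<rho> * exp (W * (g r - u) - c * (r - s))" for r
    unfolding weight_move \<rho>_def by (simp add: W_def c_def g_def a_def)
  have density: "rvrjp_density w \<Phi> x0 t z = \<rho> * exp (W * (?h - u) - c * (?\<sigma> - s))"
  proof -
    have "(\<lambda>j. sqrt ((\<Phi> j)\<^sup>2 - 2 * local_time z j ?h)) = L(i := a ?\<sigma>)"
    proof
      fix j
      have nn: "0 \<le> (L(i := a ?\<sigma>)) j"
        unfolding remaining_r[OF s\<sigma>, symmetric] by (rule remaining_nonneg[OF rc \<sigma>Y(1,2)[OF rc]])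
      have "(\<Phi> j)\<^sup>2 - 2 * local_time z j ?h = (L j)\<^sup>2 - (if j = i then 2 * (?h - u) else 0)"
        using local_time_after[OF m uh, of j] by (simp add: L_def i_def)
      also have "\<dots> = ((L(i := a ?\<sigma>)) j)\<^sup>2"
        using g_ends(2) by (cases "j = i") (simp_all add: g_def field_simps)
      finally show "sqrt ((\<Phi> j)\<^sup>2 - 2 * local_time z j ?h) = (L(i := a ?\<sigma>)) j"
        using nn by (simp only: real_sqrt_abs abs_of_nonneg)
    qed
    moreover have "z ?h = i" using frozen_at[OF matchedD(4,6)[OF m] uh] zu by simp
    ultimately have "rvrjp_density w \<Phi> x0 t z = weight x0 (L(i := a ?\<sigma>)) i"
      unfolding rvrjp_density_eq horizon_after[OF m] by (simp only:)
    then show ?thesis by (simp add: weight_r g_ends)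
  qed
  have stopped: "stop_path ?\<sigma> y = y" "stop_path ?h z = z"
    using frozen_later[OF matchedD(3,5)[OF m] s\<sigma>] frozen_later[OF matchedD(4,6)[OF m] uh] by auto
  have stay: "ennreal \<rho> * (ennreal (exp (- c * (?\<sigma> - s))) * F z) =
      ennreal (exp (- W * (?h - u))) * (ennreal (rvrjp_density w \<Phi> x0 t z) * F z)"
  proof -
    have "exp (- W * (?h - u)) * exp (W * (?h - u) - c * (?\<sigma> - s)) = exp (- c * (?\<sigma> - s))"
      by (simp add: exp_add[symmetric])
    then have "\<rho> * exp (- c * (?\<sigma> - s)) = exp (- W * (?h - u)) * rvrjp_density w \<Phi> x0 t z"
      unfolding density by (simp only: mult.left_commute)
    then show ?thesis
      using \<rho>0 by (simp only: mult.assoc[symmetric] ennreal_mult'[symmetric] ennreal_mult''[symmetric] exp_ge_zero)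
  qed
  let ?JX = "X.jump_weight (X.picard ?GX n) u z" and ?JY = "Y.jump_weight (Y.picard ?GY n) s y"
  have JX_meas: "?JX \<in> borel_measurable borel"
    using matchedD(2)[OF m] by (intro X.measurable_jump_weight[OF X.measurable_picard[OF GX], where g = "\<lambda>_. z"]) auto
  have JY_meas [measurable]: "?JY \<in> borel_measurable borel"
    using matchedD(1)[OF m] by (intro Y.measurable_jump_weight[OF Y.measurable_picard[OF GY], where g = "\<lambda>_. y"]) auto
  have jump: "ennreal \<rho> * ?JY r = ?JX (g r) * ennreal (a r)" if r: "s \<le> r" "r < ?\<sigma>" for r
  proof -
    have a_pos: "0 < a r" using r \<sigma>_end by (simp add: a_def)
    have pos: "0 < (L(i := a r)) j" for j using a_pos L_pos by simp
    have target: "ennreal \<rho> * (ennreal (rateY y s j * exp (- c * (r - s))) * Y.picard ?GY n r (redirect y r j)) =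
        ennreal (w i j * exp (- W * (g r - u))) * X.picard ?GX n (g r) (redirect z (g r) j) * ennreal (a r)" for j
    proof -
      have "(\<lambda>k. remaining \<Phi> (redirect y r j) k r) = L(i := a r)"
      proof -
        have "remaining \<Phi> (redirect y r j) k r = remaining \<Phi> y k r" for k
          by (rule clock_cong(2)) (simp add: redirect_at)
        then show ?thesis using remaining_r[OF r(1)] by (simp add: fun_eq_iff)
      qed
      moreover have "redirect y r j r = j" using s0 r by (simp add: redirect_at)
      ultimately have IH: "X.picard ?GX n (g r) (redirect z (g r) j) =
          ennreal (weight x0 (L(i := a r)) j) * Y.picard ?GY n r (redirect y r j)"
        using Suc.IH[OF matched_redirect[OF m r, of j]] by (simp only: clock_r[OF r(1)])
      have real_eq: "\<rho> * (w i j * L j * exp (- c * (r - s))) =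
          w i j * exp (- W * (g r - u)) * weight x0 (L(i := a r)) j * a r"
      proof (cases "j = i")
        case True then show ?thesis by (simp add: w_loop)
      next
        case False
        have "weight x0 (L(i := a r)) j * a r = weight x0 (L(i := a r)) i * L j"
          using weight_switch[of "L(i := a r)" x0 j i, OF pos] False by simp
        also have "\<dots> = \<rho> * exp (W * (g r - u) - c * (r - s)) * L j" by (simp only: weight_r)
        finally have "w i j * exp (- W * (g r - u)) * weight x0 (L(i := a r)) j * a r =
            w i j * (exp (- W * (g r - u)) * exp (W * (g r - u) - c * (r - s))) * \<rho> * L j"
          by (simp add: mult.assoc mult.left_commute)
        also have "exp (- W * (g r - u)) * exp (W * (g r - u) - c * (r - s)) = exp (- c * (r - s))"
          by (simp add: exp_add[symmetric])
        finally show ?thesis by (simp only: ac_simps)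
      qed
      have "ennreal \<rho> * ennreal (rateY y s j * exp (- c * (r - s))) =
          ennreal (w i j * exp (- W * (g r - u)) * weight x0 (L(i := a r)) j * a r)"
        by (simp only: rate_s real_eq[symmetric] ennreal_mult'[OF \<rho>0])
      also have "\<dots> = ennreal (w i j * exp (- W * (g r - u))) * ennreal (weight x0 (L(i := a r)) j) * ennreal (a r)"
        using a_pos w_nonneg[of i j] weight_nonneg[of "L(i := a r)" x0 j, OF pos]
        by (simp only: ennreal_mult mult_nonneg_nonneg exp_ge_zero less_imp_le)
      finally have "ennreal \<rho> * ennreal (rateY y s j * exp (- c * (r - s))) =
          ennreal (w i j * exp (- W * (g r - u))) * ennreal (weight x0 (L(i := a r)) j) * ennreal (a r)" .
      then show ?thesis unfolding IH by (simp only: mult.assoc[symmetric]) (simp only: mult.assoc mult.commute[of "ennreal (a r)"])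
    qed
    show ?thesis
      unfolding X.jump_weight_def Y.jump_weight_def sum_distrib_left sum_distrib_right
      using target by (simp add: zu W_def[symmetric] rate_s c_def[symmetric])
  qed
  have substitution: "(\<integral>\<^sup>+v. ?JX v * indicator {u..?h} v \<partial>lborel) =
      (\<integral>\<^sup>+r. ?JX (g r) * ennreal (a r) * indicator {s..?\<sigma>} r \<partial>lborel)"
  proof (cases "s = ?\<sigma>")
    case True
    then have "?h = u" using g_ends by simp
    then show ?thesis using nn_integral_singleton[of ?JX u]
        nn_integral_singleton[of "\<lambda>r. ?JX (g r) * ennreal (a r)" s] True by simp
  next
    case False
    have "(\<integral>\<^sup>+v. ?JX v * indicator {g s..g ?\<sigma>} v \<partial>lborel) =
      (\<integral>\<^sup>+r. ?JX (g r) * ennreal (a r) * indicator {s..?\<sigma>} r \<partial>lborel)"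
    proof (rule nn_integral_substitution_aux[OF JX_meas])
      show "(g has_real_derivative a r) (at r)" for r
        unfolding g_def a_def by (auto intro!: derivative_eq_intros)
      show "continuous_on {s..?\<sigma>} a" unfolding a_def by (intro continuous_intros)
      show "0 \<le> a r" if "r \<in> {s..?\<sigma>}" for r using that \<sigma>_end by (simp add: a_def)
    qed (use s\<sigma> False in auto)
    then show ?thesis by (simp only: g_ends)
  qed
  have "ennreal \<rho> * (\<integral>\<^sup>+r. ?JY r * indicator {s..?\<sigma>} r \<partial>lborel) =
      (\<integral>\<^sup>+r. ennreal \<rho> * (?JY r * indicator {s..?\<sigma>} r) \<partial>lborel)"
    by (intro nn_integral_cmult[symmetric]) measurable
  also have "\<dots> = (\<integral>\<^sup>+r. ?JX (g r) * ennreal (a r) * indicator {s..?\<sigma>} r \<partial>lborel)"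
  \<comment> \<open>At the stopping time the remaining local time may be zero, and the histories cease to be matched.\<close>
  proof (rule nn_integral_cong_AE, use AE_lborel_singleton[of ?\<sigma>] in eventually_elim)
    fix r assume "r \<noteq> ?\<sigma>"
    then show "ennreal \<rho> * (?JY r * indicator {s..?\<sigma>} r) = ?JX (g r) * ennreal (a r) * indicator {s..?\<sigma>} r"
      using jump[of r] by (cases "r \<in> {s..?\<sigma>}") (simp_all add: mult.assoc[symmetric])
  qed
  finally have integral: "ennreal \<rho> * (\<integral>\<^sup>+r. ?JY r * indicator {s..?\<sigma>} r \<partial>lborel) =
      (\<integral>\<^sup>+v. ?JX v * indicator {u..?h} v \<partial>lborel)" unfolding substitution .
  have "Y.picard ?GY (Suc n) s y = ennreal (exp (- c * (?\<sigma> - s))) * F z +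
      (\<integral>\<^sup>+r. ?JY r * indicator {s..?\<sigma>} r \<partial>lborel)"
    unfolding Y.picard_Suc Y.first_step_def if_P[OF s\<sigma>] stopped changed_after[OF m]
    by (simp only: totals)
  moreover have "X.picard ?GX (Suc n) u z = ennreal (exp (- W * (?h - u))) * (ennreal (rvrjp_density w \<Phi> x0 t z) * F z) +
      (\<integral>\<^sup>+v. ?JX v * indicator {u..?h} v \<partial>lborel)"
    unfolding X.picard_Suc X.first_step_def horizon_after[OF m] if_P[OF uh] stopped
    by (simp only: totals)
  ultimately show ?case
    unfolding i_def[symmetric] L_def[symmetric] \<rho>_def[symmetric]
    by (simp only: distrib_left stay integral)
qed simp

lemma exhaustion_time_restrict: "exhaustion_time \<Phi> (restrict x {0..}) = exhaustion_time \<Phi> x"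
  by (simp only: exhaustion_time_def local_time_restrict)

text \<open>Processes are given as families of functions on all reals, the path space only records
  nonnegative times.\<close>

lemma changed_restrict:
  assumes x: "right_continuous_path x"
  shows "changed (restrict x {0..}) = changed x"
proof -
  have rem: "remaining \<Phi> (restrict x {0..}) = remaining \<Phi> x"
    by (simp only: remaining_def[abs_def] local_time_restrict)
  have clk: "clock \<Phi> (restrict x {0..}) = clock \<Phi> x" "rvrjp_end \<Phi> (restrict x {0..}) = rvrjp_end \<Phi> x"
    by (simp_all only: clock_def[abs_def] rvrjp_end_def rem)
  have h: "horizon (restrict x {0..}) = horizon x" and inv: "inverse_clock (restrict x {0..}) = inverse_clock x"
    by (simp_all only: horizon_def time_changed_end_def inverse_clock_def clk)
  show ?thesis
  proof
    fix u
    show "changed (restrict x {0..}) u = changed x u"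
    proof (cases "0 \<le> u")
      case True
      have "0 \<le> inverse_clock x (min u (horizon x))"
        using True horizon_bounds[OF x] by (intro inverse_clock(1)[OF x]) auto
      then show ?thesis by (simp add: changed_at[OF True] h inv)
    qed (simp add: changed_def stop_path_def)
  qed
qed

theorem time_changed_law_eq_density:
  assumes X: "jump_process (\<lambda>x r j. w (x r) j) x0 N X" and Y: "jump_process rateY x0 M Y"
  shows "time_changed_rvrjp_law \<Phi> t M Y =
    density (markov_jump_law \<Phi> t N X) (\<lambda>z. ennreal (rvrjp_density w \<Phi> x0 t z))"
    and "finite_measure (markov_jump_law \<Phi> t N X)"
proof -
  interpret PX: rate_process "\<lambda>x r j. w (x r) j" \<sigma>X "\<Sum>i\<in>UNIV. \<Sum>j\<in>UNIV. w i j" t x0 N X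
    by (intro rate_process.intro rate_process_axioms.intro X.rate_functional_axioms X)
  interpret PY: rate_process rateY \<sigma>Y "\<Sum>i\<in>UNIV. \<Sum>j\<in>UNIV. w i j * \<Phi> j" "\<Sum>i\<in>UNIV. \<Phi> i" x0 M Y
    by (intro rate_process.intro rate_process_axioms.intro Y.rate_functional_axioms Y)
  let ?start = "restrict (\<lambda>_. x0) {0..}"
  have LX: "markov_jump_law \<Phi> t N X = distr N path_space (\<lambda>\<omega>. X.stopped (PX.trajectory \<omega>))"
    unfolding markov_jump_law_def stopped_law_def
  proof (rule distr_cong[OF refl refl])
    fix \<omega> assume \<omega>: "\<omega> \<in> space N"
    have "X.stopped (PX.trajectory \<omega>) = stop_path (\<sigma>X (PX.trajectory \<omega>)) (\<lambda>s. X s \<omega>)"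
      unfolding PX.trajectory_def
      by (rule stop_path_restrict) (rule X.\<sigma>_nonneg[OF restrict_in_path_space[OF PX.Y_rc[OF \<omega>]]])
    then show "stop_path (min t (exhaustion_time \<Phi> (\<lambda>s. X s \<omega>))) (\<lambda>s. X s \<omega>) = X.stopped (PX.trajectory \<omega>)"
      by (simp only: \<sigma>X_def PX.trajectory_def exhaustion_time_restrict)
  qed
  have LY: "time_changed_rvrjp_law \<Phi> t M Y = distr M path_space (\<lambda>\<omega>. changed (PY.trajectory \<omega>))"
    unfolding time_changed_rvrjp_law_def stopped_law_def
  proof (rule distr_cong[OF refl refl])
    fix \<omega> assume "\<omega> \<in> space M"
    from changed_restrict[OF PY.Y_rc[OF this]]
    show "stop_path (min t (time_changed_end \<Phi> (\<lambda>s. Y s \<omega>))) (time_changed \<Phi> (\<lambda>s. Y s \<omega>)) =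
        changed (PY.trajectory \<omega>)"
      by (simp only: PY.trajectory_def changed_def horizon_def)
  qed
  note meas_X = measurable_compose[OF PX.measurable_trajectory X.measurable_stopped]
  note meas_Y = measurable_compose[OF PY.measurable_trajectory measurable_changed]
  show "finite_measure (markov_jump_law \<Phi> t N X)"
    unfolding LX by (rule PX.finite_measure_distr[OF meas_X])
  show "time_changed_rvrjp_law \<Phi> t M Y =
      density (markov_jump_law \<Phi> t N X) (\<lambda>z. ennreal (rvrjp_density w \<Phi> x0 t z))"
  proof (rule measure_eqI)
    show "sets (time_changed_rvrjp_law \<Phi> t M Y) =
        sets (density (markov_jump_law \<Phi> t N X) (\<lambda>z. ennreal (rvrjp_density w \<Phi> x0 t z)))"
      by (simp add: LX LY)
    fix A assume "A \<in> sets (time_changed_rvrjp_law \<Phi> t M Y)"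
    then have A: "A \<in> sets path_space" by (simp add: LY)
    let ?F = "indicator A :: _ \<Rightarrow> ennreal"
    let ?GY = "\<lambda>y. ?F (changed y)" and ?GX = "\<lambda>z. ennreal (rvrjp_density w \<Phi> x0 t z) * ?F z"
    have F: "?F \<in> borel_measurable path_space" using A by measurable
    have GY: "?GY \<in> borel_measurable path_space" by (rule measurable_compose[OF measurable_changed F])
    have GX: "?GX \<in> borel_measurable path_space" using measurable_rvrjp_density F by measurable
    have "emeasure (time_changed_rvrjp_law \<Phi> t M Y) A = (\<integral>\<^sup>+z. ?F z \<partial>time_changed_rvrjp_law \<Phi> t M Y)"
      using A by (intro nn_integral_indicator[symmetric]) (simp add: LY)
    also have "\<dots> = (\<integral>\<^sup>+\<omega>. ?GY (PY.trajectory \<omega>) \<partial>M)"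
      unfolding LY using meas_Y F by (intro nn_integral_distr) simp_all
    also have "\<dots> = (\<integral>\<^sup>+\<omega>. ?GY (Y.stopped (PY.trajectory \<omega>)) \<partial>M)"
    proof (rule nn_integral_cong)
      fix \<omega> assume "\<omega> \<in> space M"
      note y = PY.trajectory_in[OF this]
      note rc = path_space_rc[OF y] path_space_rc[OF Y.stopped_in[OF y]]
      \<comment> \<open>The time-changed path is observed up to the image of the stopping time only.\<close>
      have "changed (Y.stopped (PY.trajectory \<omega>)) = changed (PY.trajectory \<omega>)"
        by (rule changed_agree[OF rc]) (simp add: stop_path_at min_absorb1)
      then show "?GY (PY.trajectory \<omega>) = ?GY (Y.stopped (PY.trajectory \<omega>))" by simp
    qed
    also have "\<dots> = (SUP n. Y.picard ?GY n 0 ?start)" by (rule PY.stopped_expectation[OF GY])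
    also have "\<dots> = (SUP n. X.picard ?GX n 0 ?start)"
    proof (rule SUP_cong[OF refl])
      fix n
      have "(\<lambda>j. remaining \<Phi> ?start j 0) = \<Phi>" by (simp add: remaining_def)
      then show "Y.picard ?GY n 0 ?start = X.picard ?GX n 0 ?start"
        using picard_matched[OF F matched_start, of x0 x0 n] by (simp add: weight_start)
    qed
    also have "\<dots> = (\<integral>\<^sup>+\<omega>. ?GX (X.stopped (PX.trajectory \<omega>)) \<partial>N)"
      by (rule PX.stopped_expectation[OF GX, symmetric])
    also have "\<dots> = (\<integral>\<^sup>+z. ?GX z \<partial>markov_jump_law \<Phi> t N X)"
      unfolding LX using meas_X GX by (intro nn_integral_distr[symmetric]) simp_all
    also have "\<dots> = emeasure (density (markov_jump_law \<Phi> t N X) (\<lambda>z. ennreal (rvrjp_density w \<Phi> x0 t z))) A"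
      using A measurable_rvrjp_density[of x0]
      by (intro emeasure_density[symmetric]) (simp_all add: LX)
    finally show "emeasure (time_changed_rvrjp_law \<Phi> t M Y) A =
      emeasure (density (markov_jump_law \<Phi> t N X) (\<lambda>z. ennreal (rvrjp_density w \<Phi> x0 t z))) A" .
  qed
qed

end

theorem theorem4:
  fixes E :: "'v::finite set set"
    and W :: "'v set \<Rightarrow> real"
    and \<Phi> :: "'v \<Rightarrow> real"
    and x0 :: 'v
    and t :: real
    and N :: "'n measure" and X :: "real \<Rightarrow> 'n \<Rightarrow> 'v"
    and M :: "'m measure" and Y :: "real \<Rightarrow> 'm \<Rightarrow> 'v"
  assumes "connected_simple_graph E"
    and "\<And>e. e \<in> E \<Longrightarrow> W e > 0"
    and "\<And>i. \<Phi> i > 0"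
    and "t \<ge> 0"
    and "markov_jump_process (conductance E W) x0 N X"
    and "rvrjp (conductance E W) \<Phi> x0 M Y"
  shows "absolutely_continuous (markov_jump_law \<Phi> t N X) (time_changed_rvrjp_law \<Phi> t M Y) \<and>
    rvrjp_density (conductance E W) \<Phi> x0 t \<in> borel_measurable (markov_jump_law \<Phi> t N X) \<and>
    (AE x in markov_jump_law \<Phi> t N X.
       RN_deriv (markov_jump_law \<Phi> t N X) (time_changed_rvrjp_law \<Phi> t M Y) x
       = ennreal (rvrjp_density (conductance E W) \<Phi> x0 t x))"
proof -
  let ?w = "conductance E W" and ?LX = "markov_jump_law \<Phi> t N X" and ?LY = "time_changed_rvrjp_law \<Phi> t M Y"
  interpret weighted_graph ?w \<Phi> t
  proof
    fix i j :: 'v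
    have "card {i} = 1" by simp
    then have "{i, i} \<notin> E" using assms(1) unfolding connected_simple_graph_def by fastforce
    then show "?w i i = 0" by (simp add: conductance_def)
    show "0 \<le> ?w i j" using assms(2)[of "{i, j}"] by (auto simp: conductance_def intro: less_imp_le)
    show "?w i j = ?w j i" by (simp add: conductance_def insert_commute)
  qed (use assms in auto)
  have X: "jump_process (\<lambda>x r j. ?w (x r) j) x0 N X"
    using assms(5) by (simp only: markov_jump_process_def)
  have Y: "jump_process rateY x0 M Y"
    using assms(6) by (simp only: rvrjp_def rateY_def[abs_def])
  let ?\<rho> = "\<lambda>z. ennreal (rvrjp_density ?w \<Phi> x0 t z)"
  have sets: "sets ?LX = sets path_space"
    by (simp add: markov_jump_law_def stopped_law_def)
  have meas: "rvrjp_density ?w \<Phi> x0 t \<in> borel_measurable ?LX"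
    using measurable_rvrjp_density[of x0] by (simp only: measurable_cong_sets[OF sets refl])
  then have \<rho>_meas: "?\<rho> \<in> borel_measurable ?LX" by measurable
  have law: "density ?LX ?\<rho> = ?LY" by (rule time_changed_law_eq_density(1)[OF X Y, symmetric])
  interpret LX: finite_measure ?LX by (rule time_changed_law_eq_density(2)[OF X Y])
  have "AE x in ?LX. ?\<rho> x = RN_deriv ?LX ?LY x"
    by (rule LX.RN_deriv_unique[OF \<rho>_meas law])
  then have "AE x in ?LX. RN_deriv ?LX ?LY x = ?\<rho> x" by (rule AE_mp) (simp add: eq_commute)
  moreover have "absolutely_continuous ?LX ?LY"
    unfolding law[symmetric] by (rule absolutely_continuousI_density[OF \<rho>_meas])
  ultimately show ?thesis using meas by blast
qed

end
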